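(* Let $d\ge1$, $\nu>0$, $\beta\in(0,1)$, $\alpha\in(0,2)$. Suppose that $\sigma:\mathbb{R}\to\mathbb{R}$ is globally Lipschitz and that $b:\mathbb{R}\to\mathbb{R}$ is locally Lipschitz and there is $\eta>0$ with $b(x)\ge|x|^{1+\eta}$ for all $x\in\mathbb{R}$. Consider $$\partial_t^\beta u_t(x)=-\nu(-\Delta)^{\alpha/2}u_t(x)+I^{1-\beta}[b(u_t(x))+\sigma(u)\dot F(t,x)],\qquad t>0,\ x\in\mathbb{R}^d,$$ with nonnegative bounded deterministic initial condition $u_0$, where the noise $\dot F$ is either space-time white noise (in which case $d<(2\wedge\beta^{-1})\alpha$) or spatially colored as described in the context. Then this equation has no (global) random field solution in each of the following cases: 1. $\inf_{x\in\mathbb{R}^d}u_0(x)>\kappa>0$ and $\eta>0$; 2. $\|u_0\|_{L^1(\mathbb{R}^d)}>0$ and $\beta d\eta/\alpha<1$.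
   Context: $\partial_t^\beta$ is the Caputo derivative, $\partial_t^\beta u_t(x)=\frac{1}{\Gamma(1-\beta)}\int_0^t\frac{\partial u_r(x)}{\partial r}\frac{dr}{(t-r)^\beta}$, and $I^{\gamma'}h(t)=\frac{1}{\Gamma(\gamma')}\int_0^t(t-\tau)^{\gamma'-1}h(\tau)\,d\tau$ for $\gamma'>0$. The operator $-\nu(-\Delta)^{\alpha/2}$ is the generator of the isotropic $\alpha$-stable Lévy process $X$ with transition density $p(t,x)$ determined by $\int_{\mathbb{R}^d}e^{i\xi\cdot x}p(t,x)\,dx=e^{-t\nu|\xi|^\alpha}$. Let $D$ be a $\beta$-stable subordinator independent of $X$ ($\mathbb{E}e^{-\lambda D_r}=e^{-r\lambda^\beta}$), $E_t=\inf\{r:D_r>t\}$ its first passage time with density $f_{E_t}$, and $G_t(x)=\int_0^\infty p(s,x)f_{E_t}(s)\,ds$ the density of $X_{E_t}$. Noise: space-time white noise means centered Gaussian with $\mathbb{E}[\dot F(s,x)\dot F(t,y)]=\delta_0(t-s)\delta_0(x-y)$. Colored noise means centered Gaussian with $\mathbb{E}[\dot F(s,x)\dot F(t,y)]=\delta_0(t-s)f(x,y)$, where $f(x,y)\le g(x-y)$ with $g$ locally integrable on $\mathbb{R}^d$, possibly singular at $0$, and $\int_{\mathbb{R}^d}\frac{\hat g(\xi)}{1+|\xi|^\alpha}\,d\xi<\infty$ ($\hat g$ is the Fourier transform of $g$). A mild solution in the sense of Walsh is a $u$ adapted to the filtration generated by the noise with $$u_t(x)=\int_{\mathbb{R}^d}G_t(x-y)u_0(y)\,dy+\int_{\mathbb{R}^d}\int_0^tb(u_s(y))G_{t-s}(x-y)\,ds\,dy+\int_{\mathbb{R}^d}\int_0^tG_{t-s}(x-y)\sigma(u_s(y))\,F(ds\,dy).$$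 A mild solution is a random field solution on $[0,T]$ if $\sup_{x\in\mathbb{R}^d}\sup_{t\in[0,T]}\mathbb{E}|u_t(x)|^k<\infty$ for all $k\in[2,\infty)$. It is global if it is defined and is a random field solution on $[0,T]$ for every $T>0$. *)

theory Defs
  imports "HOL-Probability.Probability"
begin

text \<open>
  The space \<open>\<real>\<^sup>d\<close> is a type \<open>'a\<close> of class \<open>euclidean_space\<close> with \<open>d = DIM('a)\<close>; sample points
  have type \<open>'w\<close> (noise) or \<open>'v\<close> (subordinator).
\<close>

section \<open>The kernel G\<close>

text \<open>
  The characteristic function fixes \<open>p t\<close> up to null sets only; asking for continuity selects the
  usual version and makes \<open>p\<close> jointly measurable.
\<close>

definition stable_density :: "real \<Rightarrow> real \<Rightarrow> (real \<Rightarrow> 'a::euclidean_space \<Rightarrow> real) \<Rightarrow> bool" where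
  "stable_density \<nu> \<alpha> p \<longleftrightarrow>
     continuous_on ({0<..} \<times> UNIV) (\<lambda>(t, x). p t x) \<and>
     (\<forall>t>0. (\<forall>x. 0 \<le> p t x) \<and> integrable lborel (p t) \<and>
        (\<forall>\<xi>. (CLINT x|lborel. cis (\<xi> \<bullet> x) * of_real (p t x))
             = of_real (exp (- (t * \<nu> * norm \<xi> powr \<alpha>)))))"

definition stable_subordinator :: "real \<Rightarrow> 'v measure \<Rightarrow> (real \<Rightarrow> 'v \<Rightarrow> real) \<Rightarrow> bool" where
  "stable_subordinator \<beta> N D \<longleftrightarrow>
     prob_space N \<and>
     (\<forall>r\<ge>0. D r \<in> borel_measurable N) \<and>
     (\<forall>\<omega>\<in>space N. D 0 \<omega> = 0 \<and> mono_on {0..} (\<lambda>r. D r \<omega>) \<and>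
        (\<forall>r\<ge>0. continuous (at_right r) (\<lambda>r. D r \<omega>))) \<and>
     (\<forall>(n::nat) \<tau>. 0 \<le> \<tau> 0 \<and> incseq \<tau> \<longrightarrow>
        prob_space.indep_vars N (\<lambda>_. borel) (\<lambda>i \<omega>. D (\<tau> (Suc i)) \<omega> - D (\<tau> i) \<omega>) {..<n}) \<and>
     (\<forall>r\<ge>0. \<forall>s\<ge>0. \<forall>\<theta>\<ge>0.
        (LINT \<omega>|N. exp (- \<theta> * (D (r + s) \<omega> - D r \<omega>))) = exp (- s * \<theta> powr \<beta>))"

definition first_passage :: "(real \<Rightarrow> 'v \<Rightarrow> real) \<Rightarrow> real \<Rightarrow> 'v \<Rightarrow> real" where
  "first_passage D t \<omega> = Inf {r. 0 \<le> r \<and> D r \<omega> > t}"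

definition first_passage_density ::
    "'v measure \<Rightarrow> (real \<Rightarrow> 'v \<Rightarrow> real) \<Rightarrow> (real \<Rightarrow> real \<Rightarrow> real) \<Rightarrow> bool" where
  "first_passage_density N D fE \<longleftrightarrow>
     (\<forall>t>0. (\<forall>s. 0 \<le> fE t s) \<and>
        distributed N lborel (first_passage D t) (\<lambda>s. ennreal (fE t s)))"

text \<open>
  The integral may diverge at \<open>x = 0\<close>, where the value is then 0; this is a Lebesgue null set,
  and the kernel occurs under spatial integrals only.
\<close>

definition kernel_G ::
    "(real \<Rightarrow> 'a::euclidean_space \<Rightarrow> real) \<Rightarrow> (real \<Rightarrow> real \<Rightarrow> real) \<Rightarrow> real \<Rightarrow> 'a \<Rightarrow> real" where
  "kernel_G p fE t x = (LINT s:{0<..}|lborel. p s x * fE t s)"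

section \<open>Fourier transform of a locally integrable function\<close>

definition locally_integrable :: "('a::euclidean_space \<Rightarrow> real) \<Rightarrow> bool" where
  "locally_integrable g \<longleftrightarrow> g \<in> borel_measurable borel \<and> (\<forall>R. set_integrable lborel (cball 0 R) g)"

definition smooth :: "('a::euclidean_space \<Rightarrow> real) \<Rightarrow> bool" where
  "smooth \<psi> \<longleftrightarrow> (\<forall>is. set is \<subseteq> Basis \<longrightarrow>
     foldr (\<lambda>i h x. frechet_derivative h (at x) i) is \<psi> differentiable_on UNIV)"

definition test_function :: "('a::euclidean_space \<Rightarrow> real) \<Rightarrow> bool" where
  "test_function \<psi> \<longleftrightarrow> smooth \<psi> \<and> bounded {x. \<psi> x \<noteq> 0}"

text \<open>
  Kernels such as \<open>norm x powr -\<gamma>\<close> are not Lebesgue integrable, so their Fourier transform is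
  that of a tempered distribution. It is a function \<open>gh\<close> iff \<open>g\<close> is, as a distribution, the inverse
  transform of \<open>gh\<close>; this is tested against \<open>C\<^sub>c\<^sup>\<infinity>\<close>. The convention is
  \<open>gh \<xi> = \<integral> exp (-i \<xi>\<bullet>x) g x dx\<close>.
\<close>

definition has_fourier_transform ::
    "('a::euclidean_space \<Rightarrow> real) \<Rightarrow> ('a \<Rightarrow> complex) \<Rightarrow> bool" where
  "has_fourier_transform g gh \<longleftrightarrow>
     gh \<in> borel_measurable borel \<and>
     (\<forall>\<psi>. test_function \<psi> \<longrightarrow>
        integrable lborel (\<lambda>\<xi>. gh \<xi> * (CLINT x|lborel. cis (\<xi> \<bullet> x) * of_real (\<psi> x))) \<and>
        of_real (LINT x|lborel. g x * \<psi> x) =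
          (CLINT \<xi>|lborel. gh \<xi> * (CLINT x|lborel. cis (\<xi> \<bullet> x) * of_real (\<psi> x)))
            / of_real ((2 * pi) ^ DIM('a)))"

section \<open>The noise\<close>

text \<open>
  \<open>White\<close> stands for the spatial correlation \<open>\<delta>\<^sub>0 (x - y)\<close>, \<open>Colored f\<close> for \<open>f x y\<close>.
\<close>

datatype 'a correlation = White | Colored "'a \<Rightarrow> 'a \<Rightarrow> real"

text \<open>
  The bound by \<open>g\<close> is not required on the diagonal, where \<open>g\<close> may be singular. Since only an upper
  bound for \<open>f\<close> is available, local integrability of \<open>f\<close> (automatic when \<open>f \<ge> 0\<close>) is demanded
  separately, so that the covariance of the noise is meaningful.
\<close>

primrec admissible_correlation :: "real \<Rightarrow> real \<Rightarrow> 'a::euclidean_space correlation \<Rightarrow> bool" where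
  "admissible_correlation \<alpha> \<beta> White \<longleftrightarrow> real DIM('a) < min 2 (1 / \<beta>) * \<alpha>"
| "admissible_correlation \<alpha> \<beta> (Colored f) \<longleftrightarrow>
     locally_integrable (\<lambda>(x, y). f x y) \<and>
     (\<exists>g gh. locally_integrable g \<and> (\<forall>x y. x \<noteq> y \<longrightarrow> f x y \<le> g (x - y)) \<and>
        has_fourier_transform g gh \<and>
        integrable lborel (\<lambda>\<xi>. gh \<xi> / of_real (1 + norm \<xi> powr \<alpha>)))"

primrec corr_form ::
    "'a::euclidean_space correlation \<Rightarrow> ('a \<Rightarrow> real) \<Rightarrow> ('a \<Rightarrow> real) \<Rightarrow> real" where
  "corr_form White \<phi> \<psi> = (LINT x|lborel. \<phi> x * \<psi> x)"
| "corr_form (Colored f) \<phi> \<psi> =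
     (LINT (x, y)|(lborel \<Otimes>\<^sub>M lborel). \<phi> x * \<psi> y * f x y)"

definition noise_sets :: "(real \<times> 'a::euclidean_space) set set" where
  "noise_sets = {A. A \<in> sets borel \<and> bounded A \<and> A \<subseteq> {0..} \<times> UNIV}"

text \<open>Degenerate (almost surely zero) variables count as Gaussian.\<close>

definition centered_gaussian :: "'w measure \<Rightarrow> ('w \<Rightarrow> real) \<Rightarrow> bool" where
  "centered_gaussian M X \<longleftrightarrow>
     X \<in> borel_measurable M \<and>
     ((AE \<omega> in M. X \<omega> = 0) \<or> (\<exists>s>0. distributed M lborel X (\<lambda>z. ennreal (normal_density 0 s z))))"

text \<open>
  The noise is the Gaussian random set function \<open>F A = \<integral>\<integral> 1\<^sub>A(s,x) F(ds dx)\<close>, with covariance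
  obtained by integrating \<open>\<delta>\<^sub>0 (t - s) f x y\<close> (or \<open>\<delta>\<^sub>0 (t - s) \<delta>\<^sub>0 (x - y)\<close>). Additivity of \<open>F\<close>
  (almost surely) follows from the covariance.
\<close>

definition gaussian_noise ::
    "'w measure \<Rightarrow> 'a::euclidean_space correlation \<Rightarrow> ((real \<times> 'a) set \<Rightarrow> 'w \<Rightarrow> real) \<Rightarrow> bool" where
  "gaussian_noise M C F \<longleftrightarrow>
     prob_space M \<and>
     (\<forall>J c. finite J \<and> J \<subseteq> noise_sets \<longrightarrow> centered_gaussian M (\<lambda>\<omega>. \<Sum>A\<in>J. c A * F A \<omega>)) \<and>
     (\<forall>A\<in>noise_sets. \<forall>B\<in>noise_sets.
        (LINT \<omega>|M. F A \<omega> * F B \<omega>) =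
        (LINT s:{0..}|lborel. corr_form C (\<lambda>x. indicator A (s, x)) (\<lambda>y. indicator B (s, y))))"

text \<open>The filtration generated by the noise, augmented by the null sets of \<open>M\<close>.\<close>

definition noise_filtration ::
    "'w measure \<Rightarrow> ((real \<times> 'a::euclidean_space) set \<Rightarrow> 'w \<Rightarrow> real) \<Rightarrow> real \<Rightarrow> 'w measure" where
  "noise_filtration M F t = sigma (space M)
     ({F A -` B \<inter> space M | A B. A \<in> noise_sets \<and> A \<subseteq> {0..t} \<times> UNIV \<and> B \<in> sets borel}
      \<union> null_sets M)"

section \<open>The Walsh integral\<close>

text \<open>
  A list entry \<open>(a, b, A, X)\<close> encodes the elementary process \<open>X \<omega> 1\<^bsub>(a,b]\<^esub>(s) 1\<^sub>A(x)\<close>.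
\<close>

type_synonym ('a, 'w) simple_process = "(real \<times> real \<times> 'a set \<times> ('w \<Rightarrow> real)) list"

definition is_simple_process ::
    "'w measure \<Rightarrow> ((real \<times> 'a::euclidean_space) set \<Rightarrow> 'w \<Rightarrow> real) \<Rightarrow> real
      \<Rightarrow> ('a, 'w) simple_process \<Rightarrow> bool" where
  "is_simple_process M F t S \<longleftrightarrow>
     (\<forall>(a, b, A, X) \<in> set S. 0 \<le> a \<and> a < b \<and> b \<le> t \<and> A \<in> sets borel \<and> bounded A \<and>
        X \<in> borel_measurable (noise_filtration M F a) \<and> bounded (X ` space M))"

definition simple_value ::
    "('a, 'w) simple_process \<Rightarrow> real \<Rightarrow> 'a \<Rightarrow> 'w \<Rightarrow> real" where
  "simple_value S s x \<omega> = (\<Sum>(a, b, A, X)\<leftarrow>S. X \<omega> * indicator {a<..b} s * indicator A x)"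

definition simple_integral ::
    "((real \<times> 'a::euclidean_space) set \<Rightarrow> 'w \<Rightarrow> real) \<Rightarrow> ('a, 'w) simple_process \<Rightarrow> 'w \<Rightarrow> real" where
  "simple_integral F S \<omega> = (\<Sum>(a, b, A, X)\<leftarrow>S. X \<omega> * F ({a<..b} \<times> A) \<omega>)"

text \<open>The spatial part of the squared norm given by Walsh's dominating measure.\<close>

primrec dominating_form :: "'a::euclidean_space correlation \<Rightarrow> ('a \<Rightarrow> real) \<Rightarrow> ennreal" where
  "dominating_form White \<phi> = (\<integral>\<^sup>+x. ennreal \<bar>\<phi> x * \<phi> x\<bar> \<partial>lborel)"
| "dominating_form (Colored f) \<phi> =
     (\<integral>\<^sup>+(x, y). ennreal \<bar>\<phi> x * \<phi> y * f x y\<bar> \<partial>(lborel \<Otimes>\<^sub>M lborel))"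

definition walsh_norm_sq ::
    "'w measure \<Rightarrow> 'a::euclidean_space correlation \<Rightarrow> real \<Rightarrow> (real \<Rightarrow> 'a \<Rightarrow> 'w \<Rightarrow> real) \<Rightarrow> ennreal" where
  "walsh_norm_sq M C t \<Phi> =
     (\<integral>\<^sup>+\<omega>. (\<integral>\<^sup>+s\<in>{0<..<t}. dominating_form C (\<lambda>x. \<Phi> s x \<omega>) \<partial>lborel) \<partial>M)"

text \<open>
  \<open>I\<close> is a version of \<open>\<integral>\<integral>\<^bsub>(0,t)\<^esub> \<Phi> s x F(ds dx)\<close>: the \<open>L\<^sup>2\<close> limit of the integrals of simple
  processes that converge to \<open>\<Phi>\<close> in Walsh's norm. Predictability of \<open>\<Phi>\<close>, up to modification on
  null sets, is a consequence of being such a limit.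
\<close>

definition has_walsh_integral ::
    "'w measure \<Rightarrow> 'a::euclidean_space correlation \<Rightarrow> ((real \<times> 'a) set \<Rightarrow> 'w \<Rightarrow> real) \<Rightarrow> real
      \<Rightarrow> (real \<Rightarrow> 'a \<Rightarrow> 'w \<Rightarrow> real) \<Rightarrow> ('w \<Rightarrow> real) \<Rightarrow> bool" where
  "has_walsh_integral M C F t \<Phi> I \<longleftrightarrow>
     (\<lambda>(\<omega>, s, x). \<Phi> s x \<omega>) \<in>
        borel_measurable (M \<Otimes>\<^sub>M restrict_space borel {0<..<t} \<Otimes>\<^sub>M borel) \<and>
     walsh_norm_sq M C t \<Phi> < \<infinity> \<and>
     I \<in> borel_measurable M \<and>
     (\<exists>S. (\<forall>n::nat. is_simple_process M F t (S n)) \<and>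
        (\<lambda>n. walsh_norm_sq M C t (\<lambda>s x \<omega>. simple_value (S n) s x \<omega> - \<Phi> s x \<omega>)) \<longlonglongrightarrow> 0 \<and>
        (\<lambda>n. \<integral>\<^sup>+\<omega>. ennreal ((simple_integral F (S n) \<omega> - I \<omega>)\<^sup>2) \<partial>M) \<longlonglongrightarrow> 0)"

section \<open>Solutions\<close>

definition mild_solution ::
    "'w measure \<Rightarrow> 'a::euclidean_space correlation \<Rightarrow> ((real \<times> 'a) set \<Rightarrow> 'w \<Rightarrow> real)
      \<Rightarrow> (real \<Rightarrow> 'a \<Rightarrow> real) \<Rightarrow> (real \<Rightarrow> real) \<Rightarrow> (real \<Rightarrow> real) \<Rightarrow> ('a \<Rightarrow> real) \<Rightarrow> real
      \<Rightarrow> (real \<Rightarrow> 'a \<Rightarrow> 'w \<Rightarrow> real) \<Rightarrow> bool" where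
  "mild_solution M C F G b \<sigma> u0 T u \<longleftrightarrow>
     (\<lambda>(\<omega>, t, x). u t x \<omega>) \<in> borel_measurable (M \<Otimes>\<^sub>M restrict_space borel {0..T} \<Otimes>\<^sub>M borel) \<and>
     (\<forall>t\<in>{0..T}. \<forall>x. u t x \<in> borel_measurable (noise_filtration M F t)) \<and>
     (\<forall>x. AE \<omega> in M. u 0 x \<omega> = u0 x) \<and>
     (\<forall>t\<in>{0<..T}. \<forall>x. \<exists>I.
        has_walsh_integral M C F t (\<lambda>s y \<omega>. G (t - s) (x - y) * \<sigma> (u s y \<omega>)) I \<and>
        (AE \<omega> in M.
           set_integrable (lborel \<Otimes>\<^sub>M lborel) ({0<..<t} \<times> UNIV)
             (\<lambda>(s, y). b (u s y \<omega>) * G (t - s) (x - y)) \<and>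
           u t x \<omega> =
             (LINT y|lborel. G t (x - y) * u0 y)
             + (LINT (s, y):{0<..<t} \<times> UNIV|(lborel \<Otimes>\<^sub>M lborel). b (u s y \<omega>) * G (t - s) (x - y))
             + I \<omega>))"

definition random_field_solution ::
    "'w measure \<Rightarrow> 'a::euclidean_space correlation \<Rightarrow> ((real \<times> 'a) set \<Rightarrow> 'w \<Rightarrow> real)
      \<Rightarrow> (real \<Rightarrow> 'a \<Rightarrow> real) \<Rightarrow> (real \<Rightarrow> real) \<Rightarrow> (real \<Rightarrow> real) \<Rightarrow> ('a \<Rightarrow> real) \<Rightarrow> real
      \<Rightarrow> (real \<Rightarrow> 'a \<Rightarrow> 'w \<Rightarrow> real) \<Rightarrow> bool" where
  "random_field_solution M C F G b \<sigma> u0 T u \<longleftrightarrow>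
     mild_solution M C F G b \<sigma> u0 T u \<and>
     (\<forall>k\<ge>2. (SUP x. SUP t\<in>{0..T}. \<integral>\<^sup>+\<omega>. ennreal (\<bar>u t x \<omega>\<bar> powr k) \<partial>M) < \<infinity>)"

definition global_random_field_solution ::
    "'w measure \<Rightarrow> 'a::euclidean_space correlation \<Rightarrow> ((real \<times> 'a) set \<Rightarrow> 'w \<Rightarrow> real)
      \<Rightarrow> (real \<Rightarrow> 'a \<Rightarrow> real) \<Rightarrow> (real \<Rightarrow> real) \<Rightarrow> (real \<Rightarrow> real) \<Rightarrow> ('a \<Rightarrow> real)
      \<Rightarrow> (real \<Rightarrow> 'a \<Rightarrow> 'w \<Rightarrow> real) \<Rightarrow> bool" where
  "global_random_field_solution M C F G b \<sigma> u0 u \<longleftrightarrow>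
     (\<forall>T>0. random_field_solution M C F G b \<sigma> u0 T u)"

end

theory Submission
  imports Defs
begin

text \<open>
  Let \<open>v t x\<close> be the expectation of \<open>u t x\<close>. The Walsh integral has mean zero, so by Jensen's inequality
  \<open>v t x \<ge> \<integral> G\<^sub>t(x - y) u\<^sub>0(y) dy + \<integral>\<^sub>0\<^sup>t \<integral> G\<^sub>t\<^sub>-\<^sub>s(x - y) \<bar>v s y\<bar>\<^sup>1\<^sup>+\<^sup>\<eta> dy ds\<close>.
  The kernel is a probability density that is self-similar with exponent \<open>\<gamma> = \<beta> / \<alpha>\<close>: at time \<open>\<tau>\<close> at
  least half of its mass lies within distance \<open>A \<tau>\<^sup>\<gamma>\<close> of the origin. Hence a lower bound \<open>v \<ge> c\<close>
  on a ball during a time interval doubles after a time \<open>4 c\<^sup>-\<^sup>\<eta>\<close>, on a slightly smaller ball; iterating,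
  \<open>v\<close> is infinite after a time of order \<open>c\<^sup>-\<^sup>\<eta>\<close>, provided the initial radius is at least of order
  \<open>c\<^sup>-\<^sup>\<eta>\<^sup>\<gamma>\<close>. In the first case \<open>v \<ge> \<kappa>\<close> everywhere. In the second one, for large \<open>T\<close> and \<open>t\<close> between
  \<open>T\<close> and \<open>(1 + k) T\<close>, the first term gives \<open>v \<ge> c\<close> with \<open>c\<close> of order \<open>T\<^sup>-\<^sup>\<gamma>\<^sup>d\<close> on a ball of
  radius of order \<open>T\<^sup>\<gamma>\<close>, and \<open>\<gamma> d \<eta> < 1\<close> makes \<open>c\<^sup>-\<^sup>\<eta>\<close> small compared with \<open>T\<close>. Only \<open>G 1\<close> being
  bounded below near some point is needed here, so the ball is not centred at the origin.
\<close>

section \<open>Uniqueness of characteristic functions\<close>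

text \<open>The obstacle behind "mean zero" is that the noise is known only through Gaussian linear
  combinations and a covariance, while integrands are adapted to a filtration generated by
  uncountably many \<open>F A\<close> and the null sets. Rather than constructing independence, one
  shows that an increment is orthogonal to all trigonometric functions of the past; a uniqueness
  theorem for characteristic functions of finite families then reaches every event of the past. The
  same theorem, with the coordinates of the space as the family, makes the Fourier transform
  injective. This yields the scaling of \<open>p\<close>, which is given by its transform only; the
  scaling of the passage times comes from Laplace transforms. In the blow-up, the bound carried
  along is always a constant on a space-time cylinder, which keeps the induction clear of
  measurability questions about \<open>v\<close>. The factor 4 balances the gain: half of the mass
  acting during a time \<open>h\<close> returns \<open>h / 2 * c powr (1 + \<eta>)\<close>, which is
  \<open>2 * c\<close> for \<open>h = 4 * c powr - \<eta>\<close>. The contradiction is with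
  \<open>v\<close> being a real number, by the second moment bound.\<close>

lemma cis_measurable[measurable]: "cis \<in> borel_measurable borel"
  by (intro borel_measurable_continuous_onI continuous_intros)

lemma cnj_measurable[measurable]: "cnj \<in> borel_measurable borel"
  by (intro borel_measurable_continuous_onI continuous_intros)

text \<open>\<open>Levy_uniqueness\<close> speaks of probability laws. Taking \<open>c = 0\<close>
  shows that the positive and negative parts of \<open>W\<close> have the same mass
  \<open>m\<close>; divided by \<open>m\<close> they are densities under which \<open>Z\<close> has
  the same characteristic function, hence the same law.\<close>

lemma integral_indicator_vimage_eq_0_of_iexp_real:
  fixes W :: "'w \<Rightarrow> real" and Z :: "'w \<Rightarrow> real"
  assumes W: "integrable M W" and Z[measurable]: "Z \<in> borel_measurable M"
    and 0: "\<And>c. (CLINT x|M. of_real (W x) * cis (c * Z x)) = 0"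
    and B[measurable]: "B \<in> sets borel"
  shows "(LINT x|M. W x * indicator B (Z x)) = 0"
proof -
  define Wp Wn where "Wp = (\<lambda>x. max 0 (W x))" and "Wn = (\<lambda>x. max 0 (- W x))"
  have [measurable]: "W \<in> borel_measurable M" using W by auto
  have intp: "integrable M Wp" and intn: "integrable M Wn"
    using W unfolding Wp_def Wn_def by auto
  have Weq: "W x = Wp x - Wn x" for x by (auto simp: Wp_def Wn_def)
  have [measurable]: "Wp \<in> borel_measurable M" "Wn \<in> borel_measurable M" using intp intn by auto
  have nn: "Wp x \<ge> 0" "Wn x \<ge> 0" for x by (auto simp: Wp_def Wn_def)
  have int_mult: "integrable M (\<lambda>x. complex_of_real (V x) * cis (c * Z x))"
    if "integrable M V" for V :: "'w \<Rightarrow> real" and c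
    by (rule Bochner_Integration.integrable_bound[OF that]) (use that in \<open>auto simp: norm_mult\<close>)
  have eq: "(CLINT x|M. of_real (Wp x) * cis (c * Z x)) = (CLINT x|M. of_real (Wn x) * cis (c * Z x))" for c
  proof -
    have "(CLINT x|M. of_real (Wp x) * cis (c * Z x)) - (CLINT x|M. of_real (Wn x) * cis (c * Z x))
      = (CLINT x|M. of_real (W x) * cis (c * Z x))"
      by (subst Bochner_Integration.integral_diff[symmetric, OF int_mult int_mult])
        (auto simp: intp intn Weq algebra_simps)
    then show ?thesis using 0[of c] by simp
  qed
  define m where "m = (LINT x|M. Wp x)"
  have mn: "m = (LINT x|M. Wn x)" using eq[of 0] by (simp add: m_def)
  have m0: "m \<ge> 0" unfolding m_def by (rule integral_nonneg_AE) (auto simp: nn)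
  show ?thesis
  \<comment> \<open>Normalization is impossible for \<open>m = 0\<close>, but then both parts of
    \<open>W\<close> vanish almost everywhere.\<close>
  proof (cases "m = 0")
    case True
    then have "AE x in M. Wp x = 0" "AE x in M. Wn x = 0"
      using integral_nonneg_eq_0_iff_AE[OF intp] integral_nonneg_eq_0_iff_AE[OF intn] nn mn
      by (auto simp: m_def)
    then have "AE x in M. W x * indicator B (Z x) = 0"
      by eventually_elim (simp add: Weq)
    then show ?thesis by (simp add: integral_eq_zero_AE)
  next
    case False
    then have m: "m > 0" using m0 by simp
    define P where "P V = distr (density M (\<lambda>x. ennreal (V x / m))) borel Z" for V
    have P: "real_distribution (P V) \<and> char (P V) c = (CLINT x|M. of_real (V x) * cis (c * Z x)) / m
        \<and> measure (P V) B = (LINT x|M. V x * indicator B (Z x)) / m"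
      if [measurable]: "integrable M V" and [simp]: "\<And>x. V x \<ge> 0" and i: "(LINT x|M. V x) = m" for V c
    proof (intro conjI)
      have [measurable]: "V \<in> borel_measurable M" using that by auto
      have "(\<integral>\<^sup>+ x. ennreal (V x / m) \<partial>M) = 1"
        by (subst nn_integral_eq_integral) (use that m in auto)
      then have ps: "prob_space (density M (\<lambda>x. ennreal (V x / m)))"
        by (intro prob_spaceI) (simp add: emeasure_density)
      show "real_distribution (P V)"
        unfolding P_def real_distribution_def real_distribution_axioms_def
        by (auto intro!: prob_space.prob_space_distr[OF ps])
      show "char (P V) c = (CLINT x|M. of_real (V x) * cis (c * Z x)) / m"
        unfolding char_def P_def
        apply (subst integral_distr, simp, simp)
        apply (subst integral_density)
           apply (use m in \<open>auto simp: cis_conv_exp scaleR_conv_of_real\<close>)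
        done
      have "measure (P V) B = (LINT x|P V. indicator B x)"
        unfolding P_def by simp
      also have "\<dots> = (LINT x|M. V x / m * indicator B (Z x))"
        unfolding P_def
        apply (subst integral_distr, simp, simp)
        apply (subst integral_density)
           apply (use m in \<open>auto\<close>)
        done
      also have "\<dots> = (LINT x|M. V x * indicator B (Z x)) / m" by simp
      finally show "measure (P V) B = (LINT x|M. V x * indicator B (Z x)) / m" .
    qed
    have "P Wp = P Wn"
      by (rule Levy_uniqueness)
        (use P[OF intp] P[OF intn] nn mn eq in \<open>auto simp: m_def[symmetric] fun_eq_iff\<close>)
    then have "(LINT x|M. Wp x * indicator B (Z x)) = (LINT x|M. Wn x * indicator B (Z x))"
      using P[OF intp] P[OF intn] nn mn m by (auto simp: m_def[symmetric])
    moreover have "(LINT x|M. W x * indicator B (Z x))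
        = (LINT x|M. Wp x * indicator B (Z x)) - (LINT x|M. Wn x * indicator B (Z x))"
      apply (subst Bochner_Integration.integral_diff[symmetric])
      subgoal by (rule Bochner_Integration.integrable_bound[OF intp]) (auto simp: indicator_def)
      subgoal by (rule Bochner_Integration.integrable_bound[OF intn]) (auto simp: indicator_def)
      by (simp add: Weq algebra_simps)
    ultimately show ?thesis by simp
  qed
qed

text \<open>Complex weights arise in the induction over several variables, where exponentials are
  absorbed in the weight. Conjugation replaces \<open>c\<close> by \<open>- c\<close>, so the
  hypothesis passes to \<open>cnj W\<close> and from there to the real and imaginary parts.\<close>

lemma integral_indicator_vimage_eq_0_of_iexp:
  fixes W :: "'w \<Rightarrow> complex" and Z :: "'w \<Rightarrow> real"
  assumes W: "integrable M W" and Z[measurable]: "Z \<in> borel_measurable M"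
    and 0: "\<And>c. (CLINT x|M. W x * cis (c * Z x)) = 0"
    and B[measurable]: "B \<in> sets borel"
  shows "(CLINT x|M. W x * indicator B (Z x)) = 0"
proof -
  have [measurable]: "W \<in> borel_measurable M" using W by auto
  have iW: "integrable M (\<lambda>x. W x * cis (c * Z x))" for c
    by (rule Bochner_Integration.integrable_bound[OF W]) (auto simp: norm_mult)
  have icW: "integrable M (\<lambda>x. cnj (W x) * cis (c * Z x))" for c
    by (rule Bochner_Integration.integrable_bound[OF W]) (auto simp: norm_mult)
  have 1: "(CLINT x|M. cnj (W x) * cis (c * Z x)) = 0" for c
  proof -
    have "(CLINT x|M. cnj (W x) * cis (c * Z x)) = (CLINT x|M. cnj (W x * cis (- c * Z x)))"
      by (rule Bochner_Integration.integral_cong) (auto simp: cis_cnj)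
    also have "\<dots> = cnj (CLINT x|M. W x * cis (- c * Z x))" by (rule integral_bounded_linear[OF bounded_linear_cnj iW])
    finally show ?thesis using 0[of "- c"] by simp
  qed
  have re: "(CLINT x|M. of_real (Re (W x)) * cis (c * Z x)) = 0" for c
  proof -
    have "(CLINT x|M. of_real (Re (W x)) * cis (c * Z x))
      = (CLINT x|M. (W x * cis (c * Z x) + cnj (W x) * cis (c * Z x)) / 2)"
      by (rule Bochner_Integration.integral_cong)
        (auto simp: complex_add_cnj simp flip: distrib_right)
    also have "\<dots> = 0" by (simp add: Bochner_Integration.integral_add iW icW 0 1)
    finally show ?thesis .
  qed
  have im: "(CLINT x|M. of_real (Im (W x)) * cis (c * Z x)) = 0" for c
  proof -
    have "(CLINT x|M. of_real (Im (W x)) * cis (c * Z x))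
      = (CLINT x|M. (W x * cis (c * Z x) - cnj (W x) * cis (c * Z x)) / (2 * \<i>))"
    proof (rule Bochner_Integration.integral_cong[OF refl])
      fix x
      have "(W x * cis (c * Z x) - cnj (W x) * cis (c * Z x)) / (2 * \<i>)
        = (W x - cnj (W x)) / (2 * \<i>) * cis (c * Z x)" by (simp add: left_diff_distrib diff_divide_distrib)
      also have "W x - cnj (W x) = of_real (Im (W x)) * (2 * \<i>)" by (simp add: complex_eq_iff)
      also have "\<dots> / (2 * \<i>) = of_real (Im (W x))" by (rule nonzero_mult_div_cancel_right) simp
      finally show "of_real (Im (W x)) * cis (c * Z x)
        = (W x * cis (c * Z x) - cnj (W x) * cis (c * Z x)) / (2 * \<i>)" by (rule sym)
    qed
    also have "\<dots> = 0" by (simp add: Bochner_Integration.integral_diff iW icW 0 1)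
    finally show ?thesis .
  qed
  have iR: "integrable M (\<lambda>x. Re (W x))" "integrable M (\<lambda>x. Im (W x))" using W by auto
  have iB: "integrable M (\<lambda>x. W x * indicator B (Z x))"
    by (rule Bochner_Integration.integrable_bound[OF W]) (auto simp: norm_mult indicator_def)
  show ?thesis
  proof (rule complex_eqI)
    have "Re (CLINT x|M. W x * indicator B (Z x)) = (LINT x|M. Re (W x * indicator B (Z x)))"
      by (rule integral_Re[OF iB, symmetric])
    also have "\<dots> = (LINT x|M. Re (W x) * indicator B (Z x))"
      by (rule Bochner_Integration.integral_cong) (auto simp: indicator_def)
    also have "\<dots> = 0"
      by (rule integral_indicator_vimage_eq_0_of_iexp_real[OF iR(1) Z re B])
    finally show "Re (CLINT x|M. W x * indicator B (Z x)) = Re 0" by simp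
    have "Im (CLINT x|M. W x * indicator B (Z x)) = (LINT x|M. Im (W x * indicator B (Z x)))"
      by (rule integral_Im[OF iB, symmetric])
    also have "\<dots> = (LINT x|M. Im (W x) * indicator B (Z x))"
      by (rule Bochner_Integration.integral_cong) (auto simp: indicator_def)
    also have "\<dots> = 0"
      by (rule integral_indicator_vimage_eq_0_of_iexp_real[OF iR(2) Z im B])
    finally show "Im (CLINT x|M. W x * indicator B (Z x)) = Im 0" by simp
  qed
qed

text \<open>Exponentials are exchanged for indicators one variable at a time. For fixed
  \<open>a\<close> the factor \<open>cis (a * Z k x)\<close> joins the weight and the induction
  hypothesis treats \<open>J\<close>; the one-variable lemma, with the indicators over
  \<open>J\<close> in its weight, then treats \<open>k\<close>.\<close>

lemma integral_prod_indicator_eq_0_of_iexp: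
  fixes W :: "'w \<Rightarrow> complex" and Z :: "'i \<Rightarrow> 'w \<Rightarrow> real"
  assumes "finite J" "integrable M W" "\<And>j. j \<in> J \<Longrightarrow> Z j \<in> borel_measurable M"
    and "\<And>c. (CLINT x|M. W x * cis (\<Sum>j\<in>J. c j * Z j x)) = 0"
    and "\<And>j. j \<in> J \<Longrightarrow> B j \<in> sets borel"
  shows "(CLINT x|M. W x * (\<Prod>j\<in>J. indicator (B j) (Z j x))) = 0"
  using assms
proof (induction J arbitrary: W rule: finite_induct)
  case empty
  then show ?case by simp
next
  case (insert k J)
  have [measurable]: "W \<in> borel_measurable M" "Z k \<in> borel_measurable M" "B k \<in> sets borel"
    using insert.prems by auto
  have Zm[measurable]: "\<And>j. j \<in> J \<Longrightarrow> Z j \<in> borel_measurable M" "\<And>j. j \<in> J \<Longrightarrow> B j \<in> sets borel"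
    using insert.prems by auto
  have ind_m[measurable]: "(\<lambda>x. \<Prod>j\<in>J. indicator (B j) (Z j x) :: complex) \<in> borel_measurable M"
    by (intro borel_measurable_prod) (use Zm in measurable)
  have "norm (\<Prod>j\<in>J. indicator (B j) (Z j x) :: complex) \<le> 1" for x
    unfolding prod_norm[symmetric] by (rule prod_le_1) (auto simp: indicator_def)
  then have bd: "norm (W x * (\<Prod>j\<in>J. indicator (B j) (Z j x) :: complex)) \<le> norm (W x)" for x
    by (simp add: norm_mult mult_left_le)
  have iP: "integrable M (\<lambda>x. W x * (\<Prod>j\<in>J. indicator (B j) (Z j x)))"
    by (rule Bochner_Integration.integrable_bound[OF insert.prems(1)]) (use bd in auto)
  have *: "(CLINT x|M. W x * (\<Prod>j\<in>J. indicator (B j) (Z j x)) * cis (a * Z k x)) = 0" for a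
  proof -
    have "(CLINT x|M. (W x * cis (a * Z k x)) * (\<Prod>j\<in>J. indicator (B j) (Z j x))) = 0"
    proof (rule insert.IH)
      show "integrable M (\<lambda>x. W x * cis (a * Z k x))"
        by (rule Bochner_Integration.integrable_bound[OF insert.prems(1)]) (auto simp: norm_mult)
      fix c :: "'i \<Rightarrow> real"
      have "(CLINT x|M. W x * cis (a * Z k x) * cis (\<Sum>j\<in>J. c j * Z j x))
        = (CLINT x|M. W x * cis (\<Sum>j\<in>insert k J. (c(k := a)) j * Z j x))"
      proof (rule Bochner_Integration.integral_cong[OF refl])
        fix x
        have "(\<Sum>j\<in>J. (c(k := a)) j * Z j x) = (\<Sum>j\<in>J. c j * Z j x)"
          by (rule sum.cong) (use insert.hyps in auto)
        then show "W x * cis (a * Z k x) * cis (\<Sum>j\<in>J. c j * Z j x)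
          = W x * cis (\<Sum>j\<in>insert k J. (c(k := a)) j * Z j x)"
          using insert.hyps by (simp add: cis_mult mult.assoc)
      qed
      then show "(CLINT x|M. W x * cis (a * Z k x) * cis (\<Sum>j\<in>J. c j * Z j x)) = 0"
        using insert.prems(3) by simp
    qed (use insert.prems in auto)
    then show ?thesis by (simp add: mult_ac)
  qed
  have "(CLINT x|M. W x * (\<Prod>j\<in>J. indicator (B j) (Z j x)) * indicator (B k) (Z k x)) = 0"
    by (rule integral_indicator_vimage_eq_0_of_iexp[OF iP _ *]) auto
  then show ?case using insert.hyps by (simp add: mult_ac)
qed

text \<open>Null sets are admitted as generators so that the lemma applies to augmented filtrations.\<close>

lemma set_integral_eq_0_of_iexp:
  fixes W :: "'w \<Rightarrow> real" and Z :: "'i \<Rightarrow> 'w \<Rightarrow> real"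
  assumes W: "integrable M W" and Z: "\<And>j. j \<in> I \<Longrightarrow> Z j \<in> borel_measurable M"
    and 0: "\<And>J c. finite J \<Longrightarrow> J \<subseteq> I \<Longrightarrow> (CLINT x|M. of_real (W x) * cis (\<Sum>j\<in>J. c j * Z j x)) = 0"
    and S: "S \<in> sigma_sets (space M)
      ({Z j -` B \<inter> space M | j B. j \<in> I \<and> B \<in> sets borel} \<union> null_sets M)"
  shows "(LINT x|M. W x * indicator S x) = 0"
proof -
  have [measurable]: "W \<in> borel_measurable M" using W by auto
  let ?G = "{Z j -` B \<inter> space M | j B. j \<in> I \<and> B \<in> sets borel} \<union> null_sets M"
  let ?C = "\<lambda>J B. {x \<in> space M. \<forall>j\<in>J. Z j x \<in> B j}"
  \<comment> \<open>The generators need not be closed under intersection. Finite cylinder sets are,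
    and a null set absorbs whatever it is intersected with, so \<open>P\<close> is a pi-system and
    Dynkin's argument applies.\<close>
  define P where "P = {?C J B | J B. finite J \<and> J \<subseteq> I \<and> (\<forall>j\<in>J. B j \<in> sets borel)} \<union> null_sets M"
  have Cm: "?C J B \<in> sets M" if "finite J" "J \<subseteq> I" "\<forall>j\<in>J. B j \<in> sets borel" for J B
  proof -
    have "?C J B = space M \<inter> (\<Inter>j\<in>J. Z j -` B j \<inter> space M) \<or> J = {}" by auto
    moreover have "space M \<inter> (\<Inter>j\<in>J. Z j -` B j \<inter> space M) \<in> sets M" if "J \<noteq> {}"
    proof (rule sets.Int[OF sets.top sets.finite_INT])
      fix j assume "j \<in> J"
      then show "Z j -` B j \<inter> space M \<in> sets M"
        using \<open>J \<subseteq> I\<close> \<open>\<forall>j\<in>J. B j \<in> sets borel\<close> by (intro measurable_sets[OF Z]) auto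
    qed (use \<open>finite J\<close> that in auto)
    ultimately show ?thesis by (cases "J = {}") auto
  qed
  have PM: "P \<subseteq> sets M" unfolding P_def using Cm by auto
  have sub: "?G \<subseteq> P"
  proof
    fix X assume "X \<in> ?G"
    then show "X \<in> P"
    proof
      assume "X \<in> {Z j -` B \<inter> space M | j B. j \<in> I \<and> B \<in> sets borel}"
      then obtain j B where "X = Z j -` B \<inter> space M" "j \<in> I" "B \<in> sets borel" by auto
      then show ?thesis unfolding P_def
        by (intro UnI1 CollectI exI[of _ "{j}"] exI[of _ "\<lambda>_. B"]) auto
    qed (simp add: P_def)
  qed
  have "Int_stable P"
  proof (rule Int_stableI)
    fix X Y assume X: "X \<in> P" and Y: "Y \<in> P"
    show "X \<inter> Y \<in> P"
    proof (cases "X \<in> null_sets M \<or> Y \<in> null_sets M")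
      case True
      moreover have "X \<in> sets M" "Y \<in> sets M" using X Y PM by auto
      ultimately have "X \<inter> Y \<in> null_sets M"
        by (auto intro: null_set_Int1 null_set_Int2)
      then show ?thesis by (simp add: P_def)
    next
      case False
      then obtain J B K B' where
        1: "X = ?C J B" "finite J" "J \<subseteq> I" "\<forall>j\<in>J. B j \<in> sets borel" and
        2: "Y = ?C K B'" "finite K" "K \<subseteq> I" "\<forall>j\<in>K. B' j \<in> sets borel"
        using X Y unfolding P_def by auto
      let ?B = "\<lambda>j. (if j \<in> J then B j else UNIV) \<inter> (if j \<in> K then B' j else UNIV)"
      have "X \<inter> Y = ?C (J \<union> K) ?B" 
      proof (rule set_eqI)
        fix x show "x \<in> X \<inter> Y \<longleftrightarrow> x \<in> ?C (J \<union> K) ?B"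
          unfolding 1(1) 2(1) by (cases "x \<in> space M") (simp_all, blast)
      qed
      moreover have "\<forall>j\<in>J \<union> K. ?B j \<in> sets borel" using 1(4) 2(4) by auto
      moreover have "finite (J \<union> K)" "J \<union> K \<subseteq> I" using 1(2,3) 2(2,3) by auto
      ultimately show ?thesis unfolding P_def by (intro UnI1 CollectI exI conjI) assumption+
    qed
  qed
  moreover have "P \<subseteq> Pow (space M)" using PM sets.space_closed by blast
  moreover have "S \<in> sigma_sets (space M) P"
    using S sigma_sets_mono'[OF sub] by blast
  ultimately show ?thesis
  proof (induction rule: sigma_sets_induct_disjoint)
    case (basic A)
    show ?case
    proof (cases "A \<in> null_sets M")
      case True
      then have "AE x in M. x \<notin> A" by (rule AE_not_in)
      then have "AE x in M. W x * indicator A x = 0" by eventually_elim auto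
      then show ?thesis by (simp add: integral_eq_zero_AE)
    next
      case False
      then obtain J B where
        A: "A = ?C J B" and J: "finite J" "J \<subseteq> I" "\<forall>j\<in>J. B j \<in> sets borel"
        using basic unfolding P_def by auto
      have "(CLINT x|M. of_real (W x) * (\<Prod>j\<in>J. indicator (B j) (Z j x))) = 0"
        by (rule integral_prod_indicator_eq_0_of_iexp) (use W J Z 0 in auto)
      also have "(CLINT x|M. of_real (W x) * (\<Prod>j\<in>J. indicator (B j) (Z j x)))
        = (CLINT x|M. of_real (W x * indicator A x))"
      proof (rule Bochner_Integration.integral_cong[OF refl])
        fix x assume x: "x \<in> space M"
        have "(\<Prod>j\<in>J. indicator (B j) (Z j x)) = (of_real (indicator A x) :: complex)"
        proof (cases "x \<in> A")
          case True then show ?thesis unfolding A by (auto intro!: prod.neutral)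
        next
          case False
          then obtain j where "j \<in> J" "Z j x \<notin> B j" using x unfolding A by auto
          then have "(\<Prod>j\<in>J. indicator (B j) (Z j x)) = (0 :: complex)"
            by (intro prod_zero[OF J(1)] bexI[of _ j]) auto
          then show ?thesis using False by simp
        qed
        then show "of_real (W x) * (\<Prod>j\<in>J. indicator (B j) (Z j x))
          = (of_real (W x * indicator A x) :: complex)" by simp
      qed
      also have "\<dots> = of_real (LINT x|M. W x * indicator A x)"
        by (rule integral_complex_of_real)
      finally show ?thesis by simp
    qed
  next
    case empty then show ?case by simp
  next
    case (compl A)
    have AM: "A \<in> sets M"
      using compl(1) PM by (metis sets.sigma_sets_subset subsetD)
    \<comment> \<open>For empty \<open>J\<close> the exponential is 1, so the hypothesis contains
      that the total integral of \<open>W\<close> is zero.\<close>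
    have i0: "(LINT x|M. W x) = 0" using 0[of "{}" "\<lambda>_. 0"] by simp
    have "(LINT x|M. W x * indicator (space M - A) x) = (LINT x|M. W x - W x * indicator A x)"
      by (rule Bochner_Integration.integral_cong) (auto simp: indicator_def)
    also have "\<dots> = 0"
      by (subst Bochner_Integration.integral_diff)
        (use W AM compl i0 in \<open>auto intro!: integrable_real_mult_indicator\<close>)
    finally show ?case .
  next
    case (union A)
    have AM: "A i \<in> sets M" for i
      using union(2) PM by (metis sets.sigma_sets_subset subsetD range_subsetD)
    have "set_integrable M (\<Union>i. A i) W"
      using integrable_real_mult_indicator[OF sets.countable_UN W, of A UNIV] AM
      by (auto simp: set_integrable_def mult.commute)
    then have "(LINT x:(\<Union>i. A i)|M. W x) = (\<Sum>i. LINT x:A i|M. W x)"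
      using union(1) AM
      by (intro lebesgue_integral_countable_add) (auto simp: disjoint_family_on_def)
    moreover have "(LINT x:A i|M. W x) = 0" for i
      using union(3)[of i] by (simp add: set_lebesgue_integral_def mult.commute)
    ultimately have "(LINT x:(\<Union>i. A i)|M. W x) = 0"
      by simp
    then show ?case by (simp add: set_lebesgue_integral_def mult.commute)
  qed
qed

section \<open>The Walsh integral has mean zero\<close>

lemma char_normal_density:
  assumes s: "s > 0"
  shows "(CLINT z|density lborel (\<lambda>z. ennreal (normal_density 0 s z)). cis (\<theta> * z))
    = of_real (exp (- (s\<^sup>2 * \<theta>\<^sup>2 / 2)))"
proof -
  have "(CLINT z|density lborel (\<lambda>z. ennreal (normal_density 0 s z)). cis (\<theta> * z))
    = (CLINT z|lborel. normal_density 0 s z *\<^sub>R cis (\<theta> * z))"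
    by (subst integral_density) auto
  also have "\<dots> = s *\<^sub>R (CLINT z|lborel. normal_density 0 s (0 + s * z) *\<^sub>R cis (\<theta> * (0 + s * z)))"
    using s by (subst lborel_integral_real_affine[where c=s and t=0]) auto
  also have "\<dots> = (CLINT z|lborel. s *\<^sub>R (normal_density 0 s (0 + s * z) *\<^sub>R cis (\<theta> * (0 + s * z))))"
    by (rule integral_scaleR_right[symmetric])
  also have "\<dots> = (CLINT z|lborel. std_normal_density z *\<^sub>R iexp ((\<theta> * s) * z))"
    by (rule Bochner_Integration.integral_cong)
      (use s in \<open>auto simp: normal_density_def real_sqrt_mult power_mult_distrib cis_conv_exp mult_ac\<close>)
  also have "\<dots> = char std_normal_distribution (\<theta> * s)"
    unfolding char_def by (subst integral_density) (auto simp: mult_ac)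
  also have "\<dots> = of_real (exp (- (s\<^sup>2 * \<theta>\<^sup>2 / 2)))"
    by (simp add: char_std_normal_distribution power_mult_distrib mult_ac)
  finally show ?thesis .
qed

text \<open>The characteristic function at 1 is enough: linear combinations of noise variables are
  again centered Gaussian, so any other argument is absorbed in \<open>X\<close>. What matters is
  that it depends on the variance alone, also in the degenerate case.\<close>

lemma centered_gaussian_facts:
  assumes "prob_space M" "centered_gaussian M X"
  shows "integrable M X" "integrable M (\<lambda>\<omega>. (X \<omega>)\<^sup>2)"
    "(CLINT \<omega>|M. cis (X \<omega>)) = of_real (exp (- ((LINT \<omega>|M. (X \<omega>)\<^sup>2) / 2)))"
proof -
  interpret prob_space M by fact
  have [measurable]: "X \<in> borel_measurable M" using assms by (simp add: centered_gaussian_def)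
  consider (0) "AE \<omega> in M. X \<omega> = 0"
    | (s) s where "s > 0" "distributed M lborel X (\<lambda>z. ennreal (normal_density 0 s z))"
    using assms by (auto simp: centered_gaussian_def)
  then have "integrable M X \<and> integrable M (\<lambda>\<omega>. (X \<omega>)\<^sup>2) \<and>
    (CLINT \<omega>|M. cis (X \<omega>)) = of_real (exp (- ((LINT \<omega>|M. (X \<omega>)\<^sup>2) / 2)))"
  proof cases
    case 0
    have "integrable M X \<longleftrightarrow> integrable M (\<lambda>_. 0 :: real)"
      by (rule integrable_cong_AE) (use 0 in auto)
    moreover have "integrable M (\<lambda>\<omega>. (X \<omega>)\<^sup>2) \<longleftrightarrow> integrable M (\<lambda>_. 0 :: real)"
      by (rule integrable_cong_AE) (use 0 in auto)
    moreover have "(CLINT \<omega>|M. cis (X \<omega>)) = (CLINT \<omega>|M. 1)"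
      using 0 by (intro integral_cong_AE) auto
    moreover have "(LINT \<omega>|M. (X \<omega>)\<^sup>2) = 0"
      using 0 by (intro integral_eq_zero_AE) auto
    ultimately show ?thesis by (simp add: prob_space)
  next
    case s
    have i1: "integrable lborel (\<lambda>x. normal_density 0 s x * x)"
      using integrable_normal_moment[of s 0 1] s by simp
    have i2: "integrable lborel (\<lambda>x. normal_density 0 s x * x\<^sup>2)"
      using integrable_normal_moment[of s 0 2] s by simp
    have v: "(LINT \<omega>|M. (X \<omega>)\<^sup>2) = s\<^sup>2"
      using distributed_integral[OF s(2), of "\<lambda>x. x\<^sup>2"] integral_normal_moment_even[of s 0 1] s
      by simp
    have "(CLINT \<omega>|M. cis (1 * X \<omega>)) = (CLINT z|distr M lborel X. cis (1 * z))"
      by (subst integral_distr) auto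
    also have "distr M lborel X = density lborel (\<lambda>z. ennreal (normal_density 0 s z))"
      using s(2) by (simp add: distributed_def)
    finally have c: "(CLINT \<omega>|M. cis (X \<omega>)) = of_real (exp (- (s\<^sup>2 / 2)))"
      using char_normal_density[OF s(1), of 1] by simp
    show ?thesis
      using distributed_integrable[OF s(2), of "\<lambda>x. x"] distributed_integrable[OF s(2), of "\<lambda>x. x\<^sup>2"]
        i1 i2 c v by simp
  qed
  then show "integrable M X" "integrable M (\<lambda>\<omega>. (X \<omega>)\<^sup>2)"
    "(CLINT \<omega>|M. cis (X \<omega>)) = of_real (exp (- ((LINT \<omega>|M. (X \<omega>)\<^sup>2) / 2)))" by auto
qed

section \<open>Noise increments are orthogonal to the past\<close>

context
  fixes M :: "'w measure" and C :: "'a::euclidean_space correlation"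
    and F :: "(real \<times> 'a) set \<Rightarrow> 'w \<Rightarrow> real"
  assumes noise: "gaussian_noise M C F"
begin

interpretation prob_space M using noise by (simp add: gaussian_noise_def)

lemma noise_gaussian_sum:
  assumes "finite J" "J \<subseteq> noise_sets"
  shows "centered_gaussian M (\<lambda>\<omega>. \<Sum>A\<in>J. c A * F A \<omega>)"
  using noise assms unfolding gaussian_noise_def by blast

lemma noise_gaussian:
  assumes "A \<in> noise_sets"
  shows "centered_gaussian M (F A)"
  using noise_gaussian_sum[of "{A}" "\<lambda>_. 1"] assms by simp

lemma noise_measurable: "A \<in> noise_sets \<Longrightarrow> F A \<in> borel_measurable M"
  using noise_gaussian[of A] by (simp add: centered_gaussian_def)

lemmas noise_integrable = centered_gaussian_facts(1)[OF prob_space_axioms noise_gaussian]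

lemma noise_filtration_sub:
  "S \<in> sets (noise_filtration M F t) \<Longrightarrow> S \<in> sets M"
proof -
  have 1: "{F A -` B \<inter> space M | A B. A \<in> noise_sets \<and> A \<subseteq> {0..t} \<times> UNIV \<and> B \<in> sets borel}
      \<union> null_sets M \<subseteq> sets M"
  proof
    fix X assume "X \<in> {F A -` B \<inter> space M | A B. A \<in> noise_sets \<and> A \<subseteq> {0..t} \<times> UNIV \<and> B \<in> sets borel}
      \<union> null_sets M"
    then show "X \<in> sets M"
    proof
      assume "X \<in> {F A -` B \<inter> space M | A B. A \<in> noise_sets \<and> A \<subseteq> {0..t} \<times> UNIV \<and> B \<in> sets borel}"
      then obtain A B where "X = F A -` B \<inter> space M" "A \<in> noise_sets" "B \<in> sets borel" by blast
      then show ?thesis using measurable_sets[OF noise_measurable] by simp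
    qed auto
  qed
  then have "{F A -` B \<inter> space M | A B. A \<in> noise_sets \<and> A \<subseteq> {0..t} \<times> UNIV \<and> B \<in> sets borel}
      \<union> null_sets M \<subseteq> Pow (space M)"
    using sets.space_closed by blast
  moreover assume "S \<in> sets (noise_filtration M F t)"
  ultimately have "S \<in> sigma_sets (space M) ({F A -` B \<inter> space M | A B. A \<in> noise_sets \<and> A \<subseteq> {0..t} \<times> UNIV \<and> B \<in> sets borel}
      \<union> null_sets M)"
    unfolding noise_filtration_def by (subst (asm) sets_measure_of) 
  then show ?thesis using sets.sigma_sets_subset[OF 1] by blast
qed

lemma noise_filtration_measurable:
  fixes X :: "'w \<Rightarrow> 'b::topological_space"
  assumes "X \<in> borel_measurable (noise_filtration M F t)"
  shows "X \<in> borel_measurable M"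
proof (rule measurableI)
  fix B :: "'b set" assume "B \<in> sets borel"
  then have "X -` B \<inter> space (noise_filtration M F t) \<in> sets (noise_filtration M F t)"
    using assms by (rule measurable_sets[rotated])
  from noise_filtration_sub[OF this] show "X -` B \<inter> space M \<in> sets M"
    by (simp add: noise_filtration_def space_measure_of_conv)
qed simp

text \<open>
  Since \<open>F E\<close> is uncorrelated with the past \<open>Z\<close>, the pairs \<open>(Z, F E)\<close> and \<open>(Z, - F E)\<close> have the same
  characteristic function.
\<close>

lemma noise_increment_iexp:
  assumes J: "finite J" "J \<subseteq> noise_sets" "\<And>A. A \<in> J \<Longrightarrow> A \<subseteq> {0..a} \<times> UNIV"
    and E: "E \<in> noise_sets" "E \<subseteq> {a<..} \<times> UNIV"
  shows "(CLINT \<omega>|M. of_real (F E \<omega>) * cis (\<Sum>A\<in>J. c A * F A \<omega>)) = 0"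
proof -
  define Z where "Z = (\<lambda>\<omega>. \<Sum>A\<in>J. c A * F A \<omega>)"
  define Y where "Y = F E"
  have gZ: "centered_gaussian M Z" unfolding Z_def by (rule noise_gaussian_sum[OF J(1,2)])
  have gY: "centered_gaussian M Y" unfolding Y_def by (rule noise_gaussian[OF E(1)])
  have [measurable]: "Z \<in> borel_measurable M" "Y \<in> borel_measurable M"
    using gZ gY by (auto simp: centered_gaussian_def)
  have prod_int: "integrable M (\<lambda>\<omega>. U \<omega> * V \<omega>)"
    if "centered_gaussian M U" "centered_gaussian M V" for U V
  proof (rule Bochner_Integration.integrable_bound)
    show "integrable M (\<lambda>\<omega>. (U \<omega>)\<^sup>2 + (V \<omega>)\<^sup>2)"
      using that centered_gaussian_facts(2)[OF prob_space_axioms] by auto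
    show "(\<lambda>\<omega>. U \<omega> * V \<omega>) \<in> borel_measurable M" using that by (auto simp: centered_gaussian_def)
    show "AE \<omega> in M. norm (U \<omega> * V \<omega>) \<le> norm ((U \<omega>)\<^sup>2 + (V \<omega>)\<^sup>2)"
    proof (rule AE_I2)
      fix \<omega>
      have "\<bar>U \<omega>\<bar> * \<bar>V \<omega>\<bar> \<le> (U \<omega>)\<^sup>2 + (V \<omega>)\<^sup>2"
        using sum_squares_bound[of "\<bar>U \<omega>\<bar>" "\<bar>V \<omega>\<bar>"] mult_nonneg_nonneg[of "\<bar>U \<omega>\<bar>" "\<bar>V \<omega>\<bar>"]
        unfolding power2_abs by linarith
      then show "norm (U \<omega> * V \<omega>) \<le> norm ((U \<omega>)\<^sup>2 + (V \<omega>)\<^sup>2)" by (simp add: abs_mult)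
    qed
  qed
  have cov0: "(LINT \<omega>|M. F A \<omega> * Y \<omega>) = 0" if "A \<in> J" for A
  proof -
    \<comment> \<open>At each time \<open>s\<close> one of the two sections is empty, so the form
      vanishes for white and colored noise alike.\<close>
    have "corr_form C (\<lambda>x. indicator A (s, x)) (\<lambda>y. indicator E (s, y)) = 0" for s
    proof -
      have "(\<lambda>x. indicator A (s, x) :: real) = (\<lambda>_. 0) \<or> (\<lambda>x. indicator E (s, x) :: real) = (\<lambda>_. 0)"
        using J(3)[OF that] E(2) by (cases "s \<le> a") (auto simp: indicator_def fun_eq_iff)
      then have "\<And>x y. indicator A (s, x) * indicator E (s, y) = (0 :: real)" by (auto dest: fun_cong)
      then show ?thesis by (cases C) (simp_all only: corr_form.simps split_beta' mult_zero_left Bochner_Integration.integral_zero)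
    qed
    moreover have "A \<in> noise_sets" using that J by auto
    ultimately show ?thesis
      using noise E(1) unfolding gaussian_noise_def Y_def by (simp add: set_lebesgue_integral_def)
  qed
  have "(LINT \<omega>|M. Z \<omega> * Y \<omega>) = (LINT \<omega>|M. (\<Sum>A\<in>J. c A * (F A \<omega> * Y \<omega>)))"
    by (simp add: Z_def sum_distrib_right mult.assoc)
  also have "\<dots> = (\<Sum>A\<in>J. c A * (LINT \<omega>|M. F A \<omega> * Y \<omega>))"
    using J noise_gaussian gY
    by (subst Bochner_Integration.integral_sum) (auto intro!: integrable_mult_right prod_int)
  also have "\<dots> = 0" by (simp add: cov0)
  finally have covZ: "(LINT \<omega>|M. Z \<omega> * Y \<omega>) = 0" .
  \<comment> \<open>The coefficients at \<open>E\<close> are added, not overwritten, because an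
    empty \<open>E\<close> may be a member of \<open>J\<close>.\<close>
  have gs: "centered_gaussian M (\<lambda>\<omega>. Z \<omega> + \<theta> * Y \<omega>)" for \<theta>
  proof -
    have "(\<Sum>A\<in>insert E J. ((if A \<in> J then c A else 0) + (if A = E then \<theta> else 0)) * F A \<omega>) = Z \<omega> + \<theta> * Y \<omega>" for \<omega>
    proof -
      have 1: "(\<Sum>A\<in>insert E J. (if A \<in> J then c A else 0) * F A \<omega>) = Z \<omega>"
        unfolding Z_def using J(1) by (intro sum.mono_neutral_cong_right) auto
      have 2: "(\<Sum>A\<in>insert E J. (if A = E then \<theta> else 0) * F A \<omega>) = (\<Sum>A\<in>{E}. \<theta> * F A \<omega>)"
        using J(1) by (intro sum.mono_neutral_cong_right) auto
      show ?thesis by (simp only: distrib_right sum.distrib 1 2) (simp add: Y_def)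
    qed
    then show ?thesis
      using noise_gaussian_sum[of "insert E J" "\<lambda>A. (if A \<in> J then c A else 0) + (if A = E then \<theta> else 0)"]
        J E by simp
  qed
  have var: "(LINT \<omega>|M. (Z \<omega> + \<theta> * Y \<omega>)\<^sup>2) = (LINT \<omega>|M. (Z \<omega>)\<^sup>2) + \<theta>\<^sup>2 * (LINT \<omega>|M. (Y \<omega>)\<^sup>2)" for \<theta>
  proof -
    have "(LINT \<omega>|M. (Z \<omega> + \<theta> * Y \<omega>)\<^sup>2)
      = (LINT \<omega>|M. (Z \<omega>)\<^sup>2 + (2 * \<theta> * (Z \<omega> * Y \<omega>) + \<theta>\<^sup>2 * (Y \<omega>)\<^sup>2))"
      by (simp add: power2_eq_square algebra_simps)
    also have "\<dots> = (LINT \<omega>|M. (Z \<omega>)\<^sup>2) + (2 * \<theta> * (LINT \<omega>|M. Z \<omega> * Y \<omega>) + \<theta>\<^sup>2 * (LINT \<omega>|M. (Y \<omega>)\<^sup>2))"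
      using centered_gaussian_facts(2)[OF prob_space_axioms gZ]
        centered_gaussian_facts(2)[OF prob_space_axioms gY] prod_int[OF gZ gY]
      by (simp del: Bochner_Integration.integral_mult_right_zero add: Bochner_Integration.integral_add)
    finally show ?thesis using covZ by simp
  qed
  have bint: "integrable M (\<lambda>\<omega>. cis (f \<omega>))" if [measurable]: "f \<in> borel_measurable M" for f
    by (rule integrable_const_bound[where B=1]) auto
  \<comment> \<open>By \<open>covZ\<close> the variables \<open>Z + \<theta> * Y\<close> and
    \<open>Z - \<theta> * Y\<close> have the same variance, so their exponentials have the same
    mean; the difference of these exponentials is the integrand times
    \<open>2 * \<i>\<close>.\<close>
  have sin0: "(CLINT \<omega>|M. of_real (sin (\<theta> * Y \<omega>)) * cis (Z \<omega>)) = 0" for \<theta>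
  proof -
    have "of_real (sin (\<theta> * Y \<omega>)) * cis (Z \<omega>)
        = (cis (Z \<omega> + \<theta> * Y \<omega>) - cis (Z \<omega> + (- \<theta>) * Y \<omega>)) / (2 * \<i>)" for \<omega>
    proof -
      have "cis (\<theta> * Y \<omega>) - cis (- (\<theta> * Y \<omega>)) = 2 * \<i> * of_real (sin (\<theta> * Y \<omega>))"
        by (simp add: complex_eq_iff)
      moreover have "cis (Z \<omega> + \<theta> * Y \<omega>) - cis (Z \<omega> + (- \<theta>) * Y \<omega>)
          = (cis (\<theta> * Y \<omega>) - cis (- (\<theta> * Y \<omega>))) * cis (Z \<omega>)"
        by (simp only: left_diff_distrib cis_mult add.commute mult_minus_left)
      ultimately show ?thesis by simp
    qed
    then have "(CLINT \<omega>|M. of_real (sin (\<theta> * Y \<omega>)) * cis (Z \<omega>))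
      = (CLINT \<omega>|M. (cis (Z \<omega> + \<theta> * Y \<omega>) - cis (Z \<omega> + (- \<theta>) * Y \<omega>)) / (2 * \<i>))" by simp
    also have "\<dots> = ((CLINT \<omega>|M. cis (Z \<omega> + \<theta> * Y \<omega>)) - (CLINT \<omega>|M. cis (Z \<omega> + (- \<theta>) * Y \<omega>))) / (2 * \<i>)"
      by (subst Bochner_Integration.integral_diff[symmetric]) (auto intro!: bint simp del: mult_minus_left)
    also have "\<dots> = 0"
      unfolding centered_gaussian_facts(3)[OF prob_space_axioms gs] var by simp
    finally show ?thesis .
  qed
  have iY: "integrable M Y" by (rule centered_gaussian_facts(1)[OF prob_space_axioms gY])
  \<comment> \<open>Dividing \<open>sin (\<theta> * Y)\<close> by
    \<open>\<theta> = 1 / (n + 1)\<close> recovers \<open>Y\<close> in the limit, dominated by the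
    integrable \<open>\<bar>Y\<bar>\<close>.\<close>
  have "(\<lambda>n. CLINT \<omega>|M. of_real (real (Suc n) * sin (inverse (real (Suc n)) * Y \<omega>)) * cis (Z \<omega>))
    \<longlonglongrightarrow> (CLINT \<omega>|M. of_real (Y \<omega>) * cis (Z \<omega>))"
  proof (rule integral_dominated_convergence[where w="\<lambda>\<omega>. \<bar>Y \<omega>\<bar>"])
    show "AE \<omega> in M. (\<lambda>n. of_real (real (Suc n) * sin (inverse (real (Suc n)) * Y \<omega>)) * cis (Z \<omega>))
        \<longlonglongrightarrow> of_real (Y \<omega>) * cis (Z \<omega>)"
    proof (rule AE_I2, intro tendsto_intros)
      fix \<omega>
      have "((\<lambda>x. sin (x * Y \<omega>)) has_real_derivative Y \<omega>) (at 0)"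
        by (auto intro!: derivative_eq_intros)
      then have "((\<lambda>h. sin (h * Y \<omega>) / h) \<longlongrightarrow> Y \<omega>) (at 0)"
        by (simp add: DERIV_def)
      moreover have "filterlim (\<lambda>n. inverse (real (Suc n))) (at 0) sequentially"
        unfolding filterlim_at by (auto intro!: LIMSEQ_inverse_real_of_nat simp del: of_nat_Suc)
      ultimately have "(\<lambda>n. sin (inverse (real (Suc n)) * Y \<omega>) / inverse (real (Suc n))) \<longlonglongrightarrow> Y \<omega>"
        by (rule filterlim_compose)
      then show "(\<lambda>n. real (Suc n) * sin (inverse (real (Suc n)) * Y \<omega>)) \<longlonglongrightarrow> Y \<omega>"
        by (simp add: field_simps)
    qed
    show "AE \<omega> in M. norm (complex_of_real (real (Suc n) * sin (inverse (real (Suc n)) * Y \<omega>)) * cis (Z \<omega>))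
        \<le> \<bar>Y \<omega>\<bar>" for n
    proof (rule AE_I2)
      fix \<omega>
      have "real (Suc n) * \<bar>sin (inverse (real (Suc n)) * Y \<omega>)\<bar> \<le> real (Suc n) * \<bar>inverse (real (Suc n)) * Y \<omega>\<bar>"
        by (intro mult_left_mono abs_sin_x_le_abs_x) auto
      also have "\<dots> = \<bar>Y \<omega>\<bar>" by (simp add: abs_mult)
      finally show "norm (complex_of_real (real (Suc n) * sin (inverse (real (Suc n)) * Y \<omega>)) * cis (Z \<omega>)) \<le> \<bar>Y \<omega>\<bar>"
        by (simp only: norm_mult norm_of_real norm_cis abs_mult)
    qed
  qed (use iY in auto)
  moreover have "(CLINT \<omega>|M. of_real (real (Suc n) * sin (inverse (real (Suc n)) * Y \<omega>)) * cis (Z \<omega>)) = 0" for n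
    using sin0[of "inverse (real (Suc n))"]
    by (simp only: of_real_mult mult.assoc Bochner_Integration.integral_mult_right_zero mult_zero_right)
  ultimately have "(CLINT \<omega>|M. of_real (Y \<omega>) * cis (Z \<omega>)) = 0"
    by (simp only: LIMSEQ_const_iff)
  then show ?thesis by (simp add: Y_def Z_def)
qed

text \<open>This is the vanishing of the conditional expectation of \<open>F E\<close> given the
  past, tested on events. The orthogonality to exponentials in \<open>noise_increment_iexp\<close>
  is exactly the hypothesis of \<open>set_integral_eq_0_of_iexp\<close> for the generators of the
  filtration.\<close>

lemma noise_increment_set_integral:
  assumes E: "E \<in> noise_sets" "E \<subseteq> {a<..} \<times> UNIV"
    and S: "S \<in> sets (noise_filtration M F a)"
  shows "(LINT \<omega>|M. F E \<omega> * indicator S \<omega>) = 0"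
proof (rule set_integral_eq_0_of_iexp[where I="{A \<in> noise_sets. A \<subseteq> {0..a} \<times> UNIV}" and Z=F])
  show "integrable M (F E)" by (rule noise_integrable[OF E(1)])
  show "F A \<in> borel_measurable M" if "A \<in> {A \<in> noise_sets. A \<subseteq> {0..a} \<times> UNIV}" for A
    using that noise_measurable by auto
  show "(CLINT \<omega>|M. of_real (F E \<omega>) * cis (\<Sum>A\<in>J. c A * F A \<omega>)) = 0"
    if "finite J" "J \<subseteq> {A \<in> noise_sets. A \<subseteq> {0..a} \<times> UNIV}" for J c
    by (rule noise_increment_iexp[where a=a]) (use that E in auto)
  have "{F A -` B \<inter> space M | A B. A \<in> {A \<in> noise_sets. A \<subseteq> {0..a} \<times> UNIV} \<and> B \<in> sets borel}
      \<union> null_sets M \<subseteq> Pow (space M)"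
    using sets.sets_into_space by (auto simp: null_sets_def)
  then show "S \<in> sigma_sets (space M) ({F A -` B \<inter> space M | A B. A \<in> {A \<in> noise_sets. A \<subseteq> {0..a} \<times> UNIV} \<and> B \<in> sets borel}
      \<union> null_sets M)"
    using S unfolding noise_filtration_def by (simp add: sets_measure_of conj_assoc)
qed

text \<open>The passage from events to bounded variables of the past, by approximation with simple
  functions and dominated convergence.\<close>

lemma noise_increment_mult:
  assumes E: "E \<in> noise_sets" "E \<subseteq> {a<..} \<times> UNIV"
    and X: "X \<in> borel_measurable (noise_filtration M F a)" "bounded (X ` space M)"
  shows "integrable M (\<lambda>\<omega>. X \<omega> * F E \<omega>)" "(LINT \<omega>|M. X \<omega> * F E \<omega>) = 0"
proof -
  have [measurable]: "X \<in> borel_measurable M" "F E \<in> borel_measurable M"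
    using X noise_filtration_measurable noise_measurable E by auto
  have iF: "integrable M (F E)" by (rule noise_integrable[OF E(1)])
  obtain K where K: "\<And>\<omega>. \<omega> \<in> space M \<Longrightarrow> \<bar>X \<omega>\<bar> \<le> K"
    using X(2) by (auto simp: bounded_iff)
  show i: "integrable M (\<lambda>\<omega>. X \<omega> * F E \<omega>)"
  proof (rule Bochner_Integration.integrable_bound)
    show "integrable M (\<lambda>\<omega>. K * F E \<omega>)" using iF by simp
    show "AE \<omega> in M. norm (X \<omega> * F E \<omega>) \<le> norm (K * F E \<omega>)"
      using K by (intro AE_I2) (auto simp: abs_mult intro!: mult_right_mono intro: order_trans[OF _ abs_ge_self])
  qed simp
  let ?N = "noise_filtration M F a"
  have spN: "space ?N = space M" by (simp add: noise_filtration_def space_measure_of_conv)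
  \<comment> \<open>The approximants are simple for the filtration \<open>?N\<close> and not merely
    for \<open>M\<close>, so their level sets are events of the past.\<close>
  obtain Sq where Sq: "\<And>i. simple_function ?N (Sq i)"
     "\<And>x. x \<in> space ?N \<Longrightarrow> (\<lambda>i. Sq i x) \<longlonglongrightarrow> X x"
     "\<And>i x. x \<in> space ?N \<Longrightarrow> norm (Sq i x) \<le> 2 * norm (X x)"
    using borel_measurable_implies_sequence_metric[OF X(1), of 0]
    unfolding dist_norm diff_0_right by metis
  have Sm: "Sq i \<in> borel_measurable M" for i
    using noise_filtration_measurable borel_measurable_simple_function[OF Sq(1)] by blast
  have "(LINT \<omega>|M. Sq i \<omega> * F E \<omega>) = 0" for i
  proof -
    have "(LINT \<omega>|M. Sq i \<omega> * F E \<omega>)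
      = (LINT \<omega>|M. (\<Sum>y\<in>Sq i ` space M. y * (F E \<omega> * indicator (Sq i -` {y} \<inter> space M) \<omega>)))"
    proof (rule Bochner_Integration.integral_cong[OF refl])
      fix \<omega> assume w: "\<omega> \<in> space M"
      have "(\<Sum>y\<in>Sq i ` space M. y * (F E \<omega> * indicator (Sq i -` {y} \<inter> space M) \<omega>))
        = (\<Sum>y\<in>{Sq i \<omega>}. y * (F E \<omega> * indicator (Sq i -` {y} \<inter> space M) \<omega>))"
        using simple_functionD(1)[OF Sq(1)[of i]] w spN
        by (intro sum.mono_neutral_right) (auto simp: indicator_def)
      then show "Sq i \<omega> * F E \<omega> = (\<Sum>y\<in>Sq i ` space M. y * (F E \<omega> * indicator (Sq i -` {y} \<inter> space M) \<omega>))"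
        using w by simp
    qed
    also have "\<dots> = (\<Sum>y\<in>Sq i ` space M. y * (LINT \<omega>|M. F E \<omega> * indicator (Sq i -` {y} \<inter> space M) \<omega>))"
      using iF Sm[of i]
      by (subst Bochner_Integration.integral_sum)
        (auto intro!: integrable_mult_right integrable_real_mult_indicator)
    also have "\<dots> = 0"
      using noise_increment_set_integral[OF E simple_functionD(2)[OF Sq(1)]] spN by simp
    finally show ?thesis .
  qed
  moreover have "(\<lambda>i. LINT \<omega>|M. Sq i \<omega> * F E \<omega>) \<longlonglongrightarrow> (LINT \<omega>|M. X \<omega> * F E \<omega>)"
  proof (rule integral_dominated_convergence[where w="\<lambda>\<omega>. 2 * norm (X \<omega> * F E \<omega>)"])
    show "integrable M (\<lambda>\<omega>. 2 * norm (X \<omega> * F E \<omega>))" using i by auto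
    show "AE \<omega> in M. (\<lambda>i. Sq i \<omega> * F E \<omega>) \<longlonglongrightarrow> X \<omega> * F E \<omega>"
      using Sq(2) spN by (intro AE_I2 tendsto_intros) auto
    show "AE \<omega> in M. norm (Sq i \<omega> * F E \<omega>) \<le> 2 * norm (X \<omega> * F E \<omega>)" for i
    proof (rule AE_I2)
      fix \<omega> assume "\<omega> \<in> space M"
      then have "norm (Sq i \<omega>) * norm (F E \<omega>) \<le> (2 * norm (X \<omega>)) * norm (F E \<omega>)"
        using Sq(3) spN by (intro mult_right_mono) auto
      then show "norm (Sq i \<omega> * F E \<omega>) \<le> 2 * norm (X \<omega> * F E \<omega>)"
        by (simp add: abs_mult)
    qed
  qed (use Sm in auto)
  ultimately show "(LINT \<omega>|M. X \<omega> * F E \<omega>) = 0"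
    by (simp only: LIMSEQ_const_iff)
qed

text \<open>The time interval of an entry is open on the left, hence lies strictly after the time
  \<open>a\<close> at which \<open>X\<close> is known; each summand thus has mean zero.\<close>

lemma simple_integral_mean_0:
  assumes "is_simple_process M F t S"
  shows "integrable M (simple_integral F S)" "(LINT \<omega>|M. simple_integral F S \<omega>) = 0"
proof -
  have "integrable M (simple_integral F S) \<and> (LINT \<omega>|M. simple_integral F S \<omega>) = 0"
    using assms
  proof (induction S)
    case Nil
    then show ?case by (simp add: simple_integral_def)
  next
    case (Cons e S)
    obtain a b A X where e: "e = (a, b, A, X)" by (cases e) auto
    have h: "0 \<le> a" "a < b" "A \<in> sets borel" "bounded A"
      "X \<in> borel_measurable (noise_filtration M F a)" "bounded (X ` space M)"
      using Cons.prems unfolding e is_simple_process_def by auto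
    have E: "{a<..b} \<times> A \<in> noise_sets"
    proof -
      have "{a<..b} \<times> A \<in> sets (borel \<Otimes>\<^sub>M borel)" using h by (intro pair_measureI) auto
      then have "{a<..b} \<times> A \<in> sets borel" unfolding borel_prod .
      moreover have "bounded {a<..b}" by (rule bounded_subset[OF bounded_closed_interval[of a b]]) auto
      then have "bounded ({a<..b} \<times> A)" using h by (intro bounded_Times)
      moreover have "{a<..b} \<times> A \<subseteq> {0..} \<times> UNIV" using h by auto
      ultimately show ?thesis by (simp add: noise_sets_def)
    qed
    have IH: "integrable M (simple_integral F S)" "(LINT \<omega>|M. simple_integral F S \<omega>) = 0"
      using Cons unfolding is_simple_process_def by auto
    have sub: "{a<..b} \<subseteq> {a<..}" by auto
    note nm = noise_increment_mult[OF E Sigma_mono[of _ "{a<..}" "\<lambda>_. A" "\<lambda>_. UNIV", OF sub subset_UNIV] h(5,6)]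
    have "simple_integral F (e # S) = (\<lambda>\<omega>. X \<omega> * F ({a<..b} \<times> A) \<omega> + simple_integral F S \<omega>)"
      by (auto simp: simple_integral_def e)
    then show ?case using IH nm by auto
  qed
  then show "integrable M (simple_integral F S)" "(LINT \<omega>|M. simple_integral F S \<omega>) = 0" by auto
qed

text \<open>The square of the mean of \<open>I\<close> is the square of the mean of
  \<open>simple_integral F (S n) - I\<close>, which is at most the squared \<open>L2\<close>
  distance and tends to zero.\<close>

lemma walsh_integral_mean_0:
  assumes "has_walsh_integral M C F t \<Phi> I"
  shows "integrable M I" "(LINT \<omega>|M. I \<omega>) = 0"
proof -
  obtain S where S: "\<And>n. is_simple_process M F t (S n)"
    and lim: "(\<lambda>n. \<integral>\<^sup>+\<omega>. ennreal ((simple_integral F (S n) \<omega> - I \<omega>)\<^sup>2) \<partial>M) \<longlonglongrightarrow> 0"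
    and [measurable]: "I \<in> borel_measurable M"
    using assms unfolding has_walsh_integral_def by auto
  note si = simple_integral_mean_0[OF S]
  have [measurable]: "simple_integral F (S n) \<in> borel_measurable M" for n using si(1)[of n] by auto
  define \<epsilon> where "\<epsilon> n = enn2real (\<integral>\<^sup>+\<omega>. ennreal ((simple_integral F (S n) \<omega> - I \<omega>)\<^sup>2) \<partial>M)" for n
  have \<epsilon>0: "\<epsilon> \<longlonglongrightarrow> 0"
    unfolding \<epsilon>_def using tendsto_enn2real[of _ 0] lim by simp
  have "\<forall>\<^sub>F n in sequentially. (\<integral>\<^sup>+\<omega>. ennreal ((simple_integral F (S n) \<omega> - I \<omega>)\<^sup>2) \<partial>M) < 1"
    using order_tendstoD(2)[OF lim, of 1] by simp
  \<comment> \<open>\<open>I\<close> is only known to be measurable; it inherits integrability from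
    a simple integral at finite \<open>L2\<close> distance.\<close>
  then obtain n0 where n0: "\<And>n. n \<ge> n0 \<Longrightarrow> (\<integral>\<^sup>+\<omega>. ennreal ((simple_integral F (S n) \<omega> - I \<omega>)\<^sup>2) \<partial>M) < \<infinity>"
    by (auto simp: eventually_sequentially) (metis infinity_ennreal_def ennreal_one_less_top order.strict_trans)
  have sq: "integrable M (\<lambda>\<omega>. (simple_integral F (S n) \<omega> - I \<omega>)\<^sup>2)" if "n \<ge> n0" for n
    by (rule integrableI_bounded) (use n0[OF that] in auto)
  have d: "integrable M (\<lambda>\<omega>. simple_integral F (S n) \<omega> - I \<omega>)" if "n \<ge> n0" for n
    by (rule square_integrable_imp_integrable[OF _ sq[OF that]]) simp
  have "integrable M (\<lambda>\<omega>. simple_integral F (S n0) \<omega> - (simple_integral F (S n0) \<omega> - I \<omega>))"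
    by (rule Bochner_Integration.integrable_diff[OF si(1) d]) simp
  then show iI: "integrable M I" by simp
  have "(LINT \<omega>|M. I \<omega>)\<^sup>2 \<le> \<epsilon> n" if "n \<ge> n0" for n
  proof -
    have "(LINT \<omega>|M. simple_integral F (S n) \<omega> - I \<omega>)\<^sup>2 \<le> (LINT \<omega>|M. (simple_integral F (S n) \<omega> - I \<omega>)\<^sup>2)"
      using variance_positive[of "\<lambda>\<omega>. simple_integral F (S n) \<omega> - I \<omega>"]
      unfolding variance_eq[OF d[OF that] sq[OF that]] by (simp only: diff_ge_0_iff_ge)
    also have "\<dots> = \<epsilon> n"
      unfolding \<epsilon>_def by (rule integral_eq_nn_integral) auto
    finally show ?thesis by (simp add: Bochner_Integration.integral_diff si iI)
  qed
  then have "(LINT \<omega>|M. I \<omega>)\<^sup>2 \<le> 0"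
    by (intro LIMSEQ_le_const[OF \<epsilon>0]) auto
  then show "(LINT \<omega>|M. I \<omega>) = 0" by simp
qed

end

section \<open>Self-similarity of the stable density\<close>

text \<open>The coordinates generate the Borel sets, and a linear combination of them is an inner
  product with a fixed vector. So \<open>set_integral_eq_0_of_iexp\<close>, with the coordinates as
  \<open>Z\<close>, turns a vanishing transform into vanishing integrals over all Borel
  sets.\<close>

lemma AE_eq_0_of_fourier_0:
  fixes f :: "'a::euclidean_space \<Rightarrow> real"
  assumes f: "integrable lborel f"
    and 0: "\<And>\<xi>. (CLINT x|lborel. cis (\<xi> \<bullet> x) * of_real (f x)) = 0"
  shows "AE x in lborel. f x = 0"
proof (rule density_unique_real[OF f])
  fix A :: "'a set" assume A: "A \<in> sets lborel"
  let ?G = "{(\<lambda>x::'a. x \<bullet> j) -` B \<inter> space lborel | j B. j \<in> Basis \<and> B \<in> sets borel} \<union> null_sets lborel"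
  have G: "?G \<subseteq> Pow (space lborel)" by auto
  have "(\<lambda>x::'a. x) \<in> borel_measurable (sigma (space lborel) ?G)"
  proof (subst borel_measurable_euclidean_space, intro ballI measurableI)
    fix i :: 'a and B :: "real set" assume "i \<in> Basis" "B \<in> sets borel"
    then have "(\<lambda>x. x \<bullet> i) -` B \<inter> space lborel \<in> ?G" by blast
    then show "(\<lambda>x. x \<bullet> i) -` B \<inter> space (sigma (space lborel) ?G) \<in> sets (sigma (space lborel) ?G)"
      using G by (simp add: space_measure_of_conv sets_measure_of sigma_sets.Basic)
  qed simp
  from measurable_sets[OF this, of A] A
  have S: "A \<in> sigma_sets (space lborel) ?G"
    using G by (simp add: space_measure_of_conv sets_measure_of)
  have "(LINT x|lborel. f x * indicator A x) = 0"
  proof (rule set_integral_eq_0_of_iexp[where I=Basis and Z="\<lambda>j x. x \<bullet> j", OF f _ _ S])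
    fix J :: "'a set" and c :: "'a \<Rightarrow> real"
    have "(\<Sum>j\<in>J. c j * (x \<bullet> j)) = (\<Sum>j\<in>J. c j *\<^sub>R j) \<bullet> x" for x
      by (simp add: inner_sum_left inner_commute[of x])
    then show "(CLINT x|lborel. of_real (f x) * cis (\<Sum>j\<in>J. c j * (x \<bullet> j))) = 0"
      using 0[of "\<Sum>j\<in>J. c j *\<^sub>R j"] by (simp add: mult.commute)
  qed simp
  then show "set_lebesgue_integral lborel A f = set_lebesgue_integral lborel A (\<lambda>x. 0)"
    by (simp add: set_lebesgue_integral_def mult.commute)
qed simp

lemma continuous_AE_eq_imp_eq:
  fixes f g :: "'a::euclidean_space \<Rightarrow> real"
  assumes "continuous_on UNIV f" "continuous_on UNIV g" and ae: "AE x in lborel. f x = g x"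
  shows "f x = g x"
proof (rule ccontr)
  assume "f x \<noteq> g x"
  moreover have "open {x. f x \<noteq> g x}"
    by (rule open_Collect_neq) (use assms in auto)
  ultimately obtain e where e: "e > 0" "ball x e \<subseteq> {x. f x \<noteq> g x}"
    using open_contains_ball by blast
  have "AE y in lborel. y \<notin> ball x e" using ae by eventually_elim (use e in auto)
  then have "emeasure lborel (ball x e) = 0"
    by (subst (asm) AE_iff_measurable[of "ball x e"]) auto
  then have "measure lborel (ball x e) = 0" by (simp add: measure_def)
  then show False using content_ball_pos[OF e(1), of x] by simp
qed

lemma nn_integral_lborel_affine:
  fixes f :: "'a::euclidean_space \<Rightarrow> ennreal"
  assumes [measurable]: "f \<in> borel_measurable borel" and "c \<noteq> 0"
  shows "(\<integral>\<^sup>+x. f x \<partial>lborel) = ennreal (\<bar>c\<bar> ^ DIM('a)) * (\<integral>\<^sup>+x. f (t + c *\<^sub>R x) \<partial>lborel)"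
  by (subst lborel_affine[OF assms(2), of t])
    (simp add: nn_integral_density nn_integral_distr nn_integral_cmult)

lemma lborel_integral_affine:
  fixes f :: "'a::euclidean_space \<Rightarrow> complex"
  assumes [measurable]: "f \<in> borel_measurable borel" and "c \<noteq> 0"
  shows "(\<integral>x. f x \<partial>lborel) = (\<bar>c\<bar> ^ DIM('a)) *\<^sub>R (\<integral>x. f (t + c *\<^sub>R x) \<partial>lborel)"
  by (subst lborel_affine[OF assms(2), of t])
    (simp add: integral_density integral_distr)

text \<open>Needed with a negative \<open>c\<close>, to read an almost-everywhere bound on the
  kernel at \<open>(x - y) / s\<close> as a statement about \<open>y\<close>.\<close>

lemma AE_lborel_affine:
  fixes P :: "'a::euclidean_space \<Rightarrow> bool"
  assumes P: "AE x in lborel. P x" and c: "c \<noteq> 0"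
  shows "AE x in lborel. P (t + c *\<^sub>R x)"
proof -
  obtain N where N: "{x. \<not> P x} \<subseteq> N" "N \<in> sets borel" "emeasure lborel N = 0"
    using P by (auto elim!: AE_E)
  have [measurable]: "N \<in> sets borel" by fact
  have "0 = ennreal (\<bar>c\<bar> ^ DIM('a)) * (\<integral>\<^sup>+x. indicator N (t + c *\<^sub>R x) \<partial>lborel)"
    using nn_integral_lborel_affine[of "indicator N" c t] N c by simp
  then have "(\<integral>\<^sup>+x. indicator N (t + c *\<^sub>R x) \<partial>lborel) = 0" 
  proof -
    have "\<bar>c\<bar> ^ DIM('a) > 0" using c by simp
    then have "ennreal (\<bar>c\<bar> ^ DIM('a)) \<noteq> 0" by (simp only: ennreal_eq_0_iff not_le)
    then show ?thesis using \<open>0 = _\<close> by simp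
  qed
  then have "AE x in lborel. indicator N (t + c *\<^sub>R x) = (0::ennreal)"
    by (subst (asm) nn_integral_0_iff_AE) auto
  then show ?thesis by eventually_elim (use N in \<open>auto simp: indicator_def split: if_splits\<close>)
qed

lemma stable_density_continuous:
  assumes "stable_density \<nu> \<alpha> p" "t > 0"
  shows "continuous_on UNIV (p t)"
proof -
  have "continuous_on UNIV ((\<lambda>(t, x). p t x) \<circ> (\<lambda>x. (t, x)))"
    by (rule continuous_on_compose)
      (use assms in \<open>auto simp: stable_density_def intro!: continuous_intros elim!: continuous_on_subset\<close>)
  then show ?thesis by (simp add: o_def)
qed

text \<open>Both sides have the Fourier transform belonging to time \<open>s\<close>: rescaling by
  \<open>c = s powr (- 1 / \<alpha>)\<close> multiplies \<open>norm \<xi> powr \<alpha>\<close> by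
  \<open>(1 / c) powr \<alpha> = s\<close>. Uniqueness gives equality almost everywhere, and
  continuity gives it at every \<open>x\<close>.\<close>

lemma stable_density_scaling:
  fixes p :: "real \<Rightarrow> 'a::euclidean_space \<Rightarrow> real"
  assumes p: "stable_density \<nu> \<alpha> p" and "\<alpha> > 0" "s > 0"
  shows "p s x = s powr (- real DIM('a) / \<alpha>) * p 1 ((s powr (- 1 / \<alpha>)) *\<^sub>R x)"
proof -
  define c where "c = s powr (- 1 / \<alpha>)"
  define q where "q = (\<lambda>x. c ^ DIM('a) * p 1 (c *\<^sub>R x))"
  have c: "c > 0" using \<open>s > 0\<close> by (simp add: c_def)
  have pt: "integrable lborel (p t)"
    "(CLINT x|lborel. cis (\<xi> \<bullet> x) * of_real (p t x)) = of_real (exp (- (t * \<nu> * norm \<xi> powr \<alpha>)))"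
    "p t x \<ge> 0" if "t > 0" for t x and \<xi>
    using p that by (auto simp: stable_density_def)
  have cont: "continuous_on UNIV (p t)" if "t > 0" for t by (rule stable_density_continuous[OF p that])
  have [measurable]: "p 1 \<in> borel_measurable borel" "p s \<in> borel_measurable borel"
    using cont \<open>s > 0\<close> by (auto intro!: borel_measurable_continuous_onI)
  have iq: "integrable lborel q"
  proof (rule integrableI_bounded)
    show "q \<in> borel_measurable lborel" by (simp add: q_def)
    have "(\<integral>\<^sup>+x. ennreal (norm (q x)) \<partial>lborel) = ennreal (c ^ DIM('a)) * (\<integral>\<^sup>+x. ennreal (p 1 (0 + c *\<^sub>R x)) \<partial>lborel)"
      using c by (subst nn_integral_cmult[symmetric]) (auto simp: q_def pt abs_mult ennreal_mult)
    also have "\<dots> = (\<integral>\<^sup>+x. ennreal (p 1 x) \<partial>lborel)"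
      using c by (subst nn_integral_lborel_affine[where c=c and t=0]) auto
    also have "\<dots> < \<infinity>"
      using pt by (subst nn_integral_eq_integral) auto
    finally show "(\<integral>\<^sup>+x. ennreal (norm (q x)) \<partial>lborel) < \<infinity>" .
  qed
  have Fq: "(CLINT x|lborel. cis (\<xi> \<bullet> x) * of_real (q x)) = of_real (exp (- (s * \<nu> * norm \<xi> powr \<alpha>)))" for \<xi>
  proof -
    have "(CLINT x|lborel. cis (\<xi> \<bullet> x) * of_real (q x))
      = (c ^ DIM('a)) *\<^sub>R (CLINT x|lborel. cis (((1 / c) *\<^sub>R \<xi>) \<bullet> (0 + c *\<^sub>R x)) * of_real (p 1 (0 + c *\<^sub>R x)))"
      using c by (subst integral_scaleR_right[symmetric]) (auto simp: q_def scaleR_conv_of_real mult_ac)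
    also have "\<dots> = (CLINT x|lborel. cis (((1 / c) *\<^sub>R \<xi>) \<bullet> x) * of_real (p 1 x))"
      using c by (subst lborel_integral_affine[where c=c and t=0]) auto
    also have "\<dots> = of_real (exp (- (1 * \<nu> * norm ((1 / c) *\<^sub>R \<xi>) powr \<alpha>)))"
      by (rule pt) simp
    also have "norm ((1 / c) *\<^sub>R \<xi>) powr \<alpha> = (1 / c) powr \<alpha> * norm \<xi> powr \<alpha>"
      using c by (simp add: powr_mult[symmetric])
    also have "(1 / c) powr \<alpha> = s"
      using \<open>s > 0\<close> \<open>\<alpha> > 0\<close> by (simp add: c_def powr_minus_divide[symmetric] powr_powr flip: powr_minus)
    finally show ?thesis by (simp add: mult_ac)
  qed
  have iF: "integrable lborel (\<lambda>x. cis (\<xi> \<bullet> x) * of_real (f x))" if [measurable]: "integrable lborel f" for f :: "'a \<Rightarrow> real" and \<xi>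
    by (rule Bochner_Integration.integrable_bound[OF that]) (auto simp: norm_mult)
  have "AE x in lborel. p s x - q x = 0"
  proof (rule AE_eq_0_of_fourier_0)
    show "integrable lborel (\<lambda>x. p s x - q x)" using iq pt(1)[OF \<open>s > 0\<close>] by auto
    fix \<xi> :: 'a
    have "(CLINT x|lborel. cis (\<xi> \<bullet> x) * of_real (p s x - q x))
      = (CLINT x|lborel. cis (\<xi> \<bullet> x) * of_real (p s x)) - (CLINT x|lborel. cis (\<xi> \<bullet> x) * of_real (q x))"
      by (subst Bochner_Integration.integral_diff[symmetric])
        (auto intro!: iF iq pt \<open>s > 0\<close> simp: right_diff_distrib)
    then show "(CLINT x|lborel. cis (\<xi> \<bullet> x) * of_real (p s x - q x)) = 0"
      by (simp only: pt(2)[OF \<open>s > 0\<close>] Fq) simp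
  qed
  then have ae: "AE x in lborel. p s x = q x" by simp
  have "continuous_on UNIV (\<lambda>x. p 1 (c *\<^sub>R x))"
    by (rule continuous_on_compose2[OF cont[of 1]]) (auto intro!: continuous_intros)
  then have "continuous_on UNIV q" unfolding q_def by (intro continuous_intros)
  then have "p s x = q x" by (rule continuous_AE_eq_imp_eq[OF cont[OF \<open>s > 0\<close>] _ ae])
  also have "c ^ DIM('a) = s powr (- real DIM('a) / \<alpha>)"
    using c by (simp add: c_def powr_realpow[symmetric] powr_powr)
  then have "q x = s powr (- real DIM('a) / \<alpha>) * p 1 (c *\<^sub>R x)" by (simp add: q_def)
  finally show ?thesis by (simp add: c_def)
qed

section \<open>First passage times of the stable subordinator\<close>

text \<open>
  For \<open>X \<ge> 0\<close> the variable \<open>exp (- X)\<close> is bounded, and its moments are values of the Laplace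
  transform; these determine its characteristic function.
\<close>

lemma char_exp_neg:
  fixes X :: "'v \<Rightarrow> real"
  assumes "prob_space N" and X[measurable]: "X \<in> borel_measurable N" and nn: "\<And>\<omega>. \<omega> \<in> space N \<Longrightarrow> 0 \<le> X \<omega>"
  shows "(\<lambda>n. (\<i> * of_real t) ^ n / of_real (fact n) * of_real (LINT \<omega>|N. exp (- real n * X \<omega>)))
    sums char (distr N borel (\<lambda>\<omega>. exp (- X \<omega>))) t"
proof -
  interpret prob_space N by fact
  let ?f = "\<lambda>n \<omega>. (\<i> * of_real t) ^ n / of_real (fact n) * of_real (exp (- real n * X \<omega>)) :: complex"
  have e: "?f n \<omega> = (\<i> * of_real (t * exp (- X \<omega>))) ^ n / of_real (fact n)" for n \<omega>
    by (simp add: power_mult_distrib exp_of_nat_mult[symmetric] flip: of_real_power)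
  have bd: "norm (?f n \<omega>) \<le> \<bar>t\<bar> ^ n / fact n" if "\<omega> \<in> space N" for n \<omega>
    using nn[OF that] by (auto simp: norm_mult norm_divide norm_power divide_simps intro!: mult_left_le)
  have sm: "summable (\<lambda>n. \<bar>t\<bar> ^ n / fact n)"
    using summable_exp[of "\<bar>t\<bar>"] by (simp add: divide_inverse mult.commute)
  have i: "integrable N (?f n)" for n
    by (rule integrable_const_bound[where B="\<bar>t\<bar> ^ n / fact n"]) (use bd in auto)
  have "(\<lambda>n. LINT \<omega>|N. ?f n \<omega>) sums (LINT \<omega>|N. (\<Sum>n. ?f n \<omega>))"
  proof (rule sums_integral[OF i])
    show "AE \<omega> in N. summable (\<lambda>n. norm (?f n \<omega>))"
    proof (rule AE_I2)
      fix \<omega> assume "\<omega> \<in> space N"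
      then show "summable (\<lambda>n. norm (?f n \<omega>))"
        using bd by (intro summable_comparison_test[OF _ sm]) auto
    qed
    show "summable (\<lambda>n. LINT \<omega>|N. norm (?f n \<omega>))"
    proof (rule summable_comparison_test[OF _ sm], intro exI[of _ 0] allI impI)
      fix n :: nat
      have "(LINT \<omega>|N. norm (?f n \<omega>)) \<le> (LINT \<omega>|N. \<bar>t\<bar> ^ n / fact n)"
        by (rule integral_mono) (use i bd in auto)
      moreover have "0 \<le> (LINT \<omega>|N. norm (?f n \<omega>))" by simp
      ultimately show "norm (LINT \<omega>|N. norm (?f n \<omega>)) \<le> \<bar>t\<bar> ^ n / fact n"
        by (simp add: prob_space)
    qed
  qed
  moreover have "(LINT \<omega>|N. ?f n \<omega>)
      = (\<i> * of_real t) ^ n / of_real (fact n) * of_real (LINT \<omega>|N. exp (- real n * X \<omega>))" for n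
    by (simp only: Bochner_Integration.integral_mult_right_zero integral_complex_of_real)
  moreover have "(\<Sum>n. ?f n \<omega>) = iexp (t * exp (- X \<omega>))" for \<omega>
  proof -
    have "(\<lambda>n. (\<i> * of_real (t * exp (- X \<omega>))) ^ n /\<^sub>R fact n) sums iexp (t * exp (- X \<omega>))"
      by (rule exp_converges)
    moreover have "z ^ n /\<^sub>R fact n = z ^ n / of_real (fact n)" for z :: complex and n
      by (simp add: scaleR_conv_of_real divide_inverse mult.commute)
    ultimately show ?thesis unfolding e by (simp only: sums_unique[symmetric])
  qed
  ultimately show ?thesis
    unfolding char_def by (subst integral_distr) auto
qed

lemma Laplace_unique:
  fixes X :: "'v \<Rightarrow> real" and Y :: "'w \<Rightarrow> real"
  assumes N: "prob_space N" and X[measurable]: "X \<in> borel_measurable N" and Xn: "\<And>\<omega>. \<omega> \<in> space N \<Longrightarrow> 0 \<le> X \<omega>"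
    and M: "prob_space M" and Y[measurable]: "Y \<in> borel_measurable M" and Yn: "\<And>\<omega>. \<omega> \<in> space M \<Longrightarrow> 0 \<le> Y \<omega>"
    and L: "\<And>n::nat. (LINT \<omega>|N. exp (- real n * X \<omega>)) = (LINT \<omega>|M. exp (- real n * Y \<omega>))"
  shows "distr N borel X = distr M borel Y"
proof -
  have rd: "real_distribution (distr N borel (\<lambda>\<omega>. exp (- X \<omega>)))"
    "real_distribution (distr M borel (\<lambda>\<omega>. exp (- Y \<omega>)))"
    by (auto simp: real_distribution_def real_distribution_axioms_def
        intro!: prob_space.prob_space_distr N M)
  have "char (distr N borel (\<lambda>\<omega>. exp (- X \<omega>))) = char (distr M borel (\<lambda>\<omega>. exp (- Y \<omega>)))"
  proof
    fix t
    show "char (distr N borel (\<lambda>\<omega>. exp (- X \<omega>))) t = char (distr M borel (\<lambda>\<omega>. exp (- Y \<omega>))) t"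
      using char_exp_neg[OF N X Xn, of t] unfolding L
      by (rule sums_unique2[OF _ char_exp_neg[OF M Y Yn, of t]])
  qed
  then have "distr N borel (\<lambda>\<omega>. exp (- X \<omega>)) = distr M borel (\<lambda>\<omega>. exp (- Y \<omega>))"
    by (rule Levy_uniqueness[OF rd])
  \<comment> \<open>The map \<open>exp (- x)\<close> loses no information: \<open>- ln z\<close>
    undoes it and carries the equality of laws back to \<open>X\<close> and
    \<open>Y\<close>.\<close>
  then have "distr (distr N borel (\<lambda>\<omega>. exp (- X \<omega>))) borel (\<lambda>z. - ln z)
    = distr (distr M borel (\<lambda>\<omega>. exp (- Y \<omega>))) borel (\<lambda>z. - ln z)" by simp
  then show ?thesis by (subst (asm) (1 2) distr_distr) (auto simp: o_def)
qed

context
  fixes \<beta> :: real and N :: "'v measure" and D :: "real \<Rightarrow> 'v \<Rightarrow> real"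
  assumes \<beta>: "\<beta> > 0" and sub: "stable_subordinator \<beta> N D"
begin

interpretation prob_space N using sub by (simp add: stable_subordinator_def)

lemma subordinator_measurable: "r \<ge> 0 \<Longrightarrow> D r \<in> borel_measurable N"
  using sub by (simp add: stable_subordinator_def)

lemma subordinator_mono: "\<omega> \<in> space N \<Longrightarrow> 0 \<le> r \<Longrightarrow> r \<le> s \<Longrightarrow> D r \<omega> \<le> D s \<omega>"
  using sub by (auto simp: stable_subordinator_def mono_on_def)

lemma subordinator_nonneg: "\<omega> \<in> space N \<Longrightarrow> 0 \<le> r \<Longrightarrow> 0 \<le> D r \<omega>"
  using subordinator_mono[of \<omega> 0 r] sub by (auto simp: stable_subordinator_def)

lemma subordinator_Laplace:
  assumes "s \<ge> 0" "\<theta> \<ge> 0"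
  shows "(LINT \<omega>|N. exp (- \<theta> * D s \<omega>)) = exp (- s * \<theta> powr \<beta>)"
proof -
  have "(LINT \<omega>|N. exp (- \<theta> * D s \<omega>)) = (LINT \<omega>|N. exp (- \<theta> * (D (0 + s) \<omega> - D 0 \<omega>)))"
    by (rule Bochner_Integration.integral_cong) (use sub in \<open>auto simp: stable_subordinator_def\<close>)
  also have "\<dots> = exp (- s * \<theta> powr \<beta>)"
    using sub assms unfolding stable_subordinator_def by blast
  finally show ?thesis .
qed

text \<open>The Laplace exponent is homogeneous of degree \<open>\<beta>\<close>: replacing
  \<open>\<theta>\<close> by \<open>\<theta> * s powr (1 / \<beta>)\<close> at time 1 has the effect
  of time \<open>s\<close>.\<close>

lemma subordinator_scaling:
  assumes s: "s > 0"
  shows "distr N borel (D s) = distr N borel (\<lambda>\<omega>. s powr (1 / \<beta>) * D 1 \<omega>)"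
proof (rule Laplace_unique)
  fix n :: nat
  have [measurable]: "D 1 \<in> borel_measurable N" by (simp add: subordinator_measurable)
  have "(LINT \<omega>|N. exp (- real n * (s powr (1 / \<beta>) * D 1 \<omega>))) = exp (- 1 * (real n * s powr (1 / \<beta>)) powr \<beta>)"
    using subordinator_Laplace[of 1 "real n * s powr (1 / \<beta>)"] by (simp add: mult.assoc)
  also have "(real n * s powr (1 / \<beta>)) powr \<beta> = s * real n powr \<beta>"
    using s \<beta> by (simp add: powr_mult powr_powr mult.commute)
  finally show "(LINT \<omega>|N. exp (- real n * D s \<omega>)) = (LINT \<omega>|N. exp (- real n * (s powr (1 / \<beta>) * D 1 \<omega>)))"
    using subordinator_Laplace[of s "real n"] s by simp
qed (use s subordinator_measurable[of s] subordinator_measurable[of 1]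
    in \<open>auto intro!: subordinator_nonneg mult_nonneg_nonneg prob_space_axioms\<close>)

text \<open>Ensures that \<open>first_passage\<close> takes the infimum of a nonempty set. By the
  exponential Markov inequality, \<open>D n\<close> stays below \<open>t\<close> with probability at
  most \<open>exp t * exp (- n)\<close>.\<close>

lemma subordinator_unbounded:
  "AE \<omega> in N. \<exists>r\<ge>0. D r \<omega> > t"
proof -
  have Dm[measurable]: "D (real n) \<in> borel_measurable N" for n by (simp add: subordinator_measurable)
  define A where "A = {\<omega> \<in> space N. \<forall>n::nat. D (real n) \<omega> \<le> t}"
  have [measurable]: "A \<in> sets N" unfolding A_def by measurable
  have "measure N A \<le> exp t * exp (- real n)" for n :: nat
  proof -
    have i: "integrable N (\<lambda>\<omega>. exp t * exp (- 1 * D (real n) \<omega>))"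
      by (intro integrable_mult_right integrable_const_bound[where B=1] AE_I2) (auto simp: subordinator_nonneg)
    have "measure N A = (LINT \<omega>|N. indicator A \<omega>)" by simp
    also have "\<dots> \<le> (LINT \<omega>|N. exp t * exp (- 1 * D (real n) \<omega>))"
    proof (rule integral_mono[OF _ i])
      fix \<omega> assume "\<omega> \<in> space N"
      show "indicator A \<omega> \<le> exp t * exp (- 1 * D (real n) \<omega>)"
        by (auto simp: indicator_def A_def exp_add[symmetric])
    qed (auto simp: less_top[symmetric])
    also have "\<dots> = exp t * exp (- real n)"
      using subordinator_Laplace[of "real n" 1] by simp
    finally show ?thesis .
  qed
  moreover have "(\<lambda>n. exp t * exp (- real n)) \<longlonglongrightarrow> exp t * 0"
  proof (intro tendsto_intros)
    show "(\<lambda>n. exp (- real n)) \<longlonglongrightarrow> 0"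
      by (rule filterlim_compose[OF exp_at_bot]) (rule filterlim_compose[OF filterlim_uminus_at_bot_at_top filterlim_real_sequentially])
  qed
  ultimately have "measure N A \<le> 0"
    by (intro LIMSEQ_le_const[of "\<lambda>n. exp t * exp (- real n)"]) auto
  then have "A \<in> null_sets N" by (auto simp: null_sets_def emeasure_eq_measure antisym)
  from AE_not_in[OF this] AE_space show ?thesis
  proof eventually_elim
    case (elim \<omega>)
    then obtain n :: nat where "t < D (real n) \<omega>" by (auto simp: A_def not_le)
    then show ?case by (intro exI[of _ "real n"]) auto
  qed
qed

context
  fixes fE :: "real \<Rightarrow> real \<Rightarrow> real"
  assumes fpd: "first_passage_density N D fE"
begin

lemma first_passage_distributed:
  "t > 0 \<Longrightarrow> distributed N lborel (first_passage D t) (\<lambda>s. ennreal (fE t s))"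
  "t > 0 \<Longrightarrow> fE t s \<ge> 0"
  using fpd by (auto simp: first_passage_density_def)

lemma first_passage_measurable: "t > 0 \<Longrightarrow> first_passage D t \<in> borel_measurable N"
  using first_passage_distributed(1)[of t] by (auto simp: distributed_def)

text \<open>The value 0 is excluded because the law has a density; so the restriction to
  \<open>s > 0\<close> in \<open>kernel_G\<close> loses no mass.\<close>

lemma first_passage_AE_pos: 
  assumes "t > 0"
  shows "AE \<omega> in N. first_passage D t \<omega> > 0"
proof -
  have "AE \<omega> in N. first_passage D t \<omega> \<ge> 0"
    using subordinator_unbounded[of t]
    by eventually_elim (auto simp: first_passage_def intro!: cInf_greatest)
  moreover have "AE \<omega> in N. first_passage D t \<omega> \<noteq> 0"
    using distributed_AE2[OF first_passage_distributed(1)[OF assms], of "\<lambda>s. s \<noteq> 0"] AE_lborel_singleton[of 0]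
    by auto
  ultimately show ?thesis by eventually_elim auto
qed

text \<open>The duality between a monotone process and its inverse, which transfers the scaling of
  \<open>D\<close> to the passage times.\<close>

lemma first_passage_cdf:
  assumes t: "t > 0" and s: "s > 0"
  shows "measure N {\<omega>\<in>space N. first_passage D t \<omega> \<le> s} = measure N {\<omega>\<in>space N. D s \<omega> > t}"
proof (rule measure_eq_AE)
  \<comment> \<open>On the event that the passage time equals \<open>s\<close>, the level may still
    not be exceeded at time \<open>s\<close> itself; a law with a density gives this event
    probability zero.\<close>
  have "AE \<omega> in N. first_passage D t \<omega> \<noteq> s"
    using distributed_AE2[OF first_passage_distributed(1)[OF t], of "\<lambda>x. x \<noteq> s"] AE_lborel_singleton[of s]
    by auto
  with subordinator_unbounded[of t]
  show "AE \<omega> in N. \<omega> \<in> {\<omega>\<in>space N. first_passage D t \<omega> \<le> s} \<longleftrightarrow> \<omega> \<in> {\<omega>\<in>space N. D s \<omega> > t}"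
  proof (eventually_elim, safe)
    fix \<omega> r assume *: "first_passage D t \<omega> \<noteq> s" "0 \<le> r" "t < D r \<omega>" "\<omega> \<in> space N" "first_passage D t \<omega> \<le> s"
    then have "first_passage D t \<omega> < s" by simp
    then obtain r' where "0 \<le> r'" "t < D r' \<omega>" "r' < s"
      using * cInf_lessD[of "{r. 0 \<le> r \<and> D r \<omega> > t}" s] by (auto simp: first_passage_def)
    then show "t < D s \<omega>" using subordinator_mono[OF *(4), of r' s] by simp
  next
    fix \<omega> assume "t < D s \<omega>"
    then show "first_passage D t \<omega> \<le> s"
      unfolding first_passage_def using s by (intro cInf_lower) (auto intro!: bdd_belowI[of _ 0])
  qed
qed (use t s subordinator_measurable[of s] first_passage_measurable[of t] in auto)

text \<open>With \<open>s' = s / t powr \<beta>\<close> the duality reduces the claim to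
  \<open>D s > t\<close> and \<open>D s' > 1\<close> having the same probability. By
  \<open>subordinator_scaling\<close> both are the probability that
  \<open>s powr (1 / \<beta>) * D 1\<close> exceeds \<open>t\<close>.\<close>

lemma first_passage_scaling:
  assumes t: "t > 0"
  shows "distr N borel (first_passage D t) = distr N borel (\<lambda>\<omega>. t powr \<beta> * first_passage D 1 \<omega>)"
proof (rule cdf_unique)
  note [measurable] = first_passage_measurable[OF t] first_passage_measurable[OF zero_less_one]
  show "real_distribution (distr N borel (first_passage D t))"
    "real_distribution (distr N borel (\<lambda>\<omega>. t powr \<beta> * first_passage D 1 \<omega>))"
    by (auto simp: real_distribution_def real_distribution_axioms_def intro!: prob_space_distr)
  show "cdf (distr N borel (first_passage D t)) = cdf (distr N borel (\<lambda>\<omega>. t powr \<beta> * first_passage D 1 \<omega>))"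
  proof
    fix s :: real
    have 1: "cdf (distr N borel (first_passage D t)) s = measure N {\<omega>\<in>space N. first_passage D t \<omega> \<le> s}"
      by (auto simp: cdf_def measure_distr intro!: arg_cong[where f="measure N"])
    have 2: "cdf (distr N borel (\<lambda>\<omega>. t powr \<beta> * first_passage D 1 \<omega>)) s
        = measure N {\<omega>\<in>space N. first_passage D 1 \<omega> \<le> s / t powr \<beta>}"
      using t by (auto simp: cdf_def measure_distr field_simps intro!: arg_cong[where f="measure N"])
    show "cdf (distr N borel (first_passage D t)) s = cdf (distr N borel (\<lambda>\<omega>. t powr \<beta> * first_passage D 1 \<omega>)) s"
    proof (cases "s > 0")
      case True
      define s' where "s' = s / t powr \<beta>"
      have s': "s' > 0" using True t by (simp add: s'_def)
      note [measurable] = subordinator_measurable[of s] subordinator_measurable[of s'] subordinator_measurable[of 1]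
      have *: "measure N {\<omega>\<in>space N. D r \<omega> > u} = measure N {\<omega>\<in>space N. r powr (1 / \<beta>) * D 1 \<omega> > u}"
        if "r > 0" for r u
      proof -
        note [measurable] = subordinator_measurable[of r]
        have "measure N {\<omega>\<in>space N. D r \<omega> > u} = measure (distr N borel (D r)) {u<..}"
          using that by (subst measure_distr) (auto intro!: arg_cong[where f="measure N"])
        also have "\<dots> = measure (distr N borel (\<lambda>\<omega>. r powr (1 / \<beta>) * D 1 \<omega>)) {u<..}"
          by (simp add: subordinator_scaling[OF that])
        also have "\<dots> = measure N {\<omega>\<in>space N. r powr (1 / \<beta>) * D 1 \<omega> > u}"
          by (subst measure_distr) (auto intro!: arg_cong[where f="measure N"])
        finally show ?thesis .
      qed
      have "s' powr (1 / \<beta>) = s powr (1 / \<beta>) / t"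
        using True t \<beta> by (simp add: s'_def powr_divide powr_powr)
      then have "s' powr (1 / \<beta>) * d > 1 \<longleftrightarrow> s powr (1 / \<beta>) * d > t" for d
        using t by (simp only: times_divide_eq_left less_divide_eq_1_pos)
      then show ?thesis
        unfolding 1 2 s'_def[symmetric] first_passage_cdf[OF t True] first_passage_cdf[OF zero_less_one s']
          *[OF True] *[OF s'] by simp
    next
      case False
      \<comment> \<open>The duality covers \<open>s > 0\<close>; for the other \<open>s\<close> both
        distribution functions vanish.\<close>
      have z: "measure N {\<omega>\<in>space N. first_passage D u \<omega> \<le> v} = 0" if "u > 0" "v \<le> 0" for u v
      proof -
        note [measurable] = first_passage_measurable[OF that(1)]
        have "AE \<omega> in N. \<omega> \<notin> {\<omega>\<in>space N. first_passage D u \<omega> \<le> v}"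
          using first_passage_AE_pos[OF that(1)] by eventually_elim (use that in auto)
        then have "{\<omega>\<in>space N. first_passage D u \<omega> \<le> v} \<in> null_sets N"
          by (subst AE_iff_null_sets) auto
        then show ?thesis by (simp add: measure_def null_sets_def)
      qed
      show ?thesis unfolding 1 2 using z[OF t, of s] z[OF zero_less_one, of "s / t powr \<beta>"] False t
        by (simp add: divide_nonpos_pos)
    qed
  qed
qed

end

end

section \<open>The kernel\<close>

text \<open>Measurability, mass and lower bound are required at time 1 and carried to other times by
  \<open>scaling\<close>. The lower bound is an almost-everywhere statement because the integral
  that defines \<open>kernel_G\<close> has the value 0 where it diverges.\<close>

locale self_similar_kernel =
  fixes G :: "real \<Rightarrow> 'a::euclidean_space \<Rightarrow> real" and \<gamma> :: real
  assumes \<gamma>_pos: "\<gamma> > 0"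
    and nonneg: "t > 0 \<Longrightarrow> 0 \<le> G t x"
    and scaling: "t > 0 \<Longrightarrow> G t x = t powr (- \<gamma> * DIM('a)) * G 1 (t powr (- \<gamma>) *\<^sub>R x)"
    and measurable_1: "G 1 \<in> borel_measurable borel"
    and mass_1: "(\<integral>\<^sup>+x. ennreal (G 1 x) \<partial>lborel) = 1"
    and lower_1: "\<exists>z e c. e > 0 \<and> c > 0 \<and> (AE x in lborel. x \<in> ball z e \<longrightarrow> c \<le> G 1 x)"

section \<open>The kernel of the equation is self-similar with exponent
  \<open>\<beta> / \<alpha>\<close>\<close>

context
  fixes \<nu> \<alpha> \<beta> :: real and p :: "real \<Rightarrow> 'a::euclidean_space \<Rightarrow> real"
    and N :: "'v measure" and D :: "real \<Rightarrow> 'v \<Rightarrow> real" and fE :: "real \<Rightarrow> real \<Rightarrow> real"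
  assumes \<alpha>: "\<alpha> > 0" and \<beta>: "\<beta> > 0" and p: "stable_density \<nu> \<alpha> p"
    and sub: "stable_subordinator \<beta> N D" and fpd: "first_passage_density N D fE"
begin

interpretation prob_space N using sub by (simp add: stable_subordinator_def)

text \<open>\<open>stable_density\<close> constrains \<open>p s\<close> for \<open>s > 0\<close>
  only; the cut-off makes the kernel measurable on the whole time axis.\<close>

definition stable_kernel_nn :: "real \<Rightarrow> 'a \<Rightarrow> ennreal" where
  "stable_kernel_nn s x = ennreal (indicator {0<..} s *\<^sub>R p s x)"

lemma stable_density_nonneg: "s > 0 \<Longrightarrow> 0 \<le> p s x"
  using p by (auto simp: stable_density_def)

lemma stable_density_measurable_pair:
  "(\<lambda>(s, x). indicator {0<..} s *\<^sub>R p s x) \<in> borel_measurable (borel \<Otimes>\<^sub>M borel)"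
proof -
  have "(\<lambda>z. indicator ({0<..} \<times> UNIV) z *\<^sub>R (\<lambda>(t, x). p t x) z) \<in> borel_measurable borel"
    by (rule borel_measurable_continuous_on_indicator)
      (use p in \<open>auto simp: stable_density_def intro!: borel_open open_Times\<close>)
  then show ?thesis
    unfolding borel_prod by (simp add: case_prod_unfold indicator_times)
qed

lemma stable_kernel_nn_measurable_pair[measurable]:
  "(\<lambda>(s, x). stable_kernel_nn s x) \<in> borel_measurable (borel \<Otimes>\<^sub>M borel)"
  using measurable_compose[OF stable_density_measurable_pair measurable_ennreal]
  by (simp add: stable_kernel_nn_def case_prod_unfold)

lemma stable_kernel_nn_measurable[measurable]: "(\<lambda>s. stable_kernel_nn s x) \<in> borel_measurable borel"
  using measurable_compose[OF _ stable_kernel_nn_measurable_pair, of "\<lambda>s. (s, x)" borel] by simp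

lemma stable_density_mass:
  assumes "s > 0"
  shows "(\<integral>\<^sup>+x. ennreal (p s x) \<partial>lborel) = 1"
proof -
  have i: "integrable lborel (p s)" using p assms by (auto simp: stable_density_def)
  have "(CLINT x|lborel. cis (0 \<bullet> x) * of_real (p s x)) = of_real (exp (- (s * \<nu> * norm (0 :: 'a) powr \<alpha>)))"
    using p assms unfolding stable_density_def by blast
  then have "complex_of_real (LINT x|lborel. p s x) = 1" by simp
  then have "(LINT x|lborel. p s x) = 1" by (simp only: of_real_eq_1_iff)
  then show ?thesis
    by (subst nn_integral_eq_integral[OF i]) (use assms stable_density_nonneg in auto)
qed

text \<open>The kernel as an expectation with values in \<open>[0, \<infinity>]\<close>. It depends
  on the passage time through its law only, and Fubini and scaling apply to it without integrability
  conditions.\<close>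

definition kernel_G_nn :: "real \<Rightarrow> 'a \<Rightarrow> ennreal" where
  "kernel_G_nn t x = (\<integral>\<^sup>+\<omega>. stable_kernel_nn (first_passage D t \<omega>) x \<partial>N)"

lemma kernel_G_nn_density:
  assumes t: "t > 0"
  shows "kernel_G_nn t x = (\<integral>\<^sup>+s. ennreal (fE t s) * stable_kernel_nn s x \<partial>lborel)"
  unfolding kernel_G_nn_def
  by (rule distributed_nn_integral[OF first_passage_distributed(1)[OF \<beta> sub fpd t], symmetric]) simp

lemma fE_measurable:
  assumes t: "t > 0"
  shows "fE t \<in> borel_measurable borel"
proof -
  note fp = first_passage_distributed[OF \<beta> sub fpd t]
  have "(\<lambda>s. enn2real (ennreal (fE t s))) \<in> borel_measurable borel"
    using fp(1) by (auto simp: distributed_def)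
  then show ?thesis using fp(2) by simp
qed

text \<open>Valid at every \<open>x\<close>: where the expectation is infinite,
  \<open>enn2real\<close> and the Bochner integral of a non-integrable function both return
  0.\<close>

lemma kernel_G_eq:
  assumes t: "t > 0"
  shows "kernel_G p fE t x = enn2real (kernel_G_nn t x)"
proof -
  note fp = first_passage_distributed[OF \<beta> sub fpd t]
  note [measurable] = fE_measurable[OF t]
  have [measurable]: "(\<lambda>s. indicator {0<..} s *\<^sub>R p s x) \<in> borel_measurable borel"
    using measurable_compose[OF _ stable_density_measurable_pair, of "\<lambda>s. (s, x)" borel] by simp
  have "kernel_G p fE t x = (LINT s|lborel. fE t s * (indicator {0<..} s *\<^sub>R p s x))"
    unfolding kernel_G_def set_lebesgue_integral_def by (simp add: mult_ac)
  also have "\<dots> = enn2real (\<integral>\<^sup>+s. ennreal (fE t s * (indicator {0<..} s *\<^sub>R p s x)) \<partial>lborel)"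
  proof (rule integral_eq_nn_integral)
    show "(\<lambda>s. fE t s * (indicator {0<..} s *\<^sub>R p s x)) \<in> borel_measurable lborel" by measurable
  qed (auto simp: fp indicator_def stable_density_nonneg)
  also have "(\<integral>\<^sup>+s. ennreal (fE t s * (indicator {0<..} s *\<^sub>R p s x)) \<partial>lborel) = kernel_G_nn t x"
    unfolding kernel_G_nn_density[OF t] stable_kernel_nn_def
    by (rule nn_integral_cong) (auto simp: fp indicator_def stable_density_nonneg ennreal_mult)
  finally show ?thesis .
qed

text \<open>Time \<open>t\<close> multiplies the passage time by \<open>t powr \<beta>\<close> in
  law, and \<open>p\<close> turns a factor in time into its power \<open>1 / \<alpha>\<close> in
  space.\<close>

lemma kernel_G_nn_scaling:
  assumes t: "t > 0"
  shows "kernel_G_nn t x = ennreal (t powr (- (\<beta> / \<alpha>) * DIM('a))) * kernel_G_nn 1 (t powr (- (\<beta> / \<alpha>)) *\<^sub>R x)"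
proof -
  note [measurable] = first_passage_measurable[OF \<beta> sub fpd t] first_passage_measurable[OF \<beta> sub fpd zero_less_one]
  have st: "stable_kernel_nn (t powr \<beta> * s) x
    = ennreal (t powr (- (\<beta> / \<alpha>) * DIM('a))) * stable_kernel_nn s (t powr (- (\<beta> / \<alpha>)) *\<^sub>R x)" for s
  proof (cases "s > 0")
    case True
    have "p (t powr \<beta> * s) x = (t powr \<beta> * s) powr (- real DIM('a) / \<alpha>) * p 1 ((t powr \<beta> * s) powr (- 1 / \<alpha>) *\<^sub>R x)"
      by (rule stable_density_scaling[OF p \<alpha>]) (use t True in auto)
    also have "\<dots> = t powr (- (\<beta> / \<alpha>) * DIM('a)) * (s powr (- real DIM('a) / \<alpha>) * p 1 (s powr (- 1 / \<alpha>) *\<^sub>R t powr (- (\<beta> / \<alpha>)) *\<^sub>R x))"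
      using t True by (simp add: powr_mult powr_powr mult_ac)
    also have "\<dots> = t powr (- (\<beta> / \<alpha>) * DIM('a)) * p s (t powr (- (\<beta> / \<alpha>)) *\<^sub>R x)"
      using stable_density_scaling[OF p \<alpha> True, of "t powr (- (\<beta> / \<alpha>)) *\<^sub>R x"] by simp
    finally show ?thesis
      using t True stable_density_nonneg[OF True] by (simp add: stable_kernel_nn_def ennreal_mult)
  next
    case False
    then show ?thesis using t by (simp add: stable_kernel_nn_def zero_less_mult_iff)
  qed
  have "kernel_G_nn t x = (\<integral>\<^sup>+s. stable_kernel_nn s x \<partial>distr N borel (first_passage D t))"
    unfolding kernel_G_nn_def by (subst nn_integral_distr) auto
  also have "\<dots> = (\<integral>\<^sup>+\<omega>. stable_kernel_nn (t powr \<beta> * first_passage D 1 \<omega>) x \<partial>N)"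
    unfolding first_passage_scaling[OF \<beta> sub fpd t] by (subst nn_integral_distr) auto
  also have "\<dots> = ennreal (t powr (- (\<beta> / \<alpha>) * DIM('a))) * kernel_G_nn 1 (t powr (- (\<beta> / \<alpha>)) *\<^sub>R x)"
    unfolding st kernel_G_nn_def by (rule nn_integral_cmult) simp
  finally show ?thesis .
qed

lemma kernel_G_nn_measurable:
  assumes t: "t > 0"
  shows "kernel_G_nn t \<in> borel_measurable borel"
proof -
  note [measurable] = fE_measurable[OF t]
  have "(\<lambda>x. \<integral>\<^sup>+s. ennreal (fE t s) * stable_kernel_nn s x \<partial>lborel) \<in> borel_measurable borel"
    by measurable
  then show ?thesis unfolding kernel_G_nn_density[OF t, abs_def] .
qed

lemma kernel_G_nn_mass:
  assumes t: "t > 0"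
  shows "(\<integral>\<^sup>+x. kernel_G_nn t x \<partial>lborel) = 1"
proof -
  note [measurable] = fE_measurable[OF t] first_passage_measurable[OF \<beta> sub fpd t]
  have m: "(\<integral>\<^sup>+x. stable_kernel_nn s x \<partial>lborel) = indicator {0<..} s" for s
    using stable_density_mass[of s] by (auto simp: stable_kernel_nn_def indicator_def)
  have "(\<integral>\<^sup>+x. kernel_G_nn t x \<partial>lborel)
    = (\<integral>\<^sup>+x. (\<integral>\<^sup>+s. ennreal (fE t s) * stable_kernel_nn s x \<partial>lborel) \<partial>lborel)"
    by (simp add: kernel_G_nn_density[OF t])
  also have "\<dots> = (\<integral>\<^sup>+s. (\<integral>\<^sup>+x. ennreal (fE t s) * stable_kernel_nn s x \<partial>lborel) \<partial>lborel)"
    by (rule lborel_pair.Fubini') measurable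
  also have "\<dots> = (\<integral>\<^sup>+s. ennreal (fE t s) * indicator {0<..} s \<partial>lborel)"
    by (simp add: nn_integral_cmult m)
  also have "\<dots> = (\<integral>\<^sup>+\<omega>. indicator {0<..} (first_passage D t \<omega>) \<partial>N)"
    by (rule distributed_nn_integral[OF first_passage_distributed(1)[OF \<beta> sub fpd t]]) simp
  also have "\<dots> = (\<integral>\<^sup>+\<omega>. 1 \<partial>N)"
    by (rule nn_integral_cong_AE)
      (use first_passage_AE_pos[OF \<beta> sub fpd t] in \<open>eventually_elim, simp\<close>)
  also have "\<dots> = 1" by (simp add: emeasure_space_1)
  finally show ?thesis .
qed

lemma kernel_G_nn_AE_eq:
  assumes t: "t > 0"
  shows "AE x in lborel. ennreal (kernel_G p fE t x) = kernel_G_nn t x"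
proof -
  have "AE x in lborel. kernel_G_nn t x \<noteq> \<infinity>"
    by (rule nn_integral_noteq_infinite) (use kernel_G_nn_measurable[OF t] kernel_G_nn_mass[OF t] in auto)
  then show ?thesis
    by eventually_elim (simp add: kernel_G_eq[OF t] less_top)
qed

text \<open>Otherwise every positive time is the centre of a ball of probability zero; by Lindelof
  countably many of these balls cover the half-line, in which the passage time lies almost
  surely.\<close>

lemma first_passage_support_point:
  "\<exists>s0>0. \<forall>\<delta>>0. measure N {\<omega> \<in> space N. first_passage D 1 \<omega> \<in> ball s0 \<delta>} > 0"
proof (rule ccontr)
  note [measurable] = first_passage_measurable[OF \<beta> sub fpd zero_less_one]
  assume "\<not> ?thesis"
  then have "\<forall>s0>0. \<exists>\<delta>>0. measure N {\<omega> \<in> space N. first_passage D 1 \<omega> \<in> ball s0 \<delta>} = 0"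
    by (metis measure_nonneg order_le_less)
  then obtain \<delta> where \<delta>: "\<And>s. s > 0 \<Longrightarrow> \<delta> s > 0"
      "\<And>s. s > 0 \<Longrightarrow> measure N {\<omega> \<in> space N. first_passage D 1 \<omega> \<in> ball s (\<delta> s)} = 0"
    by metis
  define \<F> where "\<F> = (\<lambda>s. ball s (\<delta> s)) ` {0<..}"
  obtain \<F>' where \<F>': "\<F>' \<subseteq> \<F>" "countable \<F>'" "\<Union>\<F>' = \<Union>\<F>"
    using Lindelof[of \<F>] by (auto simp: \<F>_def)
  have "AE \<omega> in N. \<forall>S\<in>\<F>'. first_passage D 1 \<omega> \<notin> S"
  proof (subst AE_ball_countable[OF \<F>'(2)], rule ballI)
    fix S assume "S \<in> \<F>'"
    then obtain s where s: "s > 0" "S = ball s (\<delta> s)" using \<F>' by (auto simp: \<F>_def)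
    have "{\<omega> \<in> space N. first_passage D 1 \<omega> \<in> ball s (\<delta> s)} \<in> null_sets N"
      using \<delta>(2)[OF s(1)] by (auto simp: null_sets_def emeasure_eq_measure)
    from AE_not_in[OF this] AE_space show "AE \<omega> in N. first_passage D 1 \<omega> \<notin> S"
      by eventually_elim (simp add: s)
  qed
  with first_passage_AE_pos[OF \<beta> sub fpd zero_less_one] have "AE \<omega> in N. False"
  proof eventually_elim
    case (elim \<omega>)
    then have "first_passage D 1 \<omega> \<in> \<Union>\<F>"
      unfolding \<F>_def using \<delta>(1) by (intro UnionI[of "ball (first_passage D 1 \<omega>) (\<delta> (first_passage D 1 \<omega>))"]) auto
    then show ?case using elim(2) \<F>'(3) by blast
  qed
  then show False by simp
qed

text \<open>As \<open>p s0\<close> has mass 1 it is positive at some \<open>z\<close>, and joint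
  continuity keeps \<open>p\<close> above half of that value, \<open>q\<close>, near
  \<open>(s0, z)\<close>. The passage time is close to \<open>s0\<close> with a probability
  \<open>m > 0\<close>, so averaging leaves at least \<open>q * m\<close>.\<close>

lemma kernel_G_nn_lower:
  "\<exists>z e c. e > 0 \<and> c > 0 \<and> (\<forall>x\<in>ball z e. ennreal c \<le> kernel_G_nn 1 x)"
proof -
  note [measurable] = first_passage_measurable[OF \<beta> sub fpd zero_less_one]
  obtain s0 where s0: "s0 > 0" "\<And>\<delta>. \<delta> > 0 \<Longrightarrow> measure N {\<omega> \<in> space N. first_passage D 1 \<omega> \<in> ball s0 \<delta>} > 0"
    using first_passage_support_point by blast
  have "\<exists>z. p s0 z > 0"
  proof (rule ccontr)
    assume "\<not> ?thesis"
    then have "p s0 z = 0" for z using stable_density_nonneg[OF s0(1), of z] by (force simp: not_less intro: antisym)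
    then show False using stable_density_mass[OF s0(1)] by simp
  qed
  then obtain z where z: "p s0 z > 0" ..
  define q where "q = p s0 z / 2"
  have q: "q > 0" using z by (simp add: q_def)
  define S where "S = ({0<..} \<times> UNIV) \<inter> (\<lambda>(t, x). p t x) -` {q<..}"
  have "open S"
    unfolding S_def by (rule continuous_open_preimage) (use p in \<open>auto simp: stable_density_def intro!: open_Times\<close>)
  moreover have "(s0, z) \<in> S" using s0 z by (simp add: S_def q_def)
  ultimately obtain A B where AB: "open A" "open B" "(s0, z) \<in> A \<times> B" "A \<times> B \<subseteq> S"
    by (rule open_prod_elim)
  obtain \<delta> where \<delta>: "\<delta> > 0" "ball s0 \<delta> \<subseteq> A" using AB open_contains_ball by blast
  obtain e where e: "e > 0" "ball z e \<subseteq> B" using AB open_contains_ball by blast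
  define m where "m = measure N {\<omega> \<in> space N. first_passage D 1 \<omega> \<in> ball s0 \<delta>}"
  have m: "m > 0" unfolding m_def by (rule s0(2)[OF \<delta>(1)])
  have "ennreal (q * m) \<le> kernel_G_nn 1 x" if x: "x \<in> ball z e" for x
  proof -
    have "ennreal (q * m) = (\<integral>\<^sup>+\<omega>. ennreal q * indicator {\<omega> \<in> space N. first_passage D 1 \<omega> \<in> ball s0 \<delta>} \<omega> \<partial>N)"
      using q by (subst nn_integral_cmult_indicator) (auto simp: m_def emeasure_eq_measure ennreal_mult)
    also have "\<dots> \<le> kernel_G_nn 1 x"
      unfolding kernel_G_nn_def
    proof (rule nn_integral_mono)
      fix \<omega> assume "\<omega> \<in> space N"
      show "ennreal q * indicator {\<omega> \<in> space N. first_passage D 1 \<omega> \<in> ball s0 \<delta>} \<omega>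
        \<le> stable_kernel_nn (first_passage D 1 \<omega>) x"
      proof (cases "first_passage D 1 \<omega> \<in> ball s0 \<delta>")
        case True
        then have "(first_passage D 1 \<omega>, x) \<in> S" using subsetD[OF \<delta>(2)] subsetD[OF e(2)] x by (intro subsetD[OF AB(4)]) auto
        then show ?thesis by (auto simp: S_def stable_kernel_nn_def indicator_def intro!: ennreal_leI)
      qed simp
    qed
    finally show ?thesis .
  qed
  then show ?thesis using e q m by (intro exI[of _ z] exI[of _ e] exI[of _ "q * m"]) auto
qed

lemma self_similar_kernel_G: "self_similar_kernel (kernel_G p fE) (\<beta> / \<alpha>)"
proof
  show "\<beta> / \<alpha> > 0" using \<alpha> \<beta> by simp
  show "0 \<le> kernel_G p fE t x" if "t > 0" for t x
    by (simp add: kernel_G_eq[OF that])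
  show "kernel_G p fE t x = t powr (- (\<beta> / \<alpha>) * DIM('a)) * kernel_G p fE 1 (t powr (- (\<beta> / \<alpha>)) *\<^sub>R x)"
    if "t > 0" for t x
    unfolding kernel_G_eq[OF that] kernel_G_eq[OF zero_less_one] kernel_G_nn_scaling[OF that, of x]
    by (simp add: enn2real_mult)
  have "(\<lambda>x. enn2real (kernel_G_nn 1 x)) \<in> borel_measurable borel"
    using kernel_G_nn_measurable[OF zero_less_one] by measurable
  then show "kernel_G p fE 1 \<in> borel_measurable borel"
    by (simp add: kernel_G_eq[OF zero_less_one, abs_def])
  have "(\<integral>\<^sup>+x. ennreal (kernel_G p fE 1 x) \<partial>lborel) = (\<integral>\<^sup>+x. kernel_G_nn 1 x \<partial>lborel)"
    by (rule nn_integral_cong_AE) (rule kernel_G_nn_AE_eq[OF zero_less_one])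
  then show "(\<integral>\<^sup>+x. ennreal (kernel_G p fE 1 x) \<partial>lborel) = 1"
    using kernel_G_nn_mass[OF zero_less_one] by simp
  obtain z e c where zec: "e > 0" "c > 0" "\<And>x. x\<in>ball z e \<Longrightarrow> ennreal c \<le> kernel_G_nn 1 x"
    using kernel_G_nn_lower by blast
  have "AE x in lborel. x \<in> ball z e \<longrightarrow> c \<le> kernel_G p fE 1 x"
    using kernel_G_nn_AE_eq[OF zero_less_one]
  proof eventually_elim
    case (elim x)
    show ?case
    proof
      assume "x \<in> ball z e"
      then have "ennreal c \<le> ennreal (kernel_G p fE 1 x)" using zec(3) elim by simp
      then show "c \<le> kernel_G p fE 1 x"
        by (subst (asm) ennreal_le_iff) (auto simp: kernel_G_eq)
    qed
  qed
  then show "\<exists>z e c. e > 0 \<and> c > 0 \<and> (AE x in lborel. x \<in> ball z e \<longrightarrow> c \<le> kernel_G p fE 1 x)"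
    using zec by blast
qed

end

section \<open>The mean of a random field solution\<close>

text \<open>The left side is the tangent at \<open>c\<close> of the convex function on the right. It
  follows from Young's inequality with the conjugate exponents \<open>1 + \<eta>\<close> and
  \<open>(1 + \<eta>) / \<eta>\<close>; the slope is nonnegative, which covers negative
  \<open>x\<close>.\<close>

lemma powr_tangent_le:
  fixes x c \<eta> :: real
  assumes "c \<ge> 0" "\<eta> > 0"
  shows "(1 + \<eta>) * c powr \<eta> * x - \<eta> * c powr (1 + \<eta>) \<le> \<bar>x\<bar> powr (1 + \<eta>)"
proof -
  have "\<bar>x\<bar> * c powr \<eta> \<le> \<bar>x\<bar> powr (1 + \<eta>) / (1 + \<eta>) + (c powr \<eta>) powr ((1 + \<eta>) / \<eta>) / ((1 + \<eta>) / \<eta>)"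
    by (rule Youngs_inequality) (use assms in \<open>auto simp: field_simps\<close>)
  also have "(c powr \<eta>) powr ((1 + \<eta>) / \<eta>) = c powr (1 + \<eta>)"
    using assms by (simp add: powr_powr)
  finally have "(1 + \<eta>) * (\<bar>x\<bar> * c powr \<eta>) \<le> (1 + \<eta>) * (\<bar>x\<bar> powr (1 + \<eta>) / (1 + \<eta>) + c powr (1 + \<eta>) / ((1 + \<eta>) / \<eta>))"
    by (rule mult_left_mono) (use assms in simp)
  also have "\<dots> = \<bar>x\<bar> powr (1 + \<eta>) + \<eta> * c powr (1 + \<eta>)"
  proof -
    have "1 + \<eta> \<noteq> 0" using assms by simp
    then show ?thesis by (simp add: distrib_left)
  qed
  finally have "(1 + \<eta>) * c powr \<eta> * \<bar>x\<bar> - \<eta> * c powr (1 + \<eta>) \<le> \<bar>x\<bar> powr (1 + \<eta>)"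
    by (simp add: mult_ac)
  moreover have "(1 + \<eta>) * c powr \<eta> * x \<le> (1 + \<eta>) * c powr \<eta> * \<bar>x\<bar>"
    using assms by (intro mult_left_mono) auto
  ultimately show ?thesis by linarith
qed

text \<open>Jensen's inequality by integrating the tangent at \<open>c\<close>; the moment on the
  right may be infinite.\<close>

lemma (in prob_space) powr_moment_lower:
  assumes X: "integrable M X" and "c \<ge> 0" "\<eta> > 0" and c: "c \<le> (LINT \<omega>|M. X \<omega>)"
  shows "ennreal (c powr (1 + \<eta>)) \<le> (\<integral>\<^sup>+\<omega>. ennreal (\<bar>X \<omega>\<bar> powr (1 + \<eta>)) \<partial>M)"
proof (cases "(\<integral>\<^sup>+\<omega>. ennreal (\<bar>X \<omega>\<bar> powr (1 + \<eta>)) \<partial>M) = \<infinity>")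
  case False
  have [measurable]: "X \<in> borel_measurable M" using X by auto
  have i: "integrable M (\<lambda>\<omega>. \<bar>X \<omega>\<bar> powr (1 + \<eta>))"
    by (rule integrableI_bounded) (use False in \<open>auto simp: less_top\<close>)
  let ?l = "\<lambda>\<omega>. (1 + \<eta>) * c powr \<eta> * X \<omega> - \<eta> * c powr (1 + \<eta>)"
  have il: "integrable M ?l" using X by auto
  have "c powr (1 + \<eta>) = (1 + \<eta>) * c powr \<eta> * c - \<eta> * c powr (1 + \<eta>)"
    using assms by (cases "c = 0") (simp_all add: powr_add algebra_simps)
  also have "\<dots> \<le> (1 + \<eta>) * c powr \<eta> * (LINT \<omega>|M. X \<omega>) - \<eta> * c powr (1 + \<eta>)"
    using assms by (intro diff_right_mono mult_left_mono) auto
  also have "\<dots> = (LINT \<omega>|M. ?l \<omega>)"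
    using X by (simp add: prob_space)
  also have "\<dots> \<le> (LINT \<omega>|M. \<bar>X \<omega>\<bar> powr (1 + \<eta>))"
    by (rule integral_mono[OF il i]) (rule powr_tangent_le[OF assms(2,3)])
  finally show ?thesis
    by (subst nn_integral_eq_integral[OF i]) (auto intro: ennreal_leI)
qed simp

section \<open>Kernel estimates and the expectation of the mild equation\<close>

context self_similar_kernel
begin

text \<open>For \<open>t > 0\<close>, \<open>scaling\<close> writes \<open>G\<close> as
  \<open>G 1\<close> composed with a measurable map of \<open>(t, x)\<close>, times a measurable
  factor.\<close>

lemma measurable_pair[measurable]:
  "(\<lambda>(t, x). indicator {0<..} t * G t x) \<in> borel_measurable (borel \<Otimes>\<^sub>M borel)"
proof -
  note [measurable] = measurable_1
  have "(\<lambda>(t, x). indicator {0<..} t * G t x)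
    = (\<lambda>z. indicator {0<..} (fst z) * (fst z powr (- \<gamma> * DIM('a)) * G 1 (fst z powr (- \<gamma>) *\<^sub>R snd z)))"
  proof (rule ext, clarify)
    fix t x
    show "indicator {0<..} t * G t x
      = indicator {0<..} (fst (t, x)) * (fst (t, x) powr (- \<gamma> * DIM('a)) * G 1 (fst (t, x) powr (- \<gamma>) *\<^sub>R snd (t, x)))"
      by (cases "t > 0") (simp_all add: scaling[of t x])
  qed
  also have "\<dots> \<in> borel_measurable (borel \<Otimes>\<^sub>M borel)" by measurable
  finally show ?thesis .
qed

lemma measurable_space:
  assumes "t > 0"
  shows "G t \<in> borel_measurable borel"
proof -
  have "(\<lambda>x. indicator {0<..} t * G t x) \<in> borel_measurable borel"
    using measurable_compose[OF _ measurable_pair, of "\<lambda>x. (t, x)" borel] by simp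
  then show ?thesis using assms by simp
qed

lemma nn_integral_scaling:
  assumes t: "t > 0" and [measurable]: "\<phi> \<in> borel_measurable borel"
  shows "(\<integral>\<^sup>+x. ennreal (G t x) * \<phi> (t powr (- \<gamma>) *\<^sub>R x) \<partial>lborel) = (\<integral>\<^sup>+x. ennreal (G 1 x) * \<phi> x \<partial>lborel)"
proof -
  note [measurable] = measurable_1
  have "(\<integral>\<^sup>+x. ennreal (G 1 x) * \<phi> x \<partial>lborel)
    = ennreal (\<bar>t powr (- \<gamma>)\<bar> ^ DIM('a)) * (\<integral>\<^sup>+x. ennreal (G 1 (0 + t powr (- \<gamma>) *\<^sub>R x)) * \<phi> (0 + t powr (- \<gamma>) *\<^sub>R x) \<partial>lborel)"
    using t by (subst nn_integral_lborel_affine[where c="t powr (- \<gamma>)" and t=0]) auto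
  also have "\<bar>t powr (- \<gamma>)\<bar> ^ DIM('a) = t powr (- \<gamma> * DIM('a))"
    using t by (simp add: powr_realpow[symmetric] powr_powr)
  also have "ennreal (t powr (- \<gamma> * DIM('a))) * (\<integral>\<^sup>+x. ennreal (G 1 (0 + t powr (- \<gamma>) *\<^sub>R x)) * \<phi> (0 + t powr (- \<gamma>) *\<^sub>R x) \<partial>lborel)
    = (\<integral>\<^sup>+x. ennreal (G t x) * \<phi> (t powr (- \<gamma>) *\<^sub>R x) \<partial>lborel)"
    by (subst nn_integral_cmult[symmetric])
      (auto intro!: nn_integral_cong simp: scaling[OF t] nonneg ennreal_mult mult.assoc)
  finally show ?thesis by simp
qed

lemma nn_integral_reflect:
  assumes t: "t > 0" and [measurable]: "\<phi> \<in> borel_measurable borel"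
  shows "(\<integral>\<^sup>+y. ennreal (G t (x - y)) * \<phi> (x - y) \<partial>lborel) = (\<integral>\<^sup>+z. ennreal (G t z) * \<phi> z \<partial>lborel)"
proof -
  note [measurable] = measurable_space[OF t]
  show ?thesis
    by (subst (2) nn_integral_lborel_affine[where c="-1" and t=x]) auto
qed

lemma mass:
  assumes t: "t > 0"
  shows "(\<integral>\<^sup>+y. ennreal (G t (x - y)) \<partial>lborel) = 1"
  using nn_integral_reflect[OF t, of "\<lambda>_. 1"] nn_integral_scaling[OF t, of "\<lambda>_. 1"] mass_1 by simp

text \<open>The masses of the balls \<open>cball 0 n\<close> under \<open>G 1\<close> tend to 1;
  \<open>scaling\<close> stretches a ball that carries half of the mass by
  \<open>t powr \<gamma>\<close>, so one \<open>A\<close> serves all times.\<close>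

lemma mass_concentration:
  "\<exists>A>0. \<forall>t x r. t > 0 \<longrightarrow> A * t powr \<gamma> \<le> r \<longrightarrow>
     ennreal (1 / 2) \<le> (\<integral>\<^sup>+y. ennreal (G t (x - y)) * indicator (cball 0 r) (x - y) \<partial>lborel)"
proof -
  note [measurable] = measurable_1
  define \<mu> where "\<mu> = density lborel (\<lambda>x. ennreal (G 1 x))"
  have "(\<lambda>n. emeasure \<mu> (cball 0 (real n))) \<longlonglongrightarrow> emeasure \<mu> (\<Union>n. cball 0 (real n))"
    by (rule Lim_emeasure_incseq) (auto simp: \<mu>_def incseq_def)
  moreover have "(\<Union>n. cball (0::'a) (real n)) = UNIV"
    using real_arch_simple by auto
  moreover have "emeasure \<mu> UNIV = 1"
    using mass_1 by (simp add: \<mu>_def emeasure_density)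
  ultimately have "(\<lambda>n. emeasure \<mu> (cball 0 (real n))) \<longlonglongrightarrow> 1" by simp
  then have "\<forall>\<^sub>F n in sequentially. ennreal (1 / 2) < emeasure \<mu> (cball 0 (real n))"
    by (rule order_tendstoD) (subst ennreal_1[symmetric], subst ennreal_less_iff, auto)
  then obtain n0 where n0: "\<And>n. n \<ge> n0 \<Longrightarrow> ennreal (1 / 2) < emeasure \<mu> (cball 0 (real n))"
    by (auto simp: eventually_sequentially)
  define A where "A = real (Suc n0)"
  have A: "ennreal (1 / 2) \<le> (\<integral>\<^sup>+z. ennreal (G 1 z) * indicator (cball 0 A) z \<partial>lborel)"
    using n0[of "Suc n0"] by (simp add: A_def \<mu>_def emeasure_density)
  show ?thesis
  proof (intro exI[of _ A] conjI allI impI)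
    show "A > 0" by (simp add: A_def)
    fix t r :: real and x :: 'a assume t: "t > 0" and r: "A * t powr \<gamma> \<le> r"
    have "(\<integral>\<^sup>+z. ennreal (G 1 z) * indicator (cball 0 A) z \<partial>lborel)
      = (\<integral>\<^sup>+z. ennreal (G t z) * indicator (cball 0 A) (t powr (- \<gamma>) *\<^sub>R z) \<partial>lborel)"
      by (rule nn_integral_scaling[OF t, symmetric], intro borel_measurable_indicator borel_closed) simp
    also have "\<dots> \<le> (\<integral>\<^sup>+z. ennreal (G t z) * indicator (cball 0 r) z \<partial>lborel)"
    proof (rule nn_integral_mono, rule mult_left_mono)
      fix z :: 'a
      have "z \<in> cball 0 r" if "t powr (- \<gamma>) *\<^sub>R z \<in> cball 0 A"
      proof -
        have "norm z = t powr \<gamma> * (t powr (- \<gamma>) * norm z)"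
          using t by (simp add: powr_minus)
        also have "\<dots> \<le> t powr \<gamma> * A"
          using that by (intro mult_left_mono) auto
        finally show ?thesis using r by (simp add: mult.commute)
      qed
      then show "indicator (cball 0 A) (t powr (- \<gamma>) *\<^sub>R z) \<le> (indicator (cball 0 r) z :: ennreal)"
        by (auto simp: indicator_def)
    qed simp
    also have "\<dots> = (\<integral>\<^sup>+y. ennreal (G t (x - y)) * indicator (cball 0 r) (x - y) \<partial>lborel)"
      by (rule nn_integral_reflect[OF t, symmetric], intro borel_measurable_indicator borel_closed) simp
    finally show "ennreal (1 / 2) \<le> (\<integral>\<^sup>+y. ennreal (G t (x - y)) * indicator (cball 0 r) (x - y) \<partial>lborel)"
      using A by (rule order_trans[rotated])
  qed
qed

text \<open>In the expected mild equation the Walsh term drops out, and the initial term and the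
  drift are both nonnegative, so each alone bounds the mean from below. For the drift, Tonelli
  brings the expectation inside and Jensen is applied at each fixed \<open>(s, y)\<close>.\<close>

lemma random_field_mean:
  assumes noise: "gaussian_noise M C F"
    and b_cont: "continuous_on UNIV b" and b_ge: "\<And>x. \<bar>x\<bar> powr (1 + \<eta>) \<le> b x" and \<eta>: "\<eta> > 0"
    and u0_meas: "u0 \<in> borel_measurable borel" and u0_nn: "\<And>x. 0 \<le> u0 x" and u0_bd: "bounded (range u0)"
    and sol: "random_field_solution M C F G b \<sigma> u0 T u" and t: "0 < t" "t \<le> T"
  shows "(\<integral>\<^sup>+y. ennreal (G t (x - y) * u0 y) \<partial>lborel) \<le> ennreal (LINT \<omega>|M. u t x \<omega>)"
    and "0 \<le> a \<Longrightarrow> a < t \<Longrightarrow> 0 \<le> c \<Longrightarrow>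
      (\<And>s y. a < s \<Longrightarrow> s < t \<Longrightarrow> norm (x - y) \<le> r \<Longrightarrow> c \<le> (LINT \<omega>|M. u s y \<omega>)) \<Longrightarrow>
      (\<integral>\<^sup>+s. indicator {a<..<t} s * (\<integral>\<^sup>+y. ennreal (c powr (1 + \<eta>)) * (ennreal (G (t - s) (x - y)) * indicator (cball 0 r) (x - y)) \<partial>lborel) \<partial>lborel)
      \<le> ennreal (LINT \<omega>|M. u t x \<omega>)"
proof -
  interpret M: prob_space M using noise by (simp add: gaussian_noise_def)
  have T: "T > 0" using t by simp
  have mild: "mild_solution M C F G b \<sigma> u0 T u"
    and mom: "(SUP x. SUP t\<in>{0..T}. \<integral>\<^sup>+\<omega>. ennreal (\<bar>u t x \<omega>\<bar> powr 2) \<partial>M) < \<infinity>"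
    using sol unfolding random_field_solution_def by auto
  note [measurable] = u0_meas borel_measurable_continuous_onI[OF b_cont] measurable_space
  have u_joint: "(\<lambda>(\<omega>, t, x). u t x \<omega>) \<in> borel_measurable (M \<Otimes>\<^sub>M restrict_space borel {0..T} \<Otimes>\<^sub>M borel)"
    and u_adapt: "\<And>s y. s \<in> {0..T} \<Longrightarrow> u s y \<in> borel_measurable (noise_filtration M F s)"
    and walsh: "\<exists>I. has_walsh_integral M C F t (\<lambda>s y \<omega>. G (t - s) (x - y) * \<sigma> (u s y \<omega>)) I \<and>
        (AE \<omega> in M.
           set_integrable (lborel \<Otimes>\<^sub>M lborel) ({0<..<t} \<times> UNIV) (\<lambda>(s, y). b (u s y \<omega>) * G (t - s) (x - y)) \<and>
           u t x \<omega> = (LINT y|lborel. G t (x - y) * u0 y)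
             + (LINT (s, y):{0<..<t} \<times> UNIV|(lborel \<Otimes>\<^sub>M lborel). b (u s y \<omega>) * G (t - s) (x - y)) + I \<omega>)"
    using mild t unfolding mild_solution_def by auto
  have u_meas: "u s y \<in> borel_measurable M" if "s \<in> {0..T}" for s y
    by (rule noise_filtration_measurable[OF noise u_adapt[OF that]])
  have u_int: "integrable M (u s y)" if s: "s \<in> {0..T}" for s y
  proof (rule M.square_integrable_imp_integrable[OF u_meas[OF s]])
    have "(\<integral>\<^sup>+\<omega>. ennreal (\<bar>u s y \<omega>\<bar> powr 2) \<partial>M) \<le> (SUP x. SUP t\<in>{0..T}. \<integral>\<^sup>+\<omega>. ennreal (\<bar>u t x \<omega>\<bar> powr 2) \<partial>M)"
      by (intro SUP_upper2[of y] SUP_upper2[of s]) (use s in auto)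
    also note mom
    finally have "(\<integral>\<^sup>+\<omega>. ennreal ((u s y \<omega>)\<^sup>2) \<partial>M) < \<infinity>"
      by simp
    then show "integrable M (\<lambda>\<omega>. (u s y \<omega>)\<^sup>2)"
      using u_meas[OF s] by (intro integrableI_bounded) auto
  qed
  obtain I where I: "has_walsh_integral M C F t (\<lambda>s y \<omega>. G (t - s) (x - y) * \<sigma> (u s y \<omega>)) I"
    and eq: "AE \<omega> in M.
           set_integrable (lborel \<Otimes>\<^sub>M lborel) ({0<..<t} \<times> UNIV) (\<lambda>(s, y). b (u s y \<omega>) * G (t - s) (x - y)) \<and>
           u t x \<omega> = (LINT y|lborel. G t (x - y) * u0 y)
             + (LINT (s, y):{0<..<t} \<times> UNIV|(lborel \<Otimes>\<^sub>M lborel). b (u s y \<omega>) * G (t - s) (x - y)) + I \<omega>"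
    using walsh by blast
  note I_int = walsh_integral_mean_0[OF noise I]
  have b_nn: "0 \<le> b z" for z using b_ge[of z] by (rule order_trans[rotated]) simp
  define K where "K = (LINT y|lborel. G t (x - y) * u0 y)"
  \<comment> \<open>The drift is treated as a variable with values in
    \<open>[0, \<infinity>]\<close>. By the mild equation it equals \<open>u t x - K - I\<close>
    almost surely, which is integrable, so its expectation is finite and known.\<close>
  define Bn where "Bn \<omega> = (\<integral>\<^sup>+(s, y). ennreal (indicator {0<..<t} s * (b (u s y \<omega>) * G (t - s) (x - y))) \<partial>(lborel \<Otimes>\<^sub>M lborel))" for \<omega>
  have B_eq: "AE \<omega> in M. 0 \<le> u t x \<omega> - K - I \<omega> \<and> ennreal (u t x \<omega> - K - I \<omega>) = Bn \<omega>"
    using eq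
  proof eventually_elim
    case (elim \<omega>)
    let ?f = "\<lambda>z. indicator {0<..<t} (fst z) * (b (u (fst z) (snd z) \<omega>) * G (t - fst z) (x - snd z))"
    have f: "(\<lambda>z. indicator ({0<..<t} \<times> UNIV) z *\<^sub>R (case z of (s, y) \<Rightarrow> b (u s y \<omega>) * G (t - s) (x - y))) = ?f"
      by (auto simp: fun_eq_iff indicator_def)
    have fi: "integrable (lborel \<Otimes>\<^sub>M lborel) ?f"
      using elim unfolding set_integrable_def f by simp
    have fn: "0 \<le> ?f z" for z by (auto simp: indicator_def intro!: mult_nonneg_nonneg b_nn nonneg)
    have "u t x \<omega> - K - I \<omega> = (LINT z|(lborel \<Otimes>\<^sub>M lborel). ?f z)"
      using elim unfolding set_lebesgue_integral_def f K_def by simp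
    moreover have "Bn \<omega> = ennreal (LINT z|(lborel \<Otimes>\<^sub>M lborel). ?f z)"
      unfolding Bn_def case_prod_unfold by (rule nn_integral_eq_integral[OF fi]) (use fn in auto)
    moreover have "0 \<le> (LINT z|(lborel \<Otimes>\<^sub>M lborel). ?f z)"
      by (rule integral_nonneg_AE) (use fn in auto)
    ultimately show ?case by simp
  qed
  have tT: "t \<in> {0..T}" using t by simp
  have Bi: "integrable M (\<lambda>\<omega>. u t x \<omega> - K - I \<omega>)"
    using u_int[OF tT] I_int by auto
  have BE: "(LINT \<omega>|M. u t x \<omega> - K - I \<omega>) = (LINT \<omega>|M. u t x \<omega>) - K"
    using u_int[OF tT] I_int by (simp add: M.prob_space)
  have B0: "0 \<le> (LINT \<omega>|M. u t x \<omega>) - K"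
    unfolding BE[symmetric] by (rule integral_nonneg_AE) (use B_eq in \<open>eventually_elim, simp\<close>)
  have Bnn: "(\<integral>\<^sup>+\<omega>. Bn \<omega> \<partial>M) = ennreal ((LINT \<omega>|M. u t x \<omega>) - K)"
  proof -
    have "(\<integral>\<^sup>+\<omega>. Bn \<omega> \<partial>M) = (\<integral>\<^sup>+\<omega>. ennreal (u t x \<omega> - K - I \<omega>) \<partial>M)"
      by (rule nn_integral_cong_AE) (use B_eq in \<open>eventually_elim, simp\<close>)
    also have "\<dots> = ennreal (LINT \<omega>|M. u t x \<omega> - K - I \<omega>)"
      by (rule nn_integral_eq_integral[OF Bi]) (use B_eq in \<open>eventually_elim, simp\<close>)
    finally show ?thesis by (simp only: BE)
  qed
  obtain L where L: "\<And>y. u0 y \<le> L" "L \<ge> 0"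
  proof -
    obtain L where "\<forall>z\<in>range u0. norm z \<le> L" using u0_bd by (auto simp: bounded_iff)
    then have "\<bar>u0 y\<bar> \<le> L" for y by auto
    then show ?thesis using that[of L] u0_nn by (metis abs_of_nonneg order_trans)
  qed
  have Gx: "(\<lambda>y. G t (x - y)) \<in> borel_measurable borel"
    using measurable_compose[OF _ measurable_space[OF t(1)], of "\<lambda>y. x - y" borel] by simp
  have Ki: "integrable lborel (\<lambda>y. G t (x - y) * u0 y)"
  proof (rule integrableI_bounded)
    show "(\<lambda>y. G t (x - y) * u0 y) \<in> borel_measurable lborel" using Gx by measurable
    have "(\<integral>\<^sup>+y. ennreal (norm (G t (x - y) * u0 y)) \<partial>lborel) \<le> (\<integral>\<^sup>+y. ennreal L * ennreal (G t (x - y)) \<partial>lborel)"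
      using L u0_nn nonneg[OF t(1)]
      by (intro nn_integral_mono) (auto simp: abs_mult ennreal_mult[symmetric] mult.commute intro!: ennreal_leI mult_right_mono)
    also have "\<dots> = ennreal L" using Gx by (simp add: nn_integral_cmult mass[OF t(1)])
    finally show "(\<integral>\<^sup>+y. ennreal (norm (G t (x - y) * u0 y)) \<partial>lborel) < \<infinity>"
      by (simp add: le_less_trans)
  qed
  have Knn: "(\<integral>\<^sup>+y. ennreal (G t (x - y) * u0 y) \<partial>lborel) = ennreal K"
    unfolding K_def by (rule nn_integral_eq_integral[OF Ki]) (use nonneg[OF t(1)] u0_nn in auto)
  then show "(\<integral>\<^sup>+y. ennreal (G t (x - y) * u0 y) \<partial>lborel) \<le> ennreal (LINT \<omega>|M. u t x \<omega>)"
    using B0 by (simp add: ennreal_leI)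
  have K0: "0 \<le> K" unfolding K_def by (rule integral_nonneg_AE) (use nonneg[OF t(1)] u0_nn in auto)

  assume a: "0 \<le> a" "a < t" "0 \<le> c"
    and low: "\<And>s y. a < s \<Longrightarrow> s < t \<Longrightarrow> norm (x - y) \<le> r \<Longrightarrow> c \<le> (LINT \<omega>|M. u s y \<omega>)"
  \<comment> \<open>\<open>u\<close> is jointly measurable for times in \<open>{0..T}\<close> only;
    clamping the time by \<open>\<rho>\<close> gives a function on the whole line that is unchanged
    on \<open>{0<..<t}\<close>. The indicators of \<open>t - s > 0\<close> in \<open>?k\<close> and
    \<open>?m\<close> serve the same purpose for \<open>G\<close>.\<close>
  define \<rho> where "\<rho> s = max 0 (min T s)" for s
  have \<rho>_meas: "\<rho> \<in> borel \<rightarrow>\<^sub>M restrict_space borel {0..T}"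
  proof (rule measurable_restrict_space2)
    show "\<rho> \<in> borel_measurable borel" unfolding \<rho>_def by measurable
  qed (use T in \<open>auto simp: \<rho>_def\<close>)
  have \<rho>_id: "\<rho> s = s" if "0 < s" "s < t" for s using that t by (simp add: \<rho>_def)
  let ?k = "\<lambda>\<omega> z. ennreal (indicator {0<..<t} (fst z) * (b (u (\<rho> (fst z)) (snd z) \<omega>) * (indicator {0<..} (t - fst z) * G (t - fst z) (x - snd z))))"
  have k_meas: "case_prod ?k \<in> borel_measurable (M \<Otimes>\<^sub>M (lborel \<Otimes>\<^sub>M lborel))"
  proof -
    have "(\<lambda>w. (fst w, \<rho> (fst (snd w)), snd (snd w))) \<in> M \<Otimes>\<^sub>M (lborel \<Otimes>\<^sub>M lborel) \<rightarrow>\<^sub>M M \<Otimes>\<^sub>M restrict_space borel {0..T} \<Otimes>\<^sub>M borel"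
      using \<rho>_meas by measurable
    from measurable_compose[OF this u_joint]
    have [measurable]: "(\<lambda>w. u (\<rho> (fst (snd w))) (snd (snd w)) (fst w)) \<in> borel_measurable (M \<Otimes>\<^sub>M (lborel \<Otimes>\<^sub>M lborel))"
      by simp
    have "(\<lambda>w. (t - fst (snd w), x - snd (snd w))) \<in> M \<Otimes>\<^sub>M (lborel \<Otimes>\<^sub>M lborel) \<rightarrow>\<^sub>M borel \<Otimes>\<^sub>M borel"
      by measurable
    from measurable_compose[OF this measurable_pair]
    have [measurable]: "(\<lambda>w. indicator {0<..} (t - fst (snd w)) * G (t - fst (snd w)) (x - snd (snd w))) \<in> borel_measurable (M \<Otimes>\<^sub>M (lborel \<Otimes>\<^sub>M lborel))"
      by simp
    show ?thesis unfolding case_prod_unfold by measurable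
  qed
  define \<phi> :: "'a \<Rightarrow> ennreal" where "\<phi> = indicator (cball 0 r)"
  have [measurable]: "\<phi> \<in> borel_measurable borel"
    unfolding \<phi>_def by (intro borel_measurable_indicator borel_closed) simp
  let ?m = "\<lambda>z. indicator {a<..<t} (fst z) * (ennreal (c powr (1 + \<eta>)) * (ennreal (indicator {0<..} (t - fst z) * G (t - fst z) (x - snd z)) * \<phi> (x - snd z)))"
  have m_meas: "?m \<in> borel_measurable (lborel \<Otimes>\<^sub>M lborel)"
  proof -
    have "(\<lambda>w. (t - fst w, x - snd w)) \<in> lborel \<Otimes>\<^sub>M lborel \<rightarrow>\<^sub>M borel \<Otimes>\<^sub>M borel"
      by measurable
    from measurable_compose[OF this measurable_pair]
    have [measurable]: "(\<lambda>w. indicator {0<..} (t - fst w) * G (t - fst w) (x - snd w)) \<in> borel_measurable (lborel \<Otimes>\<^sub>M lborel)"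
      by simp
    show ?thesis by measurable
  qed
  have Bnk: "Bn \<omega> = (\<integral>\<^sup>+z. ?k \<omega> z \<partial>(lborel \<Otimes>\<^sub>M lborel))" for \<omega>
    unfolding Bn_def case_prod_unfold
    by (rule nn_integral_cong) (auto simp: indicator_def \<rho>_id)
  interpret MP: pair_sigma_finite M "lborel \<Otimes>\<^sub>M lborel :: (real \<times> 'a) measure"
    unfolding pair_sigma_finite_def
    using M.sigma_finite_measure_axioms lborel_pair.sigma_finite_measure_axioms by blast
  have "(\<integral>\<^sup>+s. indicator {a<..<t} s * (\<integral>\<^sup>+y. ennreal (c powr (1 + \<eta>)) * (ennreal (G (t - s) (x - y)) * indicator (cball 0 r) (x - y)) \<partial>lborel) \<partial>lborel)
    = (\<integral>\<^sup>+s. (\<integral>\<^sup>+y. ?m (s, y) \<partial>lborel) \<partial>lborel)"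
    by (rule nn_integral_cong) (auto simp: indicator_def \<phi>_def)
  also have "\<dots> = (\<integral>\<^sup>+z. ?m z \<partial>(lborel \<Otimes>\<^sub>M lborel))"
    by (rule lborel.nn_integral_fst[OF m_meas])
  also have "\<dots> \<le> (\<integral>\<^sup>+z. (\<integral>\<^sup>+\<omega>. ?k \<omega> z \<partial>M) \<partial>(lborel \<Otimes>\<^sub>M lborel))"
  proof (rule nn_integral_mono)
    fix z :: "real \<times> 'a"
    obtain s y where z: "z = (s, y)" by (cases z)
    show "?m z \<le> (\<integral>\<^sup>+\<omega>. ?k \<omega> z \<partial>M)"
    proof (cases "a < s \<and> s < t \<and> norm (x - y) \<le> r")
      case True
      then have s: "0 < s" "s < t" "s \<in> {0..T}" using a t by auto
      have g: "0 \<le> G (t - s) (x - y)" using s by (intro nonneg) auto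
      note [measurable] = u_meas[OF s(3)]
      have "ennreal (c powr (1 + \<eta>)) \<le> (\<integral>\<^sup>+\<omega>. ennreal (\<bar>u s y \<omega>\<bar> powr (1 + \<eta>)) \<partial>M)"
        using True by (intro M.powr_moment_lower u_int s a \<eta> low) auto
      also have "\<dots> \<le> (\<integral>\<^sup>+\<omega>. ennreal (b (u s y \<omega>)) \<partial>M)"
        by (intro nn_integral_mono ennreal_leI b_ge)
      finally have "ennreal (c powr (1 + \<eta>)) * ennreal (G (t - s) (x - y))
        \<le> (\<integral>\<^sup>+\<omega>. ennreal (b (u s y \<omega>)) \<partial>M) * ennreal (G (t - s) (x - y))"
        by (rule mult_right_mono) simp
      also have "\<dots> = (\<integral>\<^sup>+\<omega>. ennreal (b (u s y \<omega>)) * ennreal (G (t - s) (x - y)) \<partial>M)"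
        by (rule nn_integral_multc[symmetric]) simp
      also have "\<dots> = (\<integral>\<^sup>+\<omega>. ?k \<omega> z \<partial>M)"
        using s g by (intro nn_integral_cong) (simp add: z \<rho>_id ennreal_mult[symmetric] b_nn)
      finally show ?thesis using True s by (simp add: z \<phi>_def)
    next
      case False
      then have "?m z = 0" by (auto simp: z indicator_def \<phi>_def)
      then show ?thesis by (simp only: zero_le)
    qed
  qed
  also have "\<dots> = (\<integral>\<^sup>+\<omega>. (\<integral>\<^sup>+z. ?k \<omega> z \<partial>(lborel \<Otimes>\<^sub>M lborel)) \<partial>M)"
    by (rule MP.Fubini'[OF k_meas])
  also have "\<dots> = ennreal ((LINT \<omega>|M. u t x \<omega>) - K)"
    by (simp only: Bnk[symmetric] Bnn)
  also have "\<dots> \<le> ennreal (LINT \<omega>|M. u t x \<omega>)" using K0 by (intro ennreal_leI) simp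
  finally show "(\<integral>\<^sup>+s. indicator {a<..<t} s * (\<integral>\<^sup>+y. ennreal (c powr (1 + \<eta>)) * (ennreal (G (t - s) (x - y)) * indicator (cball 0 r) (x - y)) \<partial>lborel) \<partial>lborel)
      \<le> ennreal (LINT \<omega>|M. u t x \<omega>)" .
qed

end

section \<open>Blow-up of the mean\<close>

lemma sum_geometric_le:
  fixes q :: real
  assumes "0 \<le> q" "q < 1" "0 \<le> K"
  shows "(\<Sum>i<n. K * q ^ i) \<le> K / (1 - q)"
proof -
  have "(\<Sum>i<n. K * q ^ i) = K * ((1 - q ^ n) / (1 - q))"
    using assms by (simp add: sum_distrib_left[symmetric] sum_gp_strict)
  also have "\<dots> \<le> K * (1 / (1 - q))"
    using assms by (intro mult_left_mono divide_right_mono) auto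
  finally show ?thesis by simp
qed

text \<open>
  Each step doubles the lower bound \<open>c\<close> at the cost of a time \<open>4 c powr - \<eta>\<close> and of a loss of
  radius of the order of that time to the power \<open>\<gamma>\<close>; both costs are summable along \<open>2 ^ n * c\<close>.
\<close>

lemma blow_up:
  fixes v :: "real \<Rightarrow> 'a::real_normed_vector \<Rightarrow> real"
  assumes step: "\<And>t x a c r. 0 \<le> a \<Longrightarrow> a < t \<Longrightarrow> 0 < c \<Longrightarrow> A * (t - a) powr \<gamma> \<le> r \<Longrightarrow>
      (\<And>s y. a < s \<Longrightarrow> s < t \<Longrightarrow> norm (x - y) \<le> r \<Longrightarrow> c \<le> v s y) \<Longrightarrow>
      (t - a) / 2 * c powr (1 + \<eta>) \<le> v t x"
    and pos: "\<eta> > 0" "\<gamma> > 0" "A > 0" "c0 > 0" "T0 \<ge> 0"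
    and base: "\<And>t x. T0 < t \<Longrightarrow> t \<le> T0 + W \<Longrightarrow> norm (x - x0) \<le> \<rho> \<Longrightarrow> c0 \<le> v t x"
    and W: "4 * c0 powr - \<eta> / (1 - 2 powr - \<eta>) < W"
    and \<rho>: "A * (4 * c0 powr - \<eta>) powr \<gamma> / (1 - (2 powr - \<eta>) powr \<gamma>) \<le> \<rho>"
  shows False
proof -
  define q where "q = (2::real) powr - \<eta>"
  define c where "c n = c0 * 2 ^ n" for n
  \<comment> \<open>The doubling time:
    \<open>h n / 2 * c n powr (1 + \<eta>) = 2 * c n = c (Suc n)\<close>.\<close>
  define h where "h n = 4 * c n powr - \<eta>" for n
  \<comment> \<open>\<open>\<tau> n\<close> is the time after which, and \<open>R n\<close> the
    radius within which, the bound \<open>c n\<close> is established.\<close>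
  define \<tau> where "\<tau> n = T0 + (\<Sum>i<n. h i)" for n
  define R where "R n = \<rho> - (\<Sum>i<n. A * h i powr \<gamma>)" for n
  have q: "0 < q" "q < 1" using pos by (auto simp: q_def intro: powr_less_one)
  have qg: "0 < q powr \<gamma>" "q powr \<gamma> < 1" using q pos powr_less_mono2[of \<gamma> q 1] by auto
  have c_pos: "c n > 0" for n using pos by (simp add: c_def)
  have h_pos: "h n > 0" for n using c_pos[of n] by (simp add: h_def)
  have "(2 ^ n :: real) powr - \<eta> = q ^ n" for n
    by (simp add: q_def powr_realpow[symmetric] powr_powr mult.commute)
  then have h_eq: "h n = 4 * c0 powr - \<eta> * q ^ n" for n
    using pos by (simp add: h_def c_def powr_mult)
  have hg_eq: "A * h n powr \<gamma> = A * (4 * c0 powr - \<eta>) powr \<gamma> * (q powr \<gamma>) ^ n" for n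
    unfolding h_eq using q pos by (simp add: powr_mult powr_realpow[symmetric] powr_powr mult.commute)
  have \<tau>_less: "\<tau> n < T0 + W" for n
    using sum_geometric_le[of q "4 * c0 powr - \<eta>" n] q W by (simp add: \<tau>_def h_eq q_def[symmetric])
  have \<tau>_ge: "\<tau> n \<ge> 0" for n
  proof -
    have "0 \<le> (\<Sum>i<n. h i)" by (rule sum_nonneg) (rule less_imp_le[OF h_pos])
    then show ?thesis using pos by (simp add: \<tau>_def)
  qed
  have R_ge: "R n \<ge> 0" for n
    using sum_geometric_le[of "q powr \<gamma>" "A * (4 * c0 powr - \<eta>) powr \<gamma>" n] qg \<rho> pos
    by (simp add: R_def hg_eq q_def[symmetric])
  have bound: "c n \<le> v t x" if "\<tau> n < t" "t \<le> T0 + W" "norm (x - x0) \<le> R n" for n t x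
    using that
  proof (induction n arbitrary: t x)
    case 0
    then show ?case using base by (simp add: \<tau>_def R_def c_def)
  next
    case (Suc n)
    \<comment> \<open>The window of length \<open>h n\<close> before \<open>t\<close> starts after
      \<open>\<tau> n\<close>, and points within \<open>A * h n powr \<gamma>\<close> of
      \<open>x\<close> stay in the larger ball of radius \<open>R n\<close>; there the induction
      hypothesis holds.\<close>
    define a where "a = t - h n"
    have a: "\<tau> n < a" "a < t" using Suc.prems h_pos[of n] by (auto simp: a_def \<tau>_def)
    have "(t - a) / 2 * c n powr (1 + \<eta>) \<le> v t x"
    proof (rule step[where r="A * h n powr \<gamma>"])
      show "0 \<le> a" using a \<tau>_ge[of n] by simp
      show "A * (t - a) powr \<gamma> \<le> A * h n powr \<gamma>" by (simp add: a_def)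
      fix s y assume s: "a < s" "s < t" and y: "norm (x - y) \<le> A * h n powr \<gamma>"
      have "norm (y - x0) \<le> norm (x - x0) + norm (x - y)"
        using norm_triangle_ineq4[of "x - x0" "x - y"] by simp
      also have "\<dots> \<le> R n" using y Suc.prems by (simp add: R_def)
      finally show "c n \<le> v s y" using s a Suc.prems by (intro Suc.IH) auto
    qed (use a c_pos[of n] in auto)
    also have "(t - a) / 2 * c n powr (1 + \<eta>) = c (Suc n)"
    proof -
      have "c n powr - \<eta> * c n powr (1 + \<eta>) = c n"
        using c_pos[of n] by (simp add: powr_add[symmetric])
      then show ?thesis by (simp add: a_def h_def c_def)
    qed
    finally show ?case .
  qed
  \<comment> \<open>The point \<open>(T0 + W, x0)\<close> belongs to the region of every
    \<open>n\<close>, yet the real number \<open>v (T0 + W) x0\<close> cannot dominate all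
    \<open>c n\<close>.\<close>
  obtain n :: nat where "v (T0 + W) x0 / c0 < real n" using reals_Archimedean2 by blast
  also have "real n < 2 ^ n" by (rule of_nat_less_two_power)
  finally have "v (T0 + W) x0 < c n" using pos by (simp add: c_def field_simps)
  moreover have "c n \<le> v (T0 + W) x0" by (rule bound) (use \<tau>_less R_ge in auto)
  ultimately show False by simp
qed

section \<open>The two blow-up regimes\<close>

context self_similar_kernel
begin

context
  fixes M :: "'w measure" and C :: "'a correlation" and F :: "(real \<times> 'a) set \<Rightarrow> 'w \<Rightarrow> real"
    and b \<sigma> :: "real \<Rightarrow> real" and u0 :: "'a \<Rightarrow> real" and u :: "real \<Rightarrow> 'a \<Rightarrow> 'w \<Rightarrow> real" and \<eta> :: real
  assumes noise: "gaussian_noise M C F"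
    and b_cont: "continuous_on UNIV b" and b_ge: "\<And>x. \<bar>x\<bar> powr (1 + \<eta>) \<le> b x" and \<eta>: "\<eta> > 0"
    and u0_meas: "u0 \<in> borel_measurable borel" and u0_nn: "\<And>x. 0 \<le> u0 x" and u0_bd: "bounded (range u0)"
    and sol: "global_random_field_solution M C F G b \<sigma> u0 u"
begin

lemma global_random_field_mean:
  assumes "t > 0"
  shows "(\<integral>\<^sup>+y. ennreal (G t (x - y) * u0 y) \<partial>lborel) \<le> ennreal (LINT \<omega>|M. u t x \<omega>)"
    and "0 \<le> a \<Longrightarrow> a < t \<Longrightarrow> 0 \<le> c \<Longrightarrow>
      (\<And>s y. a < s \<Longrightarrow> s < t \<Longrightarrow> norm (x - y) \<le> r \<Longrightarrow> c \<le> (LINT \<omega>|M. u s y \<omega>)) \<Longrightarrow>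
      (\<integral>\<^sup>+s. indicator {a<..<t} s * (\<integral>\<^sup>+y. ennreal (c powr (1 + \<eta>)) * (ennreal (G (t - s) (x - y)) * indicator (cball 0 r) (x - y)) \<partial>lborel) \<partial>lborel)
      \<le> ennreal (LINT \<omega>|M. u t x \<omega>)"
proof -
  have "random_field_solution M C F G b \<sigma> u0 t u"
    using sol assms by (simp add: global_random_field_solution_def)
  note rfm = random_field_mean[OF noise b_cont b_ge \<eta> u0_meas u0_nn u0_bd this assms order_refl]
  show "(\<integral>\<^sup>+y. ennreal (G t (x - y) * u0 y) \<partial>lborel) \<le> ennreal (LINT \<omega>|M. u t x \<omega>)" by (rule rfm(1))
  show "0 \<le> a \<Longrightarrow> a < t \<Longrightarrow> 0 \<le> c \<Longrightarrow>
      (\<And>s y. a < s \<Longrightarrow> s < t \<Longrightarrow> norm (x - y) \<le> r \<Longrightarrow> c \<le> (LINT \<omega>|M. u s y \<omega>)) \<Longrightarrow>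
      (\<integral>\<^sup>+s. indicator {a<..<t} s * (\<integral>\<^sup>+y. ennreal (c powr (1 + \<eta>)) * (ennreal (G (t - s) (x - y)) * indicator (cball 0 r) (x - y)) \<partial>lborel) \<partial>lborel)
      \<le> ennreal (LINT \<omega>|M. u t x \<omega>)" by (rule rfm(2))
qed

text \<open>An instance of \<open>blow_up\<close> for the mean of \<open>u\<close>: half of the
  kernel mass over a time \<open>t - a\<close> produces the factor \<open>(t - a) / 2\<close> in its
  step hypothesis. The constant \<open>A\<close> comes first, since the case of integrable mass
  chooses the cylinder after it.\<close>

lemma mean_blow_up:
  "\<exists>A>0. \<forall>c0 T0 W x0 \<rho>. c0 > 0 \<longrightarrow> T0 \<ge> 0 \<longrightarrow>
    (\<forall>t x. T0 < t \<longrightarrow> t \<le> T0 + W \<longrightarrow> norm (x - x0) \<le> \<rho> \<longrightarrow> c0 \<le> (LINT \<omega>|M. u t x \<omega>)) \<longrightarrow>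
    4 * c0 powr - \<eta> / (1 - 2 powr - \<eta>) < W \<longrightarrow>
    A * (4 * c0 powr - \<eta>) powr \<gamma> / (1 - (2 powr - \<eta>) powr \<gamma>) \<le> \<rho> \<longrightarrow> False"
proof -
  obtain A where A: "A > 0" "\<And>t x r. t > 0 \<Longrightarrow> A * t powr \<gamma> \<le> r \<Longrightarrow>
     ennreal (1 / 2) \<le> (\<integral>\<^sup>+y. ennreal (G t (x - y)) * indicator (cball 0 r) (x - y) \<partial>lborel)"
    using mass_concentration by blast
  have step: "(t - a) / 2 * c powr (1 + \<eta>) \<le> (LINT \<omega>|M. u t x \<omega>)"
    if a: "0 \<le> a" "a < t" and c': "0 < c" and r: "A * (t - a) powr \<gamma> \<le> r"
      and low: "\<And>s y. a < s \<Longrightarrow> s < t \<Longrightarrow> norm (x - y) \<le> r \<Longrightarrow> c \<le> (LINT \<omega>|M. u s y \<omega>)"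
    for t x a c r
  proof -
    have t: "t > 0" and c: "0 \<le> c" using a c' by auto
    have "ennreal ((t - a) / 2 * c powr (1 + \<eta>)) = (\<integral>\<^sup>+s. ennreal (c powr (1 + \<eta>) / 2) * indicator {a<..<t} s \<partial>lborel)"
      using a c by (subst nn_integral_cmult_indicator) (simp_all add: ennreal_mult[symmetric] mult.commute)
    also have "\<dots> \<le> (\<integral>\<^sup>+s. indicator {a<..<t} s * (\<integral>\<^sup>+y. ennreal (c powr (1 + \<eta>)) * (ennreal (G (t - s) (x - y)) * indicator (cball 0 r) (x - y)) \<partial>lborel) \<partial>lborel)"
    proof (rule nn_integral_mono)
      fix s
      show "ennreal (c powr (1 + \<eta>) / 2) * indicator {a<..<t} s \<le> indicator {a<..<t} s *
        (\<integral>\<^sup>+y. ennreal (c powr (1 + \<eta>)) * (ennreal (G (t - s) (x - y)) * indicator (cball 0 r) (x - y)) \<partial>lborel)"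
      proof (cases "a < s \<and> s < t")
        case True
        then have ts: "t - s > 0" by simp
        \<comment> \<open>The remaining time \<open>t - s\<close> is shorter than
          \<open>t - a\<close>, so one radius serves the whole window.\<close>
        have "A * (t - s) powr \<gamma> \<le> A * (t - a) powr \<gamma>"
          using True A \<gamma>_pos by (intro mult_left_mono powr_mono2) auto
        then have "ennreal (1 / 2) \<le> (\<integral>\<^sup>+y. ennreal (G (t - s) (x - y)) * indicator (cball 0 r) (x - y) \<partial>lborel)"
          using r by (intro A(2)[OF ts]) simp
        then have "ennreal (c powr (1 + \<eta>)) * ennreal (1 / 2) \<le> ennreal (c powr (1 + \<eta>)) * (\<integral>\<^sup>+y. ennreal (G (t - s) (x - y)) * indicator (cball 0 r) (x - y) \<partial>lborel)"
          by (rule mult_left_mono) simp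
        also have "\<dots> = (\<integral>\<^sup>+y. ennreal (c powr (1 + \<eta>)) * (ennreal (G (t - s) (x - y)) * indicator (cball 0 r) (x - y)) \<partial>lborel)"
        proof (rule nn_integral_cmult[symmetric])
          have "(\<lambda>y. G (t - s) (x - y)) \<in> borel_measurable borel"
            using measurable_compose[OF _ measurable_space[OF ts], of "\<lambda>y. x - y" borel] by simp
          moreover have "(\<lambda>y. indicator (cball 0 r) (x - y) :: ennreal) \<in> borel_measurable borel"
            by (rule measurable_compose[OF _ borel_measurable_indicator[OF borel_closed]]) auto
          ultimately show "(\<lambda>y. ennreal (G (t - s) (x - y)) * indicator (cball 0 r) (x - y)) \<in> borel_measurable lborel"
            by simp
        qed
        also have "ennreal (c powr (1 + \<eta>)) * ennreal (1 / 2) = ennreal (c powr (1 + \<eta>) / 2)"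
          by (subst ennreal_mult[symmetric]) auto
        finally show ?thesis using True by simp
      next
        case False
        then have "indicator {a<..<t} s = (0 :: ennreal)" by (simp add: indicator_def)
        then show ?thesis by (simp only: mult_zero_left mult_zero_right order_refl)
      qed
    qed
    also have "\<dots> \<le> ennreal (LINT \<omega>|M. u t x \<omega>)"
      by (rule global_random_field_mean(2)[OF t a c low])
    finally have "ennreal ((t - a) / 2 * c powr (1 + \<eta>)) \<le> ennreal (LINT \<omega>|M. u t x \<omega>)" .
    \<comment> \<open>Since \<open>ennreal\<close> sends negative numbers to 0, the comparison
      descends to the reals because the left side is positive.\<close>
    moreover have "0 < (t - a) / 2 * c powr (1 + \<eta>)" using a c' by simp
    ultimately show ?thesis by (simp only: ennreal_le_iff2) linarith
  qed
  show ?thesis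
  proof (intro exI[of _ A] conjI allI impI A(1))
    fix c0 T0 W x0 \<rho>
    assume "c0 > 0" "T0 \<ge> 0"
      and "\<forall>t x. T0 < t \<longrightarrow> t \<le> T0 + W \<longrightarrow> norm (x - x0) \<le> \<rho> \<longrightarrow> c0 \<le> (LINT \<omega>|M. u t x \<omega>)"
      and "4 * c0 powr - \<eta> / (1 - 2 powr - \<eta>) < W"
      and "A * (4 * c0 powr - \<eta>) powr \<gamma> / (1 - (2 powr - \<eta>) powr \<gamma>) \<le> \<rho>"
    then show False
      by (intro blow_up[where v="\<lambda>t x. LINT \<omega>|M. u t x \<omega>", OF step \<eta> \<gamma>_pos A(1)]) auto
  qed
qed

text \<open>The kernel has mass 1, so the mean is at least \<open>\<kappa>\<close> at all positive
  times and all points; hence the cylinder can be chosen as large as the blow-up requires.\<close>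

lemma no_global_solution_of_inf_pos:
  assumes "\<kappa> > 0" "\<And>x. \<kappa> \<le> u0 x"
  shows False
proof -
  have base: "\<kappa> \<le> (LINT \<omega>|M. u t x \<omega>)" if t: "t > 0" for t x
  proof -
    have Gx: "(\<lambda>y. G t (x - y)) \<in> borel_measurable borel"
      using measurable_compose[OF _ measurable_space[OF t], of "\<lambda>y. x - y" borel] by simp
    have "ennreal \<kappa> = (\<integral>\<^sup>+y. ennreal \<kappa> * ennreal (G t (x - y)) \<partial>lborel)"
      using Gx by (simp add: nn_integral_cmult mass[OF t])
    also have "\<dots> \<le> (\<integral>\<^sup>+y. ennreal (G t (x - y) * u0 y) \<partial>lborel)"
    proof (rule nn_integral_mono)
      fix y
      have "\<kappa> * G t (x - y) \<le> u0 y * G t (x - y)"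
        by (rule mult_right_mono[OF assms(2) nonneg[OF t]])
      then show "ennreal \<kappa> * ennreal (G t (x - y)) \<le> ennreal (G t (x - y) * u0 y)"
        using assms(1) nonneg[OF t] by (simp add: ennreal_mult[symmetric] mult.commute ennreal_leI)
    qed
    also have "\<dots> \<le> ennreal (LINT \<omega>|M. u t x \<omega>)" by (rule global_random_field_mean(1)[OF t])
    finally show ?thesis using assms(1) by (auto simp: ennreal_le_iff2)
  qed
  obtain A where "A > 0" and *: "\<And>c0 T0 W x0 \<rho>. c0 > 0 \<Longrightarrow> T0 \<ge> 0 \<Longrightarrow>
    (\<And>t x. T0 < t \<Longrightarrow> t \<le> T0 + W \<Longrightarrow> norm (x - x0) \<le> \<rho> \<Longrightarrow> c0 \<le> (LINT \<omega>|M. u t x \<omega>)) \<Longrightarrow>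
    4 * c0 powr - \<eta> / (1 - 2 powr - \<eta>) < W \<Longrightarrow>
    A * (4 * c0 powr - \<eta>) powr \<gamma> / (1 - (2 powr - \<eta>) powr \<gamma>) \<le> \<rho> \<Longrightarrow> False"
    using mean_blow_up by blast
  show False
    \<comment> \<open>The summand 1 makes the duration strictly larger than the total doubling
      time.\<close>
    by (rule *[of \<kappa> 0 "4 * \<kappa> powr - \<eta> / (1 - 2 powr - \<eta>) + 1" 0 "A * (4 * \<kappa> powr - \<eta>) powr \<gamma> / (1 - (2 powr - \<eta>) powr \<gamma>)"])
      (use assms(1) base in auto)
qed

text \<open>For \<open>x\<close> near \<open>T powr \<gamma> *\<^sub>R z\<close>, bounded
  \<open>y\<close> and \<open>t\<close> comparable to \<open>T\<close>, the rescaled point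
  \<open>(x - y) / t powr \<gamma>\<close> lies in the ball where \<open>G 1\<close> is bounded
  below. So \<open>G t (x - y)\<close> is at least of order
  \<open>t powr (- \<gamma> * DIM('a))\<close>, and the mass of \<open>u0\<close> in a fixed ball
  turns this into a bound on the mean.\<close>

lemma mean_lower_self_similar:
  assumes "(\<integral>\<^sup>+x. ennreal (u0 x) \<partial>lborel) > 0"
  shows "\<exists>z e k L T1. e > 0 \<and> k > 0 \<and> L > 0 \<and> T1 > 0 \<and>
    (\<forall>T\<ge>T1. \<forall>t x. T \<le> t \<longrightarrow> t \<le> T + k * T \<longrightarrow> norm (x - z T) \<le> e * T powr \<gamma> \<longrightarrow>
      L * T powr (- \<gamma> * DIM('a)) \<le> (LINT \<omega>|M. u t x \<omega>))"
proof -
  obtain z e c where e: "e > 0" and c: "c > 0" and low: "AE x in lborel. x \<in> ball z e \<longrightarrow> c \<le> G 1 x"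
    using lower_1 by blast
  \<comment> \<open>The integral of \<open>u0\<close> may be infinite. A ball that carries positive
    mass is chosen; its mass is finite because \<open>u0\<close> is bounded.\<close>
  define I where "I n = (\<integral>\<^sup>+y. ennreal (u0 y) * indicator (cball 0 (real n)) y \<partial>lborel)" for n
  have ind_m: "(indicator (cball 0 r) :: 'a \<Rightarrow> ennreal) \<in> borel_measurable borel" for r
    by (intro borel_measurable_indicator borel_closed) simp
  note [measurable] = u0_meas ind_m
  have "\<exists>n. I n > 0"
  proof (rule ccontr)
    assume "\<not> ?thesis"
    then have I0: "I n = 0" for n by (auto simp: not_less)
    have "AE y in lborel. \<forall>n. ennreal (u0 y) * indicator (cball 0 (real n)) y = 0"
    proof (subst AE_all_countable, rule allI)
      fix n
      show "AE y in lborel. ennreal (u0 y) * indicator (cball 0 (real n)) y = 0"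
        using I0[of n] unfolding I_def by (subst (asm) nn_integral_0_iff_AE) auto
    qed
    then have "AE y in lborel. ennreal (u0 y) = 0"
    proof eventually_elim
      case (elim y)
      obtain n :: nat where "norm y \<le> real n" using real_arch_simple by blast
      then show ?case using elim[rule_format, of n] by (simp add: indicator_def)
    qed
    then have "(\<integral>\<^sup>+x. ennreal (u0 x) \<partial>lborel) = (\<integral>\<^sup>+x. 0 \<partial>(lborel :: 'a measure))"
      by (rule nn_integral_cong_AE)
    then show False using assms by simp
  qed
  then obtain n where n: "I n > 0" ..
  obtain B where B: "\<And>y. u0 y \<le> B"
    using u0_bd by (force simp: bounded_iff dest: abs_le_D1)
  have "I n \<le> (\<integral>\<^sup>+y. ennreal B * indicator (cball 0 (real n)) (y::'a) \<partial>lborel)"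
    unfolding I_def using B by (intro nn_integral_mono mult_right_mono ennreal_leI) auto
  also have "\<dots> = ennreal B * emeasure lborel (cball (0::'a) (real n))"
    by (rule nn_integral_cmult_indicator) simp
  also have "\<dots> < \<infinity>" using emeasure_lborel_cball_finite[of "0::'a" "real n"] by (simp add: ennreal_mult_less_top)
  finally obtain m where m: "I n = ennreal m" "m > 0"
    using n by (cases "I n") auto
  define R where "R = real n"
  \<comment> \<open>Chosen so that the centre \<open>t powr \<gamma> *\<^sub>R z\<close> moves by at
    most \<open>e / 4 * T powr \<gamma>\<close> while \<open>t\<close> runs from \<open>T\<close> to
    \<open>(1 + k) * T\<close>; adding 1 to \<open>norm z\<close> allows
    \<open>z = 0\<close>.\<close>
  define k where "k = (1 + e / (4 * (norm z + 1))) powr (1 / \<gamma>) - 1"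
  have ez: "e / (4 * (norm z + 1)) > 0" using e by (simp add: add_nonneg_pos)
  have k: "k > 0" using ez \<gamma>_pos by (simp add: k_def)
  have kg: "(1 + k) powr \<gamma> = 1 + e / (4 * (norm z + 1))"
    using ez \<gamma>_pos by (simp add: k_def powr_powr)
  \<comment> \<open>From \<open>T1\<close> on, the radius \<open>R\<close> of the mass of
    \<open>u0\<close> is below \<open>e / 4 * T powr \<gamma>\<close>.\<close>
  define T1 where "T1 = (4 * (R + 1) / e) powr (1 / \<gamma>)"
  have R0: "R \<ge> 0" by (simp add: R_def)
  have T1: "T1 > 0" using e R0 by (simp add: T1_def)
  define L where "L = (1 + k) powr (- \<gamma> * DIM('a)) * c * m"
  have L: "L > 0" using k c m by (simp add: L_def)
  have main: "L * T powr (- \<gamma> * DIM('a)) \<le> (LINT \<omega>|M. u t x \<omega>)"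
    if T: "T \<ge> T1" and t: "T \<le> t" "t \<le> T + k * T" and x: "norm (x - T powr \<gamma> *\<^sub>R z) \<le> e / 4 * T powr \<gamma>" for T t x
  proof -
    have T0: "T > 0" "t > 0" using T T1 t by auto
    define S where "S = T powr \<gamma>"
    define s where "s = t powr \<gamma>"
    have S0: "S > 0" "s > 0" using T0 by (auto simp: S_def s_def)
    have "T1 powr \<gamma> \<le> S" unfolding S_def using T T1 \<gamma>_pos by (intro powr_mono2) auto
    moreover have "T1 powr \<gamma> = 4 * (R + 1) / e" using e R0 \<gamma>_pos by (simp add: T1_def powr_powr)
    ultimately have RS: "R < e / 4 * S" using e S0 by (simp add: field_simps)
    have Ss: "S \<le> s" unfolding S_def s_def using t T0 \<gamma>_pos by (intro powr_mono2) auto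
    have "s \<le> ((1 + k) * T) powr \<gamma>" unfolding s_def using t T0 \<gamma>_pos k by (intro powr_mono2) (auto simp: algebra_simps)
    also have "\<dots> = (1 + e / (4 * (norm z + 1))) * S" using k T0 by (simp add: powr_mult kg S_def)
    finally have "(s - S) \<le> e / (4 * (norm z + 1)) * S" by (simp add: algebra_simps)
    then have "(s - S) * norm z \<le> e / (4 * (norm z + 1)) * S * norm z"
      by (rule mult_right_mono) simp
    also have "\<dots> = e / 4 * S * (norm z / (norm z + 1))" by simp
    also have "\<dots> \<le> e / 4 * S * 1" using e S0 by (intro mult_left_mono) (auto simp: divide_le_eq add_nonneg_pos)
    finally have zs: "(s - S) * norm z \<le> e / 4 * S" by simp
    have inball: "(1 / s) *\<^sub>R (x - y) \<in> ball z e" if y: "norm y \<le> R" for y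
    proof -
      have "s *\<^sub>R ((1 / s) *\<^sub>R (x - y) - z) = (x - S *\<^sub>R z) - y - (s - S) *\<^sub>R z"
        using S0 by (simp add: algebra_simps)
      then have "s * norm ((1 / s) *\<^sub>R (x - y) - z) = norm ((x - S *\<^sub>R z) - y - (s - S) *\<^sub>R z)"
        using S0 by (metis norm_scaleR abs_of_pos)
      also have "\<dots> \<le> norm (x - S *\<^sub>R z) + norm y + (s - S) * norm z"
        using norm_triangle_ineq4[of "(x - S *\<^sub>R z) - y" "(s - S) *\<^sub>R z"] norm_triangle_ineq4[of "x - S *\<^sub>R z" y] Ss
        by simp
      \<comment> \<open>The three quarters are the offset of \<open>x\<close>, the size of
        \<open>y\<close>, and the movement of the centre.\<close>
      also have "\<dots> < e / 4 * S + e / 4 * S + e / 4 * S"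
        using x[folded S_def] y RS zs by linarith
      also have "\<dots> \<le> e * S" using e S0 by simp
      also have "\<dots> \<le> e * s" using Ss e by simp
      finally have "norm ((1 / s) *\<^sub>R (x - y) - z) < e" using S0 by (simp add: mult.commute)
      then show ?thesis by (simp add: dist_norm norm_minus_commute)
    qed
    have tinv: "t powr - \<gamma> = 1 / s" by (simp add: s_def powr_minus divide_inverse)
    have tlow: "((1 + k) * T) powr (- \<gamma> * DIM('a)) \<le> t powr (- \<gamma> * DIM('a))"
      using t T0 k \<gamma>_pos by (intro powr_mono2') (auto simp: algebra_simps)
    have "AE y in lborel. (1 / s) *\<^sub>R x + (- (1 / s)) *\<^sub>R y \<in> ball z e \<longrightarrow> c \<le> G 1 ((1 / s) *\<^sub>R x + (- (1 / s)) *\<^sub>R y)"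
      by (rule AE_lborel_affine[OF low]) (use S0 in simp)
    then have ae: "AE y in lborel. norm y \<le> R \<longrightarrow> ((1 + k) * T) powr (- \<gamma> * DIM('a)) * c \<le> G t (x - y)"
    proof eventually_elim
      case (elim y)
      have *: "(1 / s) *\<^sub>R x + (- (1 / s)) *\<^sub>R y = (1 / s) *\<^sub>R (x - y)" by (simp add: algebra_simps)
      show ?case
      proof
        assume "norm y \<le> R"
        then have "c \<le> G 1 ((1 / s) *\<^sub>R (x - y))" using elim inball unfolding * by blast
        then have "((1 + k) * T) powr (- \<gamma> * DIM('a)) * c \<le> t powr (- \<gamma> * DIM('a)) * G 1 ((1 / s) *\<^sub>R (x - y))"
          using tlow c by (intro mult_mono) auto
        then show "((1 + k) * T) powr (- \<gamma> * DIM('a)) * c \<le> G t (x - y)"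
          using scaling[OF T0(2), of "x - y"] tinv by simp
      qed
    qed
    have "L * T powr (- \<gamma> * DIM('a)) = ((1 + k) * T) powr (- \<gamma> * DIM('a)) * c * m"
      using k T0 by (simp add: L_def powr_mult)
    then have "ennreal (L * T powr (- \<gamma> * DIM('a))) = ennreal (((1 + k) * T) powr (- \<gamma> * DIM('a)) * c) * I n"
      using c m by (simp add: ennreal_mult)
    also have "\<dots> = (\<integral>\<^sup>+y. ennreal (((1 + k) * T) powr (- \<gamma> * DIM('a)) * c) * (ennreal (u0 y) * indicator (cball 0 R) y) \<partial>lborel)"
      unfolding I_def R_def by (rule nn_integral_cmult[symmetric]) simp
    also have "\<dots> \<le> (\<integral>\<^sup>+y. ennreal (G t (x - y) * u0 y) \<partial>lborel)"
    proof (rule nn_integral_mono_AE, use ae in eventually_elim)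
      case (elim y)
      show ?case
      proof (cases "norm y \<le> R")
        case True
        then have "ennreal (((1 + k) * T) powr (- \<gamma> * DIM('a)) * c * u0 y) \<le> ennreal (G t (x - y) * u0 y)"
          using elim u0_nn[of y] by (intro ennreal_leI mult_right_mono) auto
        then show ?thesis using True c u0_nn[of y] by (simp add: ennreal_mult)
      qed (simp add: indicator_def)
    qed
    also have "\<dots> \<le> ennreal (LINT \<omega>|M. u t x \<omega>)" by (rule global_random_field_mean(1)[OF T0(2)])
    finally have "ennreal (L * T powr (- \<gamma> * DIM('a))) \<le> ennreal (LINT \<omega>|M. u t x \<omega>)" .
    moreover have "0 < L * T powr (- \<gamma> * DIM('a))" using L T0 by simp
    ultimately show ?thesis by (simp only: ennreal_le_iff2) linarith
  qed
  show ?thesis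
    by (intro exI[of _ "\<lambda>T. T powr \<gamma> *\<^sub>R z"] exI[of _ "e / 4"] exI[of _ k] exI[of _ L] exI[of _ T1] conjI allI impI)
      (use e k L T1 main in auto)
qed

text \<open>Starting from a bound of order \<open>T powr (- \<gamma> * DIM('a))\<close>, blow-up
  needs a time of order \<open>T powr \<theta>\<close> and a radius of order
  \<open>T powr (\<gamma> * \<theta>)\<close>, against the available \<open>k * T\<close> and
  \<open>e * T powr \<gamma>\<close>. The single condition \<open>\<theta> < 1\<close> makes both
  fit for large \<open>T\<close>.\<close>

lemma no_global_solution_of_subcritical:
  assumes u0: "(\<integral>\<^sup>+x. ennreal (u0 x) \<partial>lborel) > 0" and sub: "\<gamma> * DIM('a) * \<eta> < 1"
  shows False
proof -
  obtain z e k L T1 where p: "e > 0" "k > 0" "L > 0" "T1 > 0" and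
    low: "\<And>T t x. T \<ge> T1 \<Longrightarrow> T \<le> t \<Longrightarrow> t \<le> T + k * T \<Longrightarrow> norm (x - z T) \<le> e * T powr \<gamma> \<Longrightarrow>
      L * T powr (- \<gamma> * DIM('a)) \<le> (LINT \<omega>|M. u t x \<omega>)"
    using mean_lower_self_similar[OF u0] by metis
  obtain A where A: "A > 0" and *: "\<And>c0 T0 W x0 \<rho>. c0 > 0 \<Longrightarrow> T0 \<ge> 0 \<Longrightarrow>
    (\<And>t x. T0 < t \<Longrightarrow> t \<le> T0 + W \<Longrightarrow> norm (x - x0) \<le> \<rho> \<Longrightarrow> c0 \<le> (LINT \<omega>|M. u t x \<omega>)) \<Longrightarrow>
    4 * c0 powr - \<eta> / (1 - 2 powr - \<eta>) < W \<Longrightarrow>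
    A * (4 * c0 powr - \<eta>) powr \<gamma> / (1 - (2 powr - \<eta>) powr \<gamma>) \<le> \<rho> \<Longrightarrow> False"
    using mean_blow_up by blast
  define \<theta> where "\<theta> = \<gamma> * DIM('a) * \<eta>"
  define q where "q = (2::real) powr - \<eta>"
  have q: "0 < q" "q < 1" using \<eta> by (auto simp: q_def intro: powr_less_one)
  have qg: "q powr \<gamma> < 1" using q \<gamma>_pos powr_less_mono2[of \<gamma> q 1] by auto
  \<comment> \<open>With these constants the required duration is
    \<open>k * C1 * T powr \<theta>\<close> and the required radius
    \<open>e * C2 * T powr (\<gamma> * \<theta>)\<close>.\<close>
  define C1 where "C1 = 4 * L powr - \<eta> / (1 - q) / k"
  define C2 where "C2 = A * (4 * L powr - \<eta>) powr \<gamma> / (1 - q powr \<gamma>) / e"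
  have top: "filterlim (\<lambda>T::real. T powr s) at_top at_top" if "s > 0" for s
  proof -
    have "filterlim (\<lambda>T. exp (s * ln T)) at_top at_top"
      by (intro filterlim_compose[OF exp_at_top] filterlim_tendsto_pos_mult_at_top[OF tendsto_const that] ln_at_top)
    moreover have "\<forall>\<^sub>F T in at_top. exp (s * ln T) = T powr s"
      using eventually_gt_at_top[of 0] by eventually_elim (simp add: powr_def)
    ultimately show ?thesis by (rule filterlim_mono_eventually[OF _ order_refl order_refl])
  qed
  have "\<forall>\<^sub>F T in at_top. T1 \<le> T \<and> C1 < T powr (1 - \<theta>) \<and> C2 < T powr (\<gamma> * (1 - \<theta>))"
    using top[of "1 - \<theta>"] top[of "\<gamma> * (1 - \<theta>)"] sub \<gamma>_pos
    by (intro eventually_conj eventually_ge_at_top) (auto simp: filterlim_at_top_dense \<theta>_def)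
  then obtain T where T: "T1 \<le> T" "C1 < T powr (1 - \<theta>)" "C2 < T powr (\<gamma> * (1 - \<theta>))"
    using eventually_happens'[OF trivial_limit_at_top_linorder] by blast
  have T0: "T > 0" using T p by simp
  define c0 where "c0 = L * T powr (- \<gamma> * DIM('a))"
  have c0: "c0 > 0" using p T0 by (simp add: c0_def)
  have c0p: "c0 powr - \<eta> = L powr - \<eta> * T powr \<theta>"
    using p T0 by (simp add: c0_def powr_mult powr_powr \<theta>_def)
  show False
  proof (rule *[OF c0, of T "k * T" "z T" "e * T powr \<gamma>"])
    show "0 \<le> T" using T0 by simp
    show "c0 \<le> (LINT \<omega>|M. u t x \<omega>)" if "T < t" "t \<le> T + k * T" "norm (x - z T) \<le> e * T powr \<gamma>" for t x
      unfolding c0_def by (rule low) (use that T in auto)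
    have "4 * c0 powr - \<eta> / (1 - q) = k * (C1 * T powr \<theta>)"
      using p by (simp add: C1_def c0p)
    also have "\<dots> < k * (T powr (1 - \<theta>) * T powr \<theta>)"
      using p T T0 by (intro mult_strict_left_mono mult_strict_right_mono) auto
    also have "\<dots> = k * T" using T0 by (simp add: powr_add[symmetric])
    finally show "4 * c0 powr - \<eta> / (1 - 2 powr - \<eta>) < k * T" by (simp add: q_def)
    have "A * (4 * c0 powr - \<eta>) powr \<gamma> / (1 - q powr \<gamma>) = e * (C2 * T powr (\<gamma> * \<theta>))"
      using p T0 by (simp add: C2_def c0p powr_mult powr_powr mult_ac)
    also have "\<dots> \<le> e * (T powr (\<gamma> * (1 - \<theta>)) * T powr (\<gamma> * \<theta>))"
      using p T T0 by (intro mult_left_mono mult_right_mono) auto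
    also have "\<dots> = e * T powr \<gamma>" using T0 by (simp add: powr_add[symmetric] algebra_simps)
    finally show "A * (4 * c0 powr - \<eta>) powr \<gamma> / (1 - (2 powr - \<eta>) powr \<gamma>) \<le> e * T powr \<gamma>"
      by (simp add: q_def)
  qed
qed

end

end

theorem theorem1p14:
  fixes \<nu> \<alpha> \<beta> \<eta> \<kappa> :: real
    and \<sigma> b :: "real \<Rightarrow> real"
    and u0 :: "'a::euclidean_space \<Rightarrow> real"
    and p :: "real \<Rightarrow> 'a \<Rightarrow> real"
    and N :: "'v measure" and D :: "real \<Rightarrow> 'v \<Rightarrow> real" and fE :: "real \<Rightarrow> real \<Rightarrow> real"
    and M :: "'w measure" and C :: "'a correlation" and F :: "(real \<times> 'a) set \<Rightarrow> 'w \<Rightarrow> real"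
  assumes "\<nu> > 0" and "0 < \<beta>" "\<beta> < 1" and "0 < \<alpha>" "\<alpha> < 2"
    and "\<exists>L. L-lipschitz_on UNIV \<sigma>"
    and "\<And>x. \<exists>r>0. \<exists>L. L-lipschitz_on (cball x r) b"
    and "\<eta> > 0" and "\<And>x. b x \<ge> \<bar>x\<bar> powr (1 + \<eta>)"
    and "u0 \<in> borel_measurable borel" and "\<And>x. 0 \<le> u0 x" and "bounded (range u0)"
    and "stable_density \<nu> \<alpha> p"
    and "stable_subordinator \<beta> N D" and "first_passage_density N D fE"
    and "admissible_correlation \<alpha> \<beta> C" and "gaussian_noise M C F"
  shows "((INF x. u0 x) > \<kappa> \<and> \<kappa> > 0 \<longrightarrow>
            \<not> (\<exists>u. global_random_field_solution M C F (kernel_G p fE) b \<sigma> u0 u)) \<and>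
         ((\<integral>\<^sup>+x. ennreal \<bar>u0 x\<bar> \<partial>lborel) > 0 \<and> \<beta> * real DIM('a) * \<eta> / \<alpha> < 1 \<longrightarrow>
            \<not> (\<exists>u. global_random_field_solution M C F (kernel_G p fE) b \<sigma> u0 u))"
proof -
  interpret self_similar_kernel "kernel_G p fE" "\<beta> / \<alpha>"
    by (rule self_similar_kernel_G) (use assms in auto)
  \<comment> \<open>The local Lipschitz condition enters as continuity, which makes
    \<open>b (u s y \<omega>)\<close> measurable for Tonelli.\<close>
  have b_cont: "continuous_on UNIV b"
  proof (rule continuous_at_imp_continuous_on, rule ballI)
    fix x
    obtain r L where r: "r > 0" "L-lipschitz_on (cball x r) b" using assms(7) by blast
    have "continuous_on (cball x r) b" by (rule lipschitz_on_continuous_on[OF r(2)])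
    then show "isCont b x" by (rule continuous_on_interior) (use r in simp)
  qed
  note hyps = \<open>gaussian_noise M C F\<close> b_cont assms(9) \<open>\<eta> > 0\<close> assms(10,11,12)
  show ?thesis
  proof (intro conjI impI notI; elim conjE exE)
    fix u assume \<kappa>: "\<kappa> < (INF x. u0 x)" "\<kappa> > 0"
      and sol: "global_random_field_solution M C F (kernel_G p fE) b \<sigma> u0 u"
    have "bdd_below (range u0)" using assms(11) by (auto intro!: bdd_belowI[of _ 0])
    then have "\<kappa> \<le> u0 x" for x using \<kappa>(1) cINF_lower[of u0 UNIV x] by simp
    then show False by (rule no_global_solution_of_inf_pos[OF hyps sol \<kappa>(2)])
  next
    fix u assume "0 < (\<integral>\<^sup>+x. ennreal \<bar>u0 x\<bar> \<partial>lborel)" "\<beta> * real DIM('a) * \<eta> / \<alpha> < 1"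
      and sol: "global_random_field_solution M C F (kernel_G p fE) b \<sigma> u0 u"
    then show False
      by (intro no_global_solution_of_subcritical[OF hyps sol]) (use assms(11) in \<open>auto simp: abs_of_nonneg\<close>)
  qed
qed

end
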